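(* Let $r\in\{0,1,2,3,4\}$ and let $w$ be a positive even integer. Let $f_w=\sum_{n\ge 0}a(n)q^n$ be the normalized extremal quasimodular form of weight $w$ and depth $\le r$. Then every coefficient $a(n)$ is rational and the denominator of every $a(n)$ (in lowest terms) is divisible only by primes $p<w$.
   Context: $\mathcal{M}_k$ denotes the space of holomorphic modular forms of weight $k$ for $\mathrm{PSL}(2,\mathbb{Z})$ (holomorphic also at $i\infty$; $\mathcal{M}_k=0$ for $k<0$). $E_2=1-24\sum_{n\ge1}\sigma_1(n)q^n$, $q=e^{2\pi i z}$. The space of quasimodular forms of weight $w$ and depth $\le r$ is $\mathcal{QM}_w^r=\bigoplus_{\ell=0}^r E_2^\ell\mathcal{M}_{w-2\ell}$. A nonzero $f\in\mathcal{QM}_w^r$ is called extremal if its vanishing order at $i\infty$ (the smallest $n$ with nonzero $q^n$-coefficient) equals $\dim\mathcal{QM}_w^r-1$, which for $r\le 4$ is the maximal possible vanishing order; it is normalized if its leading (lowest-order nonzero) Fourier coefficient equals $1$. *)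

theory Defs
  imports "HOL-Complex_Analysis.Complex_Analysis" "HOL-Library.Function_Algebras"
begin

definition upper_half_plane :: "complex set" (\<open>\<H>\<close>) where
  "\<H> = {z. Im z > 0}"

definition to_nome :: "complex \<Rightarrow> complex" where
  "to_nome z = exp (2 * of_real pi * \<i> * z)"

definition has_q_expansion :: "(complex \<Rightarrow> complex) \<Rightarrow> complex fps \<Rightarrow> bool" where
  "has_q_expansion f F \<longleftrightarrow> (\<forall>z\<in>\<H>. (\<lambda>n. fps_nth F n * to_nome z ^ n) sums f z)"

lemma has_q_expansion_unique:
  assumes "has_q_expansion f F" "has_q_expansion f G"
  shows   "F = G"
proof -
  have nome: "\<exists>z\<in>\<H>. to_nome z = q" if "q \<noteq> 0" "norm q < 1" for q
  proof -
    define z where "z = Ln q / (2 * of_real pi * \<i>)"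
    have "Im z = - ln (norm q) / (2 * pi)"
      using that by (simp add: z_def Im_divide power2_eq_square)
    moreover have "ln (norm q) < 0"
      using that by simp
    ultimately have "z \<in> \<H>"
      by (simp add: upper_half_plane_def divide_neg_pos)
    moreover have "to_nome z = q"
      using that by (simp add: to_nome_def z_def)
    ultimately show ?thesis by blast
  qed
  define D where "D = F - G"
  have D: "(\<lambda>n. fps_nth D n * q ^ n) sums 0" if "q \<noteq> 0" "norm q < 1" for q
  proof -
    from nome[OF that] obtain z where z: "z \<in> \<H>" "to_nome z = q"
      by blast
    have "(\<lambda>n. fps_nth F n * q ^ n - fps_nth G n * q ^ n) sums (f z - f z)"
      using assms z unfolding has_q_expansion_def by (intro sums_diff) auto
    thus ?thesis by (simp add: D_def algebra_simps)
  qed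
  have "fps_conv_radius D \<ge> norm (1/2 :: complex)"
    unfolding fps_conv_radius_def
    by (rule conv_radius_geI) (use D[of "1/2"] in \<open>auto simp: sums_iff\<close>)
  hence radius: "fps_conv_radius D > 0"
    by (rule less_le_trans[rotated]) auto
  have ev0: "eval_fps D q = 0" if "q \<noteq> 0" "norm q < 1" for q
    using D[OF that] by (simp add: eval_fps_def sums_iff)
  have "(\<lambda>_ :: complex. 0) \<midarrow>0\<rightarrow> fps_nth D 0"
    by (rule powser_limit_0_strong[where s = 1 and a = "fps_nth D" and f = "\<lambda>_. 0"]) (use D in auto)
  hence "fps_nth D 0 = 0"
    by (metis LIM_const_eq)
  hence "eval_fps D q = 0" if "norm q < 1" for q
    using ev0[of q] that by (cases "q = 0") (auto simp: eval_fps_at_0)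
  hence "eventually (\<lambda>q. eval_fps D q = eval_fps 0 q) (nhds 0)"
    using eventually_nhds_in_open[of "ball 0 1" "0 :: complex"]
    by (auto elim!: eventually_mono)
  hence "D = 0"
    using radius by (intro eval_fps_eqD) auto
  thus ?thesis by (simp add: D_def)
qed

definition q_expansion :: "(complex \<Rightarrow> complex) \<Rightarrow> complex fps" where
  "q_expansion f = (THE F. has_q_expansion f F)"

lemma q_expansion_eqI: "has_q_expansion f F \<Longrightarrow> q_expansion f = F"
  unfolding q_expansion_def using has_q_expansion_unique by blast

text \<open>
  Functions on the upper half plane are represented by total functions that are 0 outside it,
  so that equality and linear (in)dependence of functions have their usual meaning. The existence
  of a convergent power series in \<open>q\<close> is holomorphy at \<open>\<i>\<infinity>\<close>.
  Weights are integers since \<open>w - 2 * l\<close> below may be negative.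
\<close>
definition modular_forms :: "int \<Rightarrow> (complex \<Rightarrow> complex) set" where
  "modular_forms k = {f.
     f holomorphic_on \<H> \<and>
     (\<forall>z. z \<notin> \<H> \<longrightarrow> f z = 0) \<and>
     (\<forall>a b c d :: int. a * d - b * c = 1 \<longrightarrow>
        (\<forall>z\<in>\<H>. f ((of_int a * z + of_int b) / (of_int c * z + of_int d)) =
                 (of_int c * z + of_int d) powi k * f z)) \<and>
     (\<exists>F. has_q_expansion f F)}"

definition sigma1 :: "nat \<Rightarrow> nat" where
  "sigma1 n = (\<Sum>d | d dvd n. d)"

definition E2 :: "complex \<Rightarrow> complex" where
  "E2 z = 1 - 24 * (\<Sum>n. of_nat (sigma1 (Suc n)) * to_nome z ^ Suc n)"

text \<open>
  No restriction of \<open>E2\<close> to the upper half plane is needed: it is only used there, as the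
  modular forms it is multiplied with vanish elsewhere.
\<close>
definition quasimodular_forms :: "nat \<Rightarrow> nat \<Rightarrow> (complex \<Rightarrow> complex) set" where
  "quasimodular_forms w r =
     {(\<lambda>z. \<Sum>l\<le>r. E2 z ^ l * g l z) | g. \<forall>l\<le>r. g l \<in> modular_forms (int w - 2 * int l)}"

global_interpretation cfun: vector_space "\<lambda>(c::complex) (f::complex \<Rightarrow> complex) z. c * f z"
  defines cfun_dim = cfun.dim
  by unfold_locales (auto simp: fun_eq_iff algebra_simps)

text \<open>
  For \<open>f \<noteq> 0\<close>, \<^const>\<open>subdegree\<close> of the \<open>q\<close>-expansion is the vanishing order at \<open>\<i>\<infinity>\<close>;
  it is required to be the dimension minus 1.
\<close>
definition extremal :: "nat \<Rightarrow> nat \<Rightarrow> (complex \<Rightarrow> complex) \<Rightarrow> bool" where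
  "extremal w r f \<longleftrightarrow> f \<in> quasimodular_forms w r \<and> f \<noteq> 0 \<and>
     Suc (subdegree (q_expansion f)) = cfun_dim (quasimodular_forms w r)"

definition normalized :: "(complex \<Rightarrow> complex) \<Rightarrow> bool" where
  "normalized f \<longleftrightarrow> fps_nth (q_expansion f) (subdegree (q_expansion f)) = 1"

end

theory Submission
  imports Defs "Berlekamp_Zassenhaus.Finite_Field" "Jordan_Normal_Form.Determinant"
begin

text \<open>
  By the structure theorem, quasimodular forms of weight \<open>w\<close> and depth at most \<open>r\<close> have a basis of
  products of \<open>E\<^sub>2\<close>, \<open>E\<^sub>4\<close>, \<open>E\<^sub>6\<close>. If this basis has \<open>m\<close> elements, its first \<open>m\<close> Fourier coefficients
  form an integer matrix \<open>A\<close>, and an extremal form has coordinates in \<open>\<int> / det A\<close>. It remains to see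
  that no prime \<open>p > w\<close> divides \<open>det A\<close>, i.e. that over a field of characteristic \<open>p\<close> a nonzero
  isobaric polynomial \<open>G\<close> in \<open>E\<^sub>2\<close>, \<open>E\<^sub>4\<close>, \<open>E\<^sub>6\<close> has a nonzero \<open>q\<close>-series, of order less than \<open>m\<close>.

  For the order, Ramanujan's identities turn the coefficients of the iterated derivatives of \<open>G\<close> into a
  Wronskian, which is a nonzero modular form of weight \<open>(r + 1) w\<close> vanishing at least to the order of
  the \<open>q\<close>-series of \<open>G\<close>; for \<open>r \<le> 4\<close> such a form has order less than \<open>m\<close>. If, on the other hand, the
  \<open>q\<close>-series of some \<open>G \<noteq> 0\<close> vanishes, then one of least depth has depth 1, so that \<open>E\<^sub>2\<close> is a
  quotient \<open>N / M\<close> of modular forms modulo \<open>p\<close>. Choosing \<open>M\<close> of least weight \<open>k\<close>, one finds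
  \<open>k \<equiv> -1\<close> modulo \<open>p\<close> and that \<open>M\<close> divides the leading coefficient of every such \<open>G\<close>, so \<open>w \<ge> p\<close>.
\<close>

text \<open>Some bound on the weight in terms of \<open>p\<close> is unavoidable: modulo a prime
  \<open>p >= 5\<close> one has \<open>E_{p-1} = 1\<close> and \<open>E_{p+1} = E_2\<close>, so
  \<open>E_2 * E_{p-1} - E_{p+1}\<close> is a nonzero isobaric polynomial of weight
  \<open>p + 1\<close> with vanishing q-series. Both halves rest on one fact that survives in
  characteristic \<open>p\<close>: the derivation \<open>q d/dq\<close> kills constant terms, so no
  nonzero constant is the derivative of a quotient of power series. Applied to two Taylor
  coefficients at \<open>E_2\<close> of a relation, it excludes least depth 2 or more; applied to
  neighbouring coefficients of a vector, it excludes gaps and hence a vanishing Wronskian. The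
  constants that arise are integers between 1 and \<open>w\<close>, which is one way in which
  \<open>p > w\<close> enters. The algebra uses only Ramanujan's three identities and a few
  coefficients, so that it serves the complex numbers and the prime fields alike. The identities
  themselves come from the transformation law of \<open>E_2\<close> over the complex numbers and
  pass to other fields through integral power series.\<close>

hide_const (open) up_ring.coeff up_ring.monom module.smult

section \<open>The ring of modular forms as a ring of power series\<close>

lemma fps_XD_mult: "fps_XD (x * y) = fps_XD x * y + x * fps_XD (y :: 'a::comm_ring_1 fps)"
  by (simp add: fps_XD_def algebra_simps)

lemma fps_XD_0 [simp]: "fps_XD 0 = 0"
  by (simp add: fps_XD_def)

lemma fps_XD_const [simp]: "fps_XD (fps_const c) = 0"
  by (simp add: fps_XD_def)

lemma fps_XD_numeral [simp]: "fps_XD (numeral n :: 'a::comm_ring_1 fps) = 0"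
  by (simp add: fps_XD_def fps_numeral_fps_const)

lemma fps_XD_1 [simp]: "fps_XD (1 :: 'a::comm_ring_1 fps) = 0"
  by (simp add: fps_XD_def)

text \<open>
  Over a field of any characteristic no logarithm of \<open>q\<close> is a ratio of power series, since
  \<^const>\<open>fps_XD\<close> annihilates constant terms.
\<close>
lemma fps_XD_quotient_ne_const:
  fixes v1 v2 :: "'a::field fps"
  assumes "v1 * fps_XD v2 - v2 * fps_XD v1 = fps_const c * v1 ^ 2" and "v1 \<noteq> 0"
  shows "c = 0"
proof -
  define s where "s = subdegree v1"
  define u where "u = fps_shift s v1"
  have v1: "v1 = fps_X ^ s * u"
    unfolding s_def u_def using subdegree_decompose[of v1] by (simp add: mult.commute)
  have u0: "fps_nth u 0 \<noteq> 0"
    using assms(2) by (simp add: u_def s_def)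
  define x where "x = v2 / u"
  have v2: "v2 = x * u"
    using u0 by (simp add: x_def fps_divide_unit mult.assoc inverse_mult_eq_1)
  have DX: "fps_XD (fps_X ^ s :: 'a fps) = of_nat s * fps_X ^ s"
    by (rule fps_ext) (auto simp: fps_XD_nth fps_X_power_nth fps_of_nat [symmetric])
  have "v1 * fps_XD v2 - v2 * fps_XD v1 = (fps_X ^ s * u ^ 2) * (fps_XD x - of_nat s * x)"
    unfolding v1 v2 by (simp add: fps_XD_mult DX algebra_simps power2_eq_square)
  moreover have "fps_const c * v1 ^ 2 = (fps_X ^ s * u ^ 2) * (fps_const c * fps_X ^ s)"
    unfolding v1 by (simp add: algebra_simps power2_eq_square)
  moreover have "fps_X ^ s * u ^ 2 \<noteq> 0"
    using u0 by auto
  ultimately have "fps_XD x - of_nat s * x = fps_const c * fps_X ^ s"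
    using assms(1) by (metis mult_left_cancel)
  \<comment> \<open>At \<open>q^s\<close> the left side is \<open>s * x_s - s * x_s = 0\<close> in
    every characteristic, while the right side is \<open>c\<close>.\<close>
  hence "fps_nth (fps_XD x - of_nat s * x) s = fps_nth (fps_const c * fps_X ^ s) s"
    by simp
  thus ?thesis
    by (simp add: fps_XD_nth fps_X_power_nth fps_of_nat [symmetric])
qed

lemma fps_XD_quotient_ne_const':
  fixes v1 v2 :: "'a::field fps"
  assumes "12 * (v1 * fps_XD v2 - v2 * fps_XD v1) = fps_const c * v1 ^ 2" and "v1 \<noteq> 0"
  shows "c = 0"
proof (rule fps_XD_quotient_ne_const)
  show "v1 * fps_XD (12 * v2) - 12 * v2 * fps_XD v1 = fps_const c * v1 ^ 2"
    unfolding assms(1) [symmetric] by (simp add: fps_XD_mult right_diff_distrib mult.assoc mult.left_commute)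
qed fact

text \<open>The letters stand for \<open>E2\<close>, \<open>E4\<close>, \<open>E6\<close> over an
  arbitrary field. Ramanujan's identities are cleared of denominators so that they make sense in
  every characteristic; for the Eisenstein series the value in \<open>disc1\<close> is 1728, hence
  the last assumption excludes characteristics 2 and 3.\<close>

locale ramanujan =
  fixes P Q R :: "'a::field fps"
  assumes P0: "fps_nth P 0 = 1" and Q0: "fps_nth Q 0 = 1" and R0: "fps_nth R 0 = 1"
    and DP: "12 * fps_XD P = P ^ 2 - Q"
    and DQ: "3 * fps_XD Q = P * Q - R"
    and DR: "2 * fps_XD R = P * R - Q ^ 2"
    and disc1: "fps_nth (Q ^ 3 - R ^ 2) 1 \<noteq> 0"
begin

abbreviation "D \<equiv> (fps_XD :: 'a fps \<Rightarrow> 'a fps)"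

section \<open>The graded ring generated by \<open>Q\<close> and \<open>R\<close>\<close>

definition disc :: "'a fps" where "disc = Q ^ 3 - R ^ 2"

text \<open>The elements are power series, not polynomials in \<open>Q\<close> and \<open>R\<close>;
  the induction rule runs through the terms of one representation. Integer weights allow the descent
  from \<open>k\<close> to \<open>k - 12\<close> to pass below zero, where only 0 is left.\<close>

inductive_set MF :: "int \<Rightarrow> 'a fps set" for k :: int where
  zero: "0 \<in> MF k"
| step: "x \<in> MF k \<Longrightarrow> 4 * int a + 6 * int b = k \<Longrightarrow> fps_const c * Q ^ a * R ^ b + x \<in> MF k"

lemma MF_monom: "4 * int a + 6 * int b = k \<Longrightarrow> Q ^ a * R ^ b \<in> MF k"
  using MF.step[OF MF.zero, of a b k 1] by simp

lemma MF_add: "x \<in> MF k \<Longrightarrow> y \<in> MF k \<Longrightarrow> x + y \<in> MF k"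
  by (induction rule: MF.induct) (auto simp: add.assoc intro: MF.step)

lemma MF_scale: "x \<in> MF k \<Longrightarrow> fps_const c * x \<in> MF k"
proof (induction rule: MF.induct)
  case (step x a b d)
  have "fps_const c * (fps_const d * Q ^ a * R ^ b + x) =
        fps_const (c * d) * Q ^ a * R ^ b + fps_const c * x"
    by (simp add: algebra_simps flip: fps_const_mult)
  thus ?case using step by (auto intro: MF.step)
qed (auto intro: MF.zero)

lemma MF_of_int: "x \<in> MF k \<Longrightarrow> of_int n * x \<in> MF k"
  using MF_scale[of x k "of_int n"] by (simp add: fps_of_int)

lemma MF_of_nat: "x \<in> MF k \<Longrightarrow> of_nat n * x \<in> MF k"
  using MF_of_int[of x k "int n"] by simp

lemma MF_numeral: "x \<in> MF k \<Longrightarrow> numeral n * x \<in> MF k"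
  using MF_of_int[of x k "numeral n"] by simp

lemma MF_uminus: "x \<in> MF k \<Longrightarrow> - x \<in> MF k"
  using MF_of_int[of x k "-1"] by simp

lemma MF_diff: "x \<in> MF k \<Longrightarrow> y \<in> MF k \<Longrightarrow> x - y \<in> MF k"
  using MF_add[OF _ MF_uminus] by fastforce

lemma MF_sum: "(\<And>i. i \<in> A \<Longrightarrow> f i \<in> MF k) \<Longrightarrow> sum f A \<in> MF k"
  by (induction A rule: infinite_finite_induct) (auto intro: MF_add MF.zero)

lemma MF_mult: "x \<in> MF k \<Longrightarrow> y \<in> MF l \<Longrightarrow> x * y \<in> MF (k + l)"
proof (induction rule: MF.induct)
  case (step x a b c)
  from \<open>y \<in> MF l\<close> have "fps_const c * Q ^ a * R ^ b * y \<in> MF (k + l)"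
  proof (induction rule: MF.induct)
    case (step y a' b' c')
    have "fps_const c * Q ^ a * R ^ b * (fps_const c' * Q ^ a' * R ^ b' + y) =
      fps_const (c * c') * Q ^ (a + a') * R ^ (b + b') + fps_const c * Q ^ a * R ^ b * y"
      by (simp add: algebra_simps power_add flip: fps_const_mult)
    with step \<open>4 * int a + 6 * int b = k\<close> show ?case
      by (auto intro!: MF.step)
  qed (auto intro: MF.zero)
  thus ?case using step by (auto simp: distrib_right intro: MF_add)
qed (auto intro: MF.zero)

lemma one_MF: "1 \<in> MF 0"
  using MF_monom[of 0 0 0] by simp

lemma Q_MF: "Q \<in> MF 4"
  using MF_monom[of 1 0 4] by simp

lemma R_MF: "R \<in> MF 6"
  using MF_monom[of 0 1 6] by simp

lemma MF_prod: "finite A \<Longrightarrow> (\<And>i. i \<in> A \<Longrightarrow> f i \<in> MF (k i)) \<Longrightarrow> prod f A \<in> MF (sum k A)"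
  by (induction A rule: finite_induct) (auto intro: MF_mult one_MF)

lemma MF_power: "x \<in> MF k \<Longrightarrow> x ^ n \<in> MF (int n * k)"
  by (induction n) (auto intro: one_MF simp: algebra_simps dest: MF_mult)

lemma disc_MF: "disc \<in> MF 12"
  unfolding disc_def using MF_power[OF Q_MF, of 3] MF_power[OF R_MF, of 2] by (auto intro: MF_diff)

lemma disc_0: "fps_nth disc 0 = 0"
  by (simp add: disc_def fps_nth_power_0 Q0 R0)

lemma disc_neq_0: "disc \<noteq> 0"
  using disc1 by (auto simp: disc_def)

lemma subdegree_disc: "subdegree disc = 1"
  using disc1 disc_0 by (intro subdegreeI) (auto simp: disc_def)

lemma MF_nontrivial: "x \<in> MF k \<Longrightarrow> x \<noteq> 0 \<Longrightarrow> \<exists>a b. 4 * int a + 6 * int b = k"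
  by (induction rule: MF.induct) auto

text \<open>Twelve times the Serre derivative. The multiple of \<open>P\<close> makes up for the
  failure of \<open>D\<close> to map forms to forms: by \<open>theta_Q\<close> and
  \<open>theta_R\<close> the generators go to forms, and the product rule does the rest.\<close>

definition theta :: "int \<Rightarrow> 'a fps \<Rightarrow> 'a fps" where
  "theta k x = 12 * D x - of_int k * P * x"

lemma theta_mult: "theta (k + l) (x * y) = theta k x * y + x * theta l y"
  by (simp add: theta_def fps_XD_mult algebra_simps)

lemma theta_Q: "theta 4 Q = - 4 * R"
proof -
  have "theta 4 Q = 4 * (3 * D Q) - 4 * P * Q" by (simp add: theta_def)
  thus ?thesis unfolding DQ by (simp add: algebra_simps)
qed

lemma theta_R: "theta 6 R = - 6 * Q ^ 2"
proof -
  have "theta 6 R = 6 * (2 * D R) - 6 * P * R" by (simp add: theta_def)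
  thus ?thesis unfolding DR by (simp add: algebra_simps)
qed

lemma theta_power_MF:
  assumes "x \<in> MF k" "theta k x \<in> MF (k + 2)"
  shows "theta (int n * k) (x ^ n) \<in> MF (int n * k + 2)"
proof (induction n)
  case 0
  show ?case by (simp add: theta_def MF.zero)
next
  case (Suc n)
  have "theta (k + int n * k) (x * x ^ n) \<in> MF (k + int n * k + 2)"
    unfolding theta_mult
    using MF_mult[OF assms(2) MF_power[OF assms(1), of n]] MF_mult[OF assms(1) Suc]
    by (auto intro!: MF_add simp: algebra_simps)
  thus ?case by (simp add: algebra_simps)
qed

lemma theta_MF: "x \<in> MF k \<Longrightarrow> theta k x \<in> MF (k + 2)"
proof (induction rule: MF.induct)
  case zero
  show ?case by (simp add: theta_def MF.zero)
next
  case (step x a b c)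
  have 1: "theta (int a * 4) (Q ^ a) \<in> MF (int a * 4 + 2)"
    using MF_numeral[OF MF_uminus[OF R_MF], of "num.Bit0 (num.Bit0 num.One)"]
    by (intro theta_power_MF Q_MF) (auto simp: theta_Q)
  have 2: "theta (int b * 6) (R ^ b) \<in> MF (int b * 6 + 2)"
    using MF_numeral[OF MF_uminus[OF MF_power[OF Q_MF, of 2]], of "num.Bit0 (num.Bit1 num.One)"]
    by (intro theta_power_MF R_MF) (auto simp: theta_R)
  have "theta (int a * 4 + int b * 6) (Q ^ a * R ^ b) \<in> MF (k + 2)"
    unfolding theta_mult
    using MF_mult[OF 1 MF_power[OF R_MF, of b]] MF_mult[OF MF_power[OF Q_MF, of a] 2] step(2)
    by (auto intro!: MF_add simp: algebra_simps)
  hence "fps_const c * theta k (Q ^ a * R ^ b) \<in> MF (k + 2)"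
    using step(2) by (intro MF_scale) (simp add: algebra_simps)
  moreover have "theta k (fps_const c * Q ^ a * R ^ b + x) =
     fps_const c * theta k (Q ^ a * R ^ b) + theta k x"
    by (simp add: theta_def fps_XD_mult fps_XD_add algebra_simps)
  ultimately show ?case using step by (auto intro: MF_add)
qed

text \<open>The monomial of weight \<open>k\<close> with at most one factor \<open>R\<close>. If
  \<open>k\<close> is not of the form \<open>4 a + 6 b\<close>, the value is meaningless.\<close>

definition Cmon :: "int \<Rightarrow> 'a fps" where
  "Cmon k = (if k mod 4 = 2 then Q ^ nat ((k - 6) div 4) * R else Q ^ nat (k div 4))"

lemma Cmon_0: "fps_nth (Cmon k) 0 = 1"
  by (simp add: Cmon_def fps_nth_power_0 Q0 R0)

lemma Cmon_MF:
  assumes "4 * int a + 6 * int b = k"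
  shows "Cmon k \<in> MF k"
proof (cases "k mod 4 = 2")
  case True
  have "b \<noteq> 0" using True assms by (intro notI) auto
  hence "k \<ge> 6" using assms by simp
  define j where "j = (k - 6) div 4"
  have "k = 4 * j + 6" using True unfolding j_def by presburger
  hence "4 * int (nat ((k - 6) div 4)) + 6 * int 1 = k"
    using \<open>k \<ge> 6\<close> by simp
  from MF_monom[OF this] True show ?thesis by (simp add: Cmon_def)
next
  case False
  define j where "j = k div 4"
  have "k = 4 * j" using False assms unfolding j_def by presburger
  moreover have "k \<ge> 0" using assms by simp
  ultimately have "4 * int (nat (k div 4)) + 6 * int 0 = k" by simp
  from MF_monom[OF this] False show ?thesis by (simp add: Cmon_def)
qed

text \<open>Replacing \<open>R^2\<close> by \<open>Q^3 - disc\<close> lowers the exponent of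
  \<open>R\<close> by two at the cost of a multiple of \<open>disc\<close>, until at most one
  \<open>R\<close> is left.\<close>

lemma monom_eq_Cmon:
  assumes "4 * int a + 6 * int b = k"
  shows "\<exists>y\<in>MF (k - 12). Q ^ a * R ^ b = Cmon k + disc * y"
  using assms
proof (induction b arbitrary: a rule: less_induct)
  case (less b)
  consider "b = 0" | "b = 1" | b' where "b = b' + 2"
    by (metis One_nat_def add_2_eq_Suc' not0_implies_Suc)
  thus ?case
  proof cases
    case 1
    hence "k = 4 * int a" using less.prems by simp
    hence "k mod 4 \<noteq> 2" "a = nat (k div 4)" by auto
    thus ?thesis using 1 by (intro bexI[of _ 0] MF.zero) (auto simp: Cmon_def)
  next
    case 2
    hence "k = 4 * int a + 6" using less.prems by simp
    hence "k mod 4 = 2" "(k - 6) div 4 = int a" by presburger+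
    hence "k mod 4 = 2" "a = nat ((k - 6) div 4)" by simp_all
    thus ?thesis using 2 by (intro bexI[of _ 0] MF.zero) (auto simp: Cmon_def)
  next
    case 3
    obtain y where y: "y \<in> MF (k - 12)" "Q ^ (a + 3) * R ^ b' = Cmon k + disc * y"
      using less.IH[of b' "a + 3"] less.prems 3 by auto
    have "Q ^ a * R ^ b = Q ^ (a + 3) * R ^ b' - disc * (Q ^ a * R ^ b')"
      by (simp add: 3 disc_def power_add algebra_simps power2_eq_square power3_eq_cube)
    also have "\<dots> = Cmon k + disc * (y - Q ^ a * R ^ b')"
      using y by (simp add: algebra_simps)
    finally show ?thesis
      using less.prems 3 y by (intro bexI[of _ "y - Q ^ a * R ^ b'"] MF_diff MF_monom) auto
  qed
qed

lemma MF_eq_Cmon: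
  assumes "x \<in> MF k"
  shows "\<exists>y\<in>MF (k - 12). x = fps_const (fps_nth x 0) * Cmon k + disc * y"
  using assms
proof (induction rule: MF.induct)
  case (step x a b c)
  obtain y where y: "y \<in> MF (k - 12)" "x = fps_const (fps_nth x 0) * Cmon k + disc * y"
    using step by blast
  obtain z where z: "z \<in> MF (k - 12)" "Q ^ a * R ^ b = Cmon k + disc * z"
    using monom_eq_Cmon[OF step(2)] by blast
  have n: "fps_nth (fps_const c * Q ^ a * R ^ b + x) 0 = c + fps_nth x 0"
    by (simp add: fps_nth_power_0 Q0 R0)
  have "fps_const c * Q ^ a * R ^ b + x =
     fps_const c * (Q ^ a * R ^ b) + (fps_const (fps_nth x 0) * Cmon k + disc * y)"
    using y by (simp add: mult.assoc)
  also have "\<dots> = fps_const (c + fps_nth x 0) * Cmon k + disc * (fps_const c * z + y)"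
    unfolding z by (simp add: algebra_simps flip: fps_const_add)
  finally show ?case unfolding n using y z by (auto intro!: MF_add MF_scale)
qed (auto intro!: bexI[of _ 0] MF.zero)

section \<open>Division by the discriminant, and coprimality of \<open>Q\<close> and
  \<open>R\<close>\<close>

lemma MF_cusp:
  assumes "x \<in> MF k" "fps_nth x 0 = 0"
  shows "\<exists>y\<in>MF (k - 12). x = disc * y"
  using MF_eq_Cmon[OF assms(1)] assms(2) by auto

text \<open>Each zero at the cusp splits off a factor \<open>disc\<close> of weight 12, and the
  nonzero cofactor left at the end has a weight of the form \<open>4 a + 6 b\<close>. This takes the
  place of the valence formula.\<close>

lemma subdegree_MF:
  assumes "x \<in> MF k" "x \<noteq> 0"
  shows "\<exists>a b. 12 * int (subdegree x) + 4 * int a + 6 * int b = k"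
  using assms
proof (induction "subdegree x" arbitrary: x k)
  case 0
  thus ?case using MF_nontrivial by auto
next
  case (Suc n)
  have "fps_nth x 0 = 0" using Suc.hyps(2) by (intro nth_less_subdegree_zero) auto
  then obtain y where y: "y \<in> MF (k - 12)" "x = disc * y"
    using MF_cusp Suc.prems by blast
  hence "y \<noteq> 0" using Suc.prems by auto
  hence s: "subdegree x = Suc (subdegree y)"
    using y disc_neq_0 by (simp add: subdegree_disc)
  hence "\<exists>a b. 12 * int (subdegree y) + 4 * int a + 6 * int b = k - 12"
    using Suc y \<open>y \<noteq> 0\<close> by auto
  then obtain a b where "12 * int (subdegree y) + 4 * int a + 6 * int b = k - 12" by blast
  hence "12 * int (subdegree x) + 4 * int a + 6 * int b = k" unfolding s by simp
  thus ?case by blast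
qed

lemma MF_neg: "x \<in> MF k \<Longrightarrow> k < 0 \<Longrightarrow> x = 0"
  using MF_nontrivial by fastforce

lemma MF_2: "x \<in> MF 2 \<Longrightarrow> x = 0"
proof (rule ccontr)
  assume "x \<in> MF 2" "x \<noteq> 0"
  then obtain a b where "4 * int a + 6 * int b = 2" using MF_nontrivial by blast
  thus False by presburger
qed

lemma MF_odd: "x \<in> MF k \<Longrightarrow> odd k \<Longrightarrow> x = 0"
proof (rule ccontr)
  assume "x \<in> MF k" "odd k" "x \<noteq> 0"
  then obtain a b where "4 * int a + 6 * int b = k" using MF_nontrivial by blast
  thus False using \<open>odd k\<close> by presburger
qed

text \<open>With \<open>R^2 = Q^3 - disc\<close> the equation becomes \<open>disc\<close> times the
  one for exponent \<open>N - 2\<close>, because the new cofactor \<open>z'\<close> has no constant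
  term. The descent ends at \<open>N = 0\<close> or \<open>N = 1\<close>, where \<open>z\<close> has
  weight -4 or 2 and so is 0.\<close>

lemma R_power_not_Q_multiple:
  assumes "z \<in> MF (6 * int N - 4)" "fps_const c * R ^ N = Q * z"
  shows "c = 0"
  using assms
proof (induction N arbitrary: z rule: less_induct)
  case (less N)
  have Qz: "c = fps_nth z 0"
    using arg_cong[OF less.prems(2), of "\<lambda>x. fps_nth x 0"] by (simp add: fps_nth_power_0 R0 Q0)
  consider "N = 0" | "N = 1" | N' where "N = N' + 2"
    by (metis One_nat_def add_2_eq_Suc' not0_implies_Suc)
  thus ?case
  proof cases
    case 1
    thus ?thesis using MF_neg[of z "-4"] less.prems Qz by simp
  next
    case 2
    thus ?thesis using MF_2[of z] less.prems Qz by simp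
  next
    case 3
    define z' where "z' = fps_const c * Q ^ 2 * R ^ N' - z"
    have z': "z' \<in> MF (6 * int N - 4)"
      unfolding z'_def mult.assoc using less.prems(1) 3 by (intro MF_diff MF_scale MF_monom) auto
    have "fps_nth z' 0 = 0" by (simp add: z'_def fps_nth_power_0 Q0 R0 Qz)
    then obtain u where u: "u \<in> MF (6 * int N - 4 - 12)" "z' = disc * u"
      using MF_cusp z' by blast
    have "disc * (fps_const c * R ^ N') = Q * z'"
      using less.prems(2)
      by (simp add: 3 disc_def z'_def power_add algebra_simps power2_eq_square power3_eq_cube)
    hence "disc * (fps_const c * R ^ N') = disc * (Q * u)"
      by (simp add: u)
    hence "fps_const c * R ^ N' = Q * u"
      using disc_neq_0 by simp
    thus ?thesis using less.IH[of N' u] u 3 by (simp add: algebra_simps)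
  qed
qed

text \<open>Modulo \<open>Q\<close> a form of weight \<open>k\<close> is a scalar times a power of
  \<open>R\<close>, and \<open>R_power_not_Q_multiple\<close> shows that this scalar is 0.\<close>

lemma Q_dvd_of_mult_R:
  assumes "y \<in> MF k" "x \<in> MF (k + 2)" "R * y = Q * x"
  shows "\<exists>u\<in>MF (k - 4). y = Q * u"
proof -
  \<comment> \<open>All terms free of \<open>Q\<close> have weight \<open>k\<close>, hence the same
    exponent of \<open>R\<close>, and merge into one.\<close>
  have "\<exists>u\<in>MF (k - 4). \<exists>c b. y = Q * u + fps_const c * R ^ b \<and> (c = 0 \<or> 6 * int b = k)"
    using assms(1)
  proof (induction rule: MF.induct)
    case (step x a b c)
    then obtain u c' b' where u: "u \<in> MF (k - 4)" "x = Q * u + fps_const c' * R ^ b'"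
      "c' = 0 \<or> 6 * int b' = k" by blast
    show ?case
    proof (cases a)
      case 0
      have "fps_const c * Q ^ a * R ^ b + x = Q * u + fps_const (c + c') * R ^ b"
      proof (cases "c' = 0")
        case False
        hence "b = b'" using u 0 step(2) by auto
        thus ?thesis using u 0 by (simp add: algebra_simps flip: fps_const_add)
      qed (use 0 u in auto)
      moreover have "6 * int b = k" using 0 step(2) by simp
      ultimately show ?thesis using u(1) by blast
    next
      case (Suc a')
      have "fps_const c * Q ^ a * R ^ b + x
          = Q * (fps_const c * (Q ^ a' * R ^ b) + u) + fps_const c' * R ^ b'"
        using u Suc by (simp add: algebra_simps)
      moreover have "fps_const c * (Q ^ a' * R ^ b) + u \<in> MF (k - 4)"
        using u Suc step(2) by (intro MF_add MF_scale MF_monom) auto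
      ultimately show ?thesis using u(3) by blast
    qed
  qed (auto intro!: bexI[of _ 0] MF.zero exI[of _ 0])
  then obtain u c b where u: "u \<in> MF (k - 4)" "y = Q * u + fps_const c * R ^ b"
    "c = 0 \<or> 6 * int b = k" by blast
  have "c = 0"
  proof (rule ccontr)
    assume "c \<noteq> 0"
    hence k: "6 * int b = k" using u by auto
    have "fps_const c * R ^ Suc b = Q * (x - R * u)"
      using assms(3) u(2) by (simp add: algebra_simps)
    moreover have "x - R * u \<in> MF (6 * int (Suc b) - 4)"
      using MF_mult[OF R_MF u(1)] assms(2) k by (intro MF_diff) (auto simp: algebra_simps)
    ultimately show False using R_power_not_Q_multiple \<open>c \<noteq> 0\<close> by blast
  qed
  thus ?thesis using u by auto
qed

section \<open>The graded ideal of denominators of \<open>P\<close>\<close>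

definition J :: "int \<Rightarrow> 'a fps set" where
  "J k = {M \<in> MF k. P * M \<in> MF (k + 2)}"

lemma J_diff: "x \<in> J k \<Longrightarrow> y \<in> J k \<Longrightarrow> x - y \<in> J k"
  by (simp add: J_def MF_diff right_diff_distrib)

lemma J_mult: "x \<in> J k \<Longrightarrow> y \<in> MF l \<Longrightarrow> x * y \<in> J (k + l)"
  using MF_mult[of "P * x" "k + 2" y l] MF_mult[of x k y l] by (simp add: J_def algebra_simps)

lemma J_scale: "x \<in> J k \<Longrightarrow> fps_const c * x \<in> J k"
  using MF_scale[of "P * x" "k + 2" c] MF_scale[of x k c] by (simp add: J_def mult.left_commute)

lemma J_cusp:
  assumes "M \<in> J k" "fps_nth M 0 = 0"
  shows "\<exists>y\<in>J (k - 12). M = disc * y"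
proof -
  obtain y where y: "y \<in> MF (k - 12)" "M = disc * y"
    using MF_cusp assms by (auto simp: J_def)
  obtain z where z: "z \<in> MF (k + 2 - 12)" "P * M = disc * z"
    using MF_cusp[of "P * M" "k + 2"] assms by (auto simp: J_def)
  have "disc * (P * y) = disc * z" using y z by (simp add: mult.left_commute)
  hence "P * y = z" using disc_neq_0 by simp
  thus ?thesis using y z by (auto simp: J_def)
qed

lemma Q_neq_0: "Q \<noteq> 0"
  using Q0 by auto

text \<open>The numerators satisfy \<open>R * (P * (Q * x)) = Q * (P * (R * x))\<close>. As
  \<open>Q\<close> and \<open>R\<close> are coprime, \<open>Q\<close> divides the form
  \<open>P * (Q * x)\<close> with a form as quotient.\<close>

lemma J_div_Q:
  assumes "x \<in> MF k" "Q * x \<in> J (k + 4)" "R * x \<in> J (k + 6)"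
  shows "x \<in> J k"
proof -
  have "P * (Q * x) \<in> MF (k + 6)" "P * (R * x) \<in> MF (k + 6 + 2)"
    using assms by (auto simp: J_def algebra_simps)
  then obtain u where u: "u \<in> MF (k + 6 - 4)" "P * (Q * x) = Q * u"
    using Q_dvd_of_mult_R[of "P * (Q * x)" "k + 6" "P * (R * x)"] by (auto simp: mult_ac)
  have "k + 6 - 4 = k + 2" by simp
  hence "u \<in> MF (k + 2)" using u(1) by metis
  moreover have "Q * (P * x) = Q * u" using u by (simp add: mult_ac)
  hence "P * x = u" using Q_neq_0 by simp
  ultimately show ?thesis using assms by (simp add: J_def)
qed

text \<open>The series is \<open>theta k M - P * M\<close>, and its product with \<open>P\<close> is
  \<open>theta (k + 2) (P * M) + Q * M\<close> because of \<open>12 * D P = P^2 - Q\<close>. The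
  coefficient \<open>k + 1\<close> reappears in the constant term, where \<open>J_lowest\<close>
  exploits it.\<close>

lemma J_raise:
  assumes "M \<in> J k"
  shows "12 * D M - of_int (k + 1) * P * M \<in> J (k + 2)"
proof -
  have M: "M \<in> MF k" "P * M \<in> MF (k + 2)" using assms by (auto simp: J_def)
  have "12 * D M - of_int (k + 1) * P * M = theta k M - P * M"
    by (simp add: theta_def algebra_simps)
  also have "\<dots> \<in> MF (k + 2)" using M theta_MF by (intro MF_diff) auto
  finally have 1: "12 * D M - of_int (k + 1) * P * M \<in> MF (k + 2)" .
  have "theta (k + 2) (P * M) = (P ^ 2 - Q) * M + 12 * P * D M - of_int (k + 2) * P * (P * M)"
    unfolding DP [symmetric] by (simp add: theta_def fps_XD_mult algebra_simps)
  hence "P * (12 * D M - of_int (k + 1) * P * M) = theta (k + 2) (P * M) + Q * M"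
    by (simp add: algebra_simps power2_eq_square)
  also have "\<dots> \<in> MF (k + 2 + 2)"
    using theta_MF[OF M(2)] MF_mult[OF Q_MF M(1)] by (intro MF_add) (auto simp: algebra_simps)
  finally show ?thesis using 1 by (simp add: J_def)
qed

text \<open>
  The lowest-weight element of \<open>J\<close> plays the part of the Hasse invariant (the reduction
  of \<open>E\<^bsub>p-1\<^esub>\<close>), and \<open>P\<close> times it that of the reduction of \<open>E\<^bsub>p+1\<^esub>\<close>. No generator can occur
  two weights above the lowest one, as it would allow the latter to be divided by \<open>Q\<close>.
\<close>
lemma J_lowest:
  assumes M: "M \<in> J k" "M \<noteq> 0" and low: "\<And>l x. l < k \<Longrightarrow> x \<in> J l \<Longrightarrow> x = 0"
  shows "fps_nth M 0 \<noteq> 0"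
    and "x \<in> J (k + 2) \<Longrightarrow> fps_nth x 0 = 0"
    and "of_int (k + 1) = (0 :: 'a)"
    and "x \<in> J l \<Longrightarrow> \<exists>y\<in>MF (l - k). x = M * y"
proof -
  show M0: "fps_nth M 0 \<noteq> 0"
  proof
    assume "fps_nth M 0 = 0"
    then obtain y where "y \<in> J (k - 12)" "M = disc * y" using J_cusp M by blast
    thus False using low[of "k - 12" y] M by auto
  qed
  show k2: "fps_nth x 0 = 0" if x: "x \<in> J (k + 2)" for x
  proof (rule ccontr)
    assume x0: "fps_nth x 0 \<noteq> 0"
    \<comment> \<open>Cancelling the constant terms in weight \<open>k + 6\<close> makes
      \<open>z\<close> divisible by \<open>disc\<close>, with quotient in \<open>J\<close> of weight
      \<open>k - 6\<close>, which is below the lowest weight.\<close>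
    define z where "z = fps_const (fps_nth M 0) * (x * Q) - fps_const (fps_nth x 0) * (M * R)"
    have "z \<in> J (k + 6)"
      unfolding z_def using J_mult[OF x Q_MF] J_mult[OF M(1) R_MF]
      by (intro J_diff J_scale) (auto simp: algebra_simps)
    moreover have "fps_nth z 0 = 0" by (simp add: z_def Q0 R0)
    ultimately obtain y where "y \<in> J (k + 6 - 12)" "z = disc * y" using J_cusp by blast
    hence z: "z = 0" using low[of "k + 6 - 12" y] by simp
    have eq: "R * (fps_const (fps_nth x 0) * M) = Q * (fps_const (fps_nth M 0) * x)"
      using z by (simp add: z_def algebra_simps)
    have "fps_const (fps_nth x 0) * M \<in> MF k" "fps_const (fps_nth M 0) * x \<in> MF (k + 2)"
      using M(1) x by (auto simp: J_def intro: MF_scale)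
    then obtain u where u: "u \<in> MF (k - 4)" "fps_const (fps_nth x 0) * M = Q * u"
      using Q_dvd_of_mult_R eq by blast
    have "Q * (R * u) = R * (fps_const (fps_nth x 0) * M)"
      unfolding u(2) by (simp add: mult_ac)
    hence Ru: "R * u = fps_const (fps_nth M 0) * x"
      unfolding eq using Q_neq_0 by simp
    \<comment> \<open>\<open>Q * u\<close> and \<open>R * u\<close> are scalar multiples of
      \<open>M\<close> and \<open>x\<close>, so \<open>J_div_Q\<close> puts \<open>u\<close> into
      \<open>J\<close> four weights below \<open>M\<close>.\<close>
    have e: "k - 4 + 4 = k" "k - 4 + 6 = k + 2" by simp_all
    have "Q * u \<in> J (k - 4 + 4)" "R * u \<in> J (k - 4 + 6)"
      unfolding e Ru u(2) [symmetric] by (intro J_scale M x)+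
    hence "u = 0" using J_div_Q[OF u(1)] low[of "k - 4" u] by auto
    thus False using u M x0 by simp
  qed
  \<comment> \<open>\<open>J_raise\<close> applied to \<open>M\<close> has constant term
    \<open>- (k + 1)\<close> times that of \<open>M\<close>, and by the second claim this is
    zero.\<close>
  have "fps_nth (12 * D M - of_int (k + 1) * P * M) 0 = 0"
    using k2 J_raise[OF M(1)] by blast
  moreover have "fps_nth (12 * D M - of_int (k + 1) * P * M) 0 = - of_int (k + 1) * fps_nth M 0"
    by (simp add: P0 fps_XD_nth algebra_simps flip: fps_of_int)
  ultimately have "- of_int (k + 1) * fps_nth M 0 = 0" by metis
  thus "of_int (k + 1) = (0 :: 'a)" using M0 by (metis mult_eq_0_iff neg_equal_0_iff_equal)
  show "\<exists>y\<in>MF (l - k). x = M * y" if "x \<in> J l" for x l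
    using that
  proof (induction "nat (l - k)" arbitrary: x l rule: less_induct)
    case less
    have cusp: "\<exists>y\<in>MF (l - k). x = M * y" if x: "x \<in> J l" "fps_nth x 0 = 0" for x
    proof (cases "x = 0")
      case False
      obtain y where y: "y \<in> J (l - 12)" "x = disc * y" using J_cusp x by blast
      have "l - 12 \<ge> k" using low[of "l - 12" y] y False by fastforce
      then obtain z where "z \<in> MF (l - 12 - k)" "y = M * z" using less.hyps[of "l - 12" y] y by auto
      thus ?thesis using y MF_mult[OF disc_MF, of z "l - 12 - k"]
        by (intro bexI[of _ "disc * z"]) (auto simp: mult_ac)
    qed (auto intro: bexI[of _ 0] MF.zero)
    show ?case
    proof (cases "fps_nth x 0 = 0")
      case False
      hence "x \<noteq> 0" by auto
      hence "l \<ge> k" using low[of l x] less.prems by fastforce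
      moreover have "even k" "even l"
        using MF_odd[of M k] MF_odd[of x l] M less.prems \<open>x \<noteq> 0\<close> by (auto simp: J_def)
      \<comment> \<open>The weight 2 is the only nonnegative even one without a monomial in
        \<open>Q\<close> and \<open>R\<close>, and \<open>l - k = 2\<close> is excluded by the
        second claim.\<close>
      moreover have "l \<noteq> k + 2" using k2 less.prems False by auto
      moreover define j where "j = nat ((l - k) div 2)"
      ultimately have j: "l - k = 2 * int j" "l \<noteq> k + 2" by auto
      hence "j \<noteq> 1" by auto
      obtain a b where ab: "4 * int a + 6 * int b = l - k"
      proof (cases "even j")
        case True
        thus ?thesis using that[of "j div 2" 0] j by auto
      next
        case False
        define i where "i = (j - 3) div 2"
        have "j = 2 * i + 3" using False \<open>j \<noteq> 1\<close> unfolding i_def by presburger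
        thus ?thesis using that[of i 1] j by simp
      qed
      define c where "c = fps_nth x 0 / fps_nth M 0"
      define m where "m = fps_const c * (Q ^ a * R ^ b)"
      have m: "m \<in> MF (l - k)" unfolding m_def by (intro MF_scale MF_monom ab)
      have "x - M * m \<in> J l" using J_mult[OF M(1) m] less.prems by (intro J_diff) auto
      moreover have "fps_nth (x - M * m) 0 = 0"
        using M0 by (simp add: m_def c_def fps_nth_power_0 Q0 R0)
      ultimately obtain y where "y \<in> MF (l - k)" "x - M * m = M * y" using cusp by blast
      thus ?thesis using m by (intro bexI[of _ "y + m"] MF_add) (auto simp: algebra_simps)
    qed (use cusp less.prems in blast)
  qed
qed

section \<open>Isobaric polynomials in a variable of weight 2 standing for \<open>P\<close>\<close>

definition isobaric :: "int \<Rightarrow> 'a fps poly \<Rightarrow> bool" where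
  "isobaric w G \<longleftrightarrow> (\<forall>l. coeff G l \<in> MF (w - 2 * int l))"

lemma isobaric_diff: "isobaric w G \<Longrightarrow> isobaric w H \<Longrightarrow> isobaric w (G - H)"
  by (simp add: isobaric_def MF_diff)

lemma isobaric_smult: "x \<in> MF k \<Longrightarrow> isobaric w G \<Longrightarrow> isobaric (k + w) (smult x G)"
  unfolding isobaric_def using MF_mult by (auto simp flip: add_diff_eq)

lemma isobaric_pderiv: "isobaric w G \<Longrightarrow> isobaric (w - 2) (pderiv G)"
proof -
  assume G: "isobaric w G"
  have "coeff (pderiv G) l \<in> MF (w - 2 - 2 * int l)" for l
  proof -
    have "coeff G (Suc l) \<in> MF (w - 2 * int (Suc l))" using G unfolding isobaric_def by blast
    hence "of_nat (Suc l) * coeff G (Suc l) \<in> MF (w - 2 * int (Suc l))" by (intro MF_of_nat)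
    thus ?thesis by (simp add: coeff_pderiv algebra_simps)
  qed
  thus ?thesis by (simp add: isobaric_def)
qed

definition mapD :: "'a fps poly \<Rightarrow> 'a fps poly" where
  "mapD = map_poly D"

lemma coeff_mapD [simp]: "coeff (mapD G) l = D (coeff G l)"
  by (simp add: mapD_def coeff_map_poly)

lemma mapD_add: "mapD (G + H) = mapD G + mapD H"
  by (rule poly_eqI) (simp add: fps_XD_add)

lemma mapD_smult: "mapD (smult c G) = smult (D c) G + smult c (mapD G)"
  by (rule poly_eqI) (simp add: fps_XD_mult)

lemma mapD_0 [simp]: "mapD 0 = 0"
  by (rule poly_eqI) simp

lemma mapD_pCons: "mapD (pCons c G) = pCons (D c) (mapD G)"
  by (rule poly_eqI) (simp add: coeff_pCons split: nat.splits)

lemma mapD_pcompose: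
  "mapD (G \<circ>\<^sub>p [:P, 1:]) = mapD G \<circ>\<^sub>p [:P, 1:] + smult (D P) (pderiv G \<circ>\<^sub>p [:P, 1:])"
proof (induction G)
  case (pCons c G)
  have 1: "[:P, 1:] * H = smult P H + pCons 0 H" for H by simp
  have "mapD ([:P, 1:] * (G \<circ>\<^sub>p [:P, 1:])) =
     smult (D P) (G \<circ>\<^sub>p [:P, 1:]) + [:P, 1:] * mapD (G \<circ>\<^sub>p [:P, 1:])"
    unfolding 1 by (simp add: mapD_add mapD_smult mapD_pCons)
  thus ?case
    by (simp add: pcompose_pCons mapD_add mapD_pCons pCons.IH pderiv_pCons pcompose_add
        algebra_simps smult_add_right)
qed simp

text \<open>
  With \<open>X\<close> in place of \<open>P\<close>, this is \<open>12 D - (w - r) P\<close> on forms of weight \<open>w\<close> and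
  depth at most \<open>r\<close>; the subtracted multiple of \<open>P\<close> keeps the depth at most \<open>r\<close>.
\<close>
definition Phi :: "int \<Rightarrow> nat \<Rightarrow> 'a fps poly \<Rightarrow> 'a fps poly" where
  "Phi w r G = smult 12 (mapD G) - smult (of_int w * P) G + smult (2 * P) (pCons 0 (pderiv G))
     + smult (of_nat r) (pCons 0 G) - pCons 0 (pCons 0 (pderiv G)) - smult Q (pderiv G)"

text \<open>This is \<open>Phi\<close> after the substitution \<open>X = P + Y\<close>, up to a
  scalar multiple of \<open>P\<close>. Neither the weight nor \<open>Q\<close> is left in it, and it
  links only neighbouring coefficients in \<open>Y\<close>.\<close>

definition N :: "nat \<Rightarrow> 'a fps poly \<Rightarrow> 'a fps poly" where
  "N r V = smult 12 (mapD V) + smult (of_nat r) (pCons 0 V) - pCons 0 (pCons 0 (pderiv V))"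

lemma coeff_X_pderiv: "coeff (pCons 0 (pderiv G)) l = of_nat l * coeff G l"
  by (cases l) (auto simp: coeff_pCons coeff_pderiv)

lemma coeff_N_0: "coeff (N r V) 0 = 12 * D (coeff V 0)"
  by (simp add: N_def)

lemma coeff_N_Suc:
  "coeff (N r V) (Suc l) = 12 * D (coeff V (Suc l)) + (of_nat r - of_nat l) * coeff V l"
  using coeff_X_pderiv[of V l] by (simp add: N_def algebra_simps)

text \<open>Since \<open>2 P (P + Y) - (P + Y)^2 = P^2 - Y^2\<close>, the terms with
  \<open>P^2\<close> and \<open>Q\<close> cancel against \<open>12 * D P = P^2 - Q\<close>, and only
  \<open>- Y^2\<close> times the derivative remains.\<close>

lemma Phi_pcompose:
  "Phi w r G \<circ>\<^sub>p [:P, 1:] = N r (G \<circ>\<^sub>p [:P, 1:]) - smult (of_int (w - int r) * P) (G \<circ>\<^sub>p [:P, 1:])"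
proof -
  define V where "V = G \<circ>\<^sub>p [:P, 1:]"
  define V' where "V' = pderiv G \<circ>\<^sub>p [:P, 1:]"
  define Y :: "'a fps poly" where "Y = [:0, 1:]"
  have dV: "pderiv V = V'" by (simp add: V_def V'_def pderiv_pcompose pderiv_pCons)
  have mV: "mapD V = mapD G \<circ>\<^sub>p [:P, 1:] + smult (D P) V'"
    by (simp add: V_def V'_def mapD_pcompose)
  \<comment> \<open>Scalars are turned into constant polynomials, so that the claim becomes an
    identity of commutative rings.\<close>
  define p where "p = [:P:]"
  define q where "q = [:Q:]"
  have pC: "pCons 0 H = Y * H" for H :: "'a fps poly" by (simp add: Y_def)
  have Y: "Y \<circ>\<^sub>p [:P, 1:] = p + Y" by (simp add: Y_def p_def pcompose_pCons)
  have p: "smult P H = p * H" and q: "smult Q H = q * H" for H by (simp_all add: p_def q_def)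
  have int: "smult (of_int i) H = of_int i * H" and nat: "smult (of_nat j) H = of_nat j * H"
    for i j and H :: "'a fps poly" by (simp_all add: of_int_poly of_nat_poly)
  have "smult 12 (mapD G \<circ>\<^sub>p [:P, 1:]) = smult 12 (mapD V) - smult (12 * D P) V'"
    by (simp add: mV smult_add_right)
  also have "\<dots> = smult 12 (mapD V) - (p * (p * V') - q * V')"
    unfolding DP smult_diff_left power2_eq_square by (simp add: p_def q_def)
  finally have 1: "smult 12 (mapD G \<circ>\<^sub>p [:P, 1:]) = smult 12 (mapD V) - (p * (p * V') - q * V')" .
  have 2: "N r V = smult 12 (mapD V) + of_nat r * (Y * V) - Y * (Y * V')"
    unfolding N_def pC dV nat by simp
  have 3: "Phi w r G \<circ>\<^sub>p [:P, 1:] = smult 12 (mapD G \<circ>\<^sub>p [:P, 1:]) - of_int w * (p * V)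
      + 2 * (p * ((p + Y) * V')) + of_nat r * ((p + Y) * V)
      - (p + Y) * ((p + Y) * V') - q * V'"
    unfolding Phi_def pC pcompose_add pcompose_diff pcompose_smult pcompose_mult Y
      V_def [symmetric] V'_def [symmetric]
    by (simp add: p_def q_def of_int_poly of_nat_poly numeral_poly mult_ac)
  have 4: "smult (of_int (w - int r) * P) V = (of_int w - of_nat r) * (p * V)"
    by (simp add: p_def of_int_poly of_nat_poly algebra_simps smult_diff_left)
  show ?thesis
    unfolding V_def [symmetric] 1 2 3 4 by (simp add: algebra_simps)
qed

lemma coeff_Phi:
  assumes "isobaric w G"
  shows "coeff (Phi w r G) l = theta (w - 2 * int l) (coeff G l)
     + (if l = 0 then 0 else of_int (int r + 1 - int l) * coeff G (l - 1))
     - of_nat (Suc l) * (Q * coeff G (Suc l))"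
  using coeff_X_pderiv[of G l] coeff_X_pderiv[of G "l - 1"]
  by (cases l) (auto simp: Phi_def theta_def algebra_simps coeff_pderiv)

lemma isobaric_Phi:
  assumes "isobaric w G"
  shows "isobaric (w + 2) (Phi w r G)"
proof -
  have "coeff (Phi w r G) l \<in> MF (w + 2 - 2 * int l)" for l
  proof -
    have "theta (w - 2 * int l) (coeff G l) \<in> MF (w + 2 - 2 * int l)"
      using assms theta_MF[of "coeff G l" "w - 2 * int l"]
      by (auto simp: isobaric_def algebra_simps)
    moreover have "of_int (int r + 1 - int l) * coeff G (l - 1) \<in> MF (w + 2 - 2 * int l)" if "l \<noteq> 0"
    proof -
      have "w - 2 * int (l - 1) = w + 2 - 2 * int l" using that by (simp add: of_nat_diff)
      thus ?thesis using assms by (metis MF_of_int isobaric_def)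
    qed
    moreover have "of_nat (Suc l) * (Q * coeff G (Suc l)) \<in> MF (w + 2 - 2 * int l)"
    proof -
      have "coeff G (Suc l) \<in> MF (w - 2 * int (Suc l))"
        using assms unfolding isobaric_def by blast
      from MF_mult[OF Q_MF this] have "Q * coeff G (Suc l) \<in> MF (4 + (w - 2 * int (Suc l)))" .
      moreover have "4 + (w - 2 * int (Suc l)) = w + 2 - 2 * int l" by simp
      ultimately show ?thesis by (metis MF_of_nat)
    qed
    ultimately show ?thesis unfolding coeff_Phi[OF assms]
      by (cases "l = 0") (auto intro!: MF_add MF_diff simp del: of_nat_Suc)
  qed
  thus ?thesis by (simp add: isobaric_def)
qed

text \<open>The factor \<open>int r + 1 - int l\<close> in \<open>coeff_Phi\<close> vanishes at
  \<open>l = r + 1\<close>, the only place where the degree could grow.\<close>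

lemma degree_Phi:
  assumes "isobaric w G" "degree G \<le> r"
  shows "degree (Phi w r G) \<le> r"
proof (rule degree_le, intro allI impI)
  fix l assume "r < l"
  hence "coeff G l = 0" "coeff G (Suc l) = 0" "l = Suc r \<or> coeff G (l - 1) = 0"
    using assms(2) by (auto intro!: coeff_eq_0)
  thus "coeff (Phi w r G) l = 0"
    unfolding coeff_Phi[OF assms(1)] by (auto simp: theta_def)
qed

section \<open>Polynomial relations satisfied by \<open>P\<close>\<close>

lemma isobaric_degree:
  assumes "isobaric w G" "G \<noteq> 0"
  shows "2 * int (degree G) \<le> w"
proof -
  have "coeff G (degree G) \<in> MF (w - 2 * int (degree G))"
    using assms unfolding isobaric_def by blast
  moreover have "coeff G (degree G) \<noteq> 0" using assms by simp
  ultimately have "\<not> w - 2 * int (degree G) < 0" using MF_neg by blast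
  thus ?thesis by simp
qed

lemma coeff_pcompose_1: "coeff (G \<circ>\<^sub>p [:P, 1:]) 1 = poly (pderiv G) P"
proof -
  have "pderiv (G \<circ>\<^sub>p [:P, 1:]) = pderiv G \<circ>\<^sub>p [:P, 1:]"
    by (simp add: pderiv_pcompose pderiv_pCons)
  from arg_cong[OF this, of "\<lambda>p. coeff p 0"] show ?thesis
    by (simp add: coeff_pderiv coeff_pcompose_0)
qed

text \<open>A relation of least depth \<open>e\<close> is proportional to its image under
  \<open>Phi\<close>: eliminating the leading terms leaves a relation of smaller depth, hence 0.
  Comparing Taylor coefficients at \<open>P\<close> then forces \<open>e = 1\<close>, and a relation
  \<open>g + P * M = 0\<close> puts its leading coefficient \<open>M\<close> into
  \<open>J\<close>.\<close>

lemma J_nontrivial_of_vanishing: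
  assumes "isobaric w0 G0" "G0 \<noteq> 0" "poly G0 P = 0"
    and char: "\<And>n. 0 < n \<Longrightarrow> n \<le> degree G0 \<Longrightarrow> of_nat n \<noteq> (0 :: 'a)"
  shows "\<exists>k. \<exists>M\<in>J k. M \<noteq> 0"
proof -
  define V where "V = (\<lambda>e w G. isobaric w G \<and> G \<noteq> 0 \<and> poly G P = 0 \<and> degree G = e)"
  define e where "e = (LEAST e. \<exists>w G. V e w G)"
  have ex: "\<exists>w G. V (degree G0) w G" using assms by (auto simp: V_def)
  have "\<exists>w G. V e w G" unfolding e_def by (rule LeastI_ex) (use ex in blast)
  then obtain w G where G: "isobaric w G" "G \<noteq> 0" "poly G P = 0" "degree G = e"
    by (auto simp: V_def)
  have "e \<le> degree G0" unfolding e_def by (rule Least_le) (use ex in blast)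
  have min: "H = 0" if "isobaric u H" "poly H P = 0" "degree H < e" for u H
    using not_less_Least[of "degree H" "\<lambda>e. \<exists>w G. V e w G"] that by (auto simp: V_def e_def)
  have coeffs: "coeff G l \<in> MF (w - 2 * int l)" for l
    using G unfolding isobaric_def by blast
  have "e \<noteq> 0"
  proof
    assume "e = 0"
    then obtain g where "G = [:g:]" using G by (auto elim: degree_eq_zeroE)
    thus False using G by simp
  qed
  moreover have "e < 2"
  proof (rule ccontr)
    assume "\<not> e < 2"
    define V where "V = G \<circ>\<^sub>p [:P, 1:]"
    define H where "H = Phi w e G"
    define g h where "g = coeff G e" and "h = coeff H e"
    define v1 v2 where "v1 = coeff V 1" and "v2 = coeff V 2"
    have "g \<noteq> 0" using G by (auto simp: g_def)
    have H: "isobaric (w + 2) H" "degree H \<le> e"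
      using G by (auto simp: H_def intro: isobaric_Phi degree_Phi)
    have HV: "H \<circ>\<^sub>p [:P, 1:] = N e V - smult (of_int (w - int e) * P) V"
      by (simp add: H_def V_def Phi_pcompose)
    have V0: "coeff V 0 = 0" using G by (simp add: V_def coeff_pcompose_0)
    \<comment> \<open>The constant coefficient of \<open>N e V\<close> is \<open>12 * D\<close> of
      that of \<open>V\<close>, so \<open>Phi\<close> preserves vanishing at
      \<open>P\<close>.\<close>
    have "coeff (H \<circ>\<^sub>p [:P, 1:]) 0 = 0"
      unfolding HV by (simp add: coeff_N_0 V0)
    hence H0: "poly H P = 0" by (simp add: coeff_pcompose_0)
    have gh: "g \<in> MF (w - 2 * int e)" "h \<in> MF (w + 2 - 2 * int e)"
      using coeffs H unfolding g_def h_def isobaric_def by blast+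
    have "isobaric (w - 2 * int e + (w + 2)) (smult g H)" using gh H by (intro isobaric_smult)
    moreover have "isobaric (w - 2 * int e + (w + 2)) (smult h G)"
      using isobaric_smult[OF gh(2) G(1)] by (simp add: algebra_simps)
    ultimately have "isobaric (w - 2 * int e + (w + 2)) (smult g H - smult h G)"
      by (rule isobaric_diff)
    moreover have "degree (smult g H - smult h G) < e"
    proof -
      have "degree (smult g H - smult h G) \<le> e - 1"
      proof (rule degree_le, intro allI impI)
        fix l assume "e - 1 < l"
        hence "l = e \<or> (coeff G l = 0 \<and> coeff H l = 0)"
          using G H by (cases "l = e") (auto intro!: coeff_eq_0)
        thus "coeff (smult g H - smult h G) l = 0" by (auto simp: g_def h_def)
      qed
      thus ?thesis using \<open>e \<noteq> 0\<close> by simp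
    qed
    moreover have "poly (smult g H - smult h G) P = 0" using H0 G by simp
    ultimately have "smult g H - smult h G = 0" using min by blast
    hence "smult g H = smult h G" by simp
    from arg_cong[OF this, of "\<lambda>p. p \<circ>\<^sub>p [:P, 1:]"]
    have eq: "smult g (N e V - smult (of_int (w - int e) * P) V) = smult h V"
      by (simp only: pcompose_smult HV flip: V_def)
    \<comment> \<open>\<open>v1\<close> is the value at \<open>P\<close> of the derivative of
      \<open>G\<close>. It is nonzero because this derivative is isobaric, of smaller degree, and
      not the zero polynomial, as \<open>e\<close> is invertible.\<close>
    have "degree (pderiv G) \<le> e - 1"
      using G(4) degree_pderiv_le by metis
    hence "degree (pderiv G) < e" using \<open>e \<noteq> 0\<close> by linarith
    moreover have "coeff (pderiv G) (e - 1) \<noteq> 0"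
    proof -
      have "of_nat e * coeff G e \<noteq> 0"
        using char[of e] \<open>e \<noteq> 0\<close> \<open>e \<le> degree G0\<close> \<open>g \<noteq> 0\<close> by (simp add: g_def flip: fps_of_nat)
      thus ?thesis using \<open>e \<noteq> 0\<close> by (simp add: coeff_pderiv)
    qed
    hence "pderiv G \<noteq> 0" by auto
    moreover have "v1 = poly (pderiv G) P"
      unfolding v1_def V_def by (rule coeff_pcompose_1)
    ultimately have "v1 \<noteq> 0"
      using min[OF isobaric_pderiv[OF G(1)]] by metis
    define c where "c = of_int (w - int e) * P"
    have "coeff (smult g (N e V - smult c V)) (Suc 0) = coeff (smult h V) (Suc 0)"
      using eq by (simp add: c_def)
    hence 1: "g * (12 * D v1 - c * v1) = h * v1"
      by (simp add: coeff_N_Suc V0 v1_def)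
    have "coeff (smult g (N e V - smult c V)) (Suc 1) = coeff (smult h V) (Suc 1)"
      using eq by (simp add: c_def)
    hence 2: "g * (12 * D v2 + (of_nat e - 1) * v1 - c * v2) = h * v2"
      unfolding coeff_smult coeff_diff coeff_N_Suc by (simp add: v1_def v2_def numeral_2_eq_2)
    \<comment> \<open>Eliminating \<open>h\<close> from the coefficients of \<open>Y\<close> and
      \<open>Y^2\<close> leaves \<open>12 * D (v2 / v1) = - (e - 1)\<close> with denominators
      cleared.\<close>
    have "g * (12 * (v1 * D v2 - v2 * D v1) + (of_nat e - 1) * v1 ^ 2) =
        v1 * (g * (12 * D v2 + (of_nat e - 1) * v1 - c * v2)) - v2 * (g * (12 * D v1 - c * v1))"
      by (simp add: algebra_simps power2_eq_square)
    also have "\<dots> = 0" unfolding 1 2 by (simp add: algebra_simps)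
    finally have "12 * (v1 * D v2 - v2 * D v1) + (of_nat e - 1) * v1 ^ 2 = 0"
      using \<open>g \<noteq> 0\<close> by (metis mult_eq_0_iff)
    hence "12 * (v1 * D v2 - v2 * D v1) = - (of_nat e - 1) * v1 ^ 2"
      by (metis eq_neg_iff_add_eq_0 minus_mult_left)
    also have "- (of_nat e - 1 :: 'a fps) = fps_const (- of_nat (e - 1))"
      using \<open>e \<noteq> 0\<close> by (simp add: of_nat_diff fps_of_nat flip: fps_const_neg fps_const_sub)
    finally have "- of_nat (e - 1) = (0 :: 'a)"
      using \<open>v1 \<noteq> 0\<close> by (rule fps_XD_quotient_ne_const')
    hence "of_nat (e - 1) = (0 :: 'a)" by (metis neg_equal_0_iff_equal)
    moreover have "0 < e - 1" "e - 1 \<le> degree G0"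
      using \<open>\<not> e < 2\<close> \<open>e \<le> degree G0\<close> by simp_all
    ultimately show False using char by blast
  qed
  ultimately have e: "e = 1" by simp
  define M where "M = coeff G 1"
  have "M \<noteq> 0" using G e unfolding M_def by (metis leading_coeff_0_iff)
  have "G = [:coeff G 0, M:]"
    using G(4) e by (intro poly_eqI) (auto simp: M_def coeff_pCons coeff_eq_0 split: nat.splits)
  hence "coeff G 0 + P * M = 0" using G(3) by (metis poly_pCons poly_0 add.right_neutral mult_zero_right)
  hence "P * M = - coeff G 0" by (simp add: eq_neg_iff_add_eq_0 add.commute)
  hence "M \<in> J (w - 2)"
    using coeffs[of 0] coeffs[of 1] MF_uminus by (auto simp: J_def M_def)
  thus ?thesis using \<open>M \<noteq> 0\<close> by blast
qed

text \<open>Multiplying the relation by \<open>M^d\<close> gives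
  \<open>coeff G d * (P * M)^d = M * x\<close> for a form \<open>x\<close>. With respect to
  \<open>M\<close> the factor \<open>P * M\<close> behaves as if it were coprime, so
  \<open>M\<close> divides \<open>coeff G d\<close>. Comparing weights yields
  \<open>k <= w - 2 d\<close> and thus \<open>k + 1 <= w\<close>, whereas \<open>k + 1\<close> is 0
  in the field.\<close>

lemma vanishing_isobaric:
  assumes "isobaric (int w) G" "poly G P = 0"
    and char: "\<And>n. 0 < n \<Longrightarrow> n \<le> w \<Longrightarrow> of_nat n \<noteq> (0 :: 'a)"
  shows "G = 0"
proof (rule ccontr)
  assume "G \<noteq> 0"
  have "2 * degree G \<le> w" using isobaric_degree[OF assms(1) \<open>G \<noteq> 0\<close>] by simp
  hence "\<exists>k. \<exists>M\<in>J k. M \<noteq> 0"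
    using assms \<open>G \<noteq> 0\<close> by (intro J_nontrivial_of_vanishing[of w G]) auto
  then obtain k' M' where M': "M' \<in> J k'" "M' \<noteq> 0" by blast
  define k where "k = (LEAST k. \<exists>M\<in>J (int k). M \<noteq> 0)"
  have pos: "l \<ge> 0" if "x \<in> J l" "x \<noteq> 0" for x l
    using that MF_neg[of x l] by (force simp: J_def)
  have "\<exists>k. \<exists>M\<in>J (int k). M \<noteq> 0"
    using M' pos[OF M'] by (intro exI[of _ "nat k'"]) auto
  hence "\<exists>M\<in>J (int k). M \<noteq> 0" unfolding k_def by (rule LeastI_ex)
  then obtain M where M: "M \<in> J (int k)" "M \<noteq> 0" by blast
  have low: "x = 0" if "l < int k" "x \<in> J l" for l x
    using not_less_Least[of "nat l" "\<lambda>k. \<exists>M\<in>J (int k). M \<noteq> 0"] that pos[of x l]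
    by (fastforce simp: k_def)
  have "of_int (int k + 1) = (0 :: 'a)"
    by (rule J_lowest(3)[OF M]) (use low in blast)
  hence k: "of_nat (k + 1) = (0 :: 'a)" by (simp add: add.commute)
  have J_M: "\<exists>y\<in>MF (l - int k). x = M * y" if "x \<in> J l" for x l
    by (rule J_lowest(4)[OF M _ that]) (use low in blast)
  have PM: "P * M \<in> MF (int k + 2)" using M by (simp add: J_def)
  \<comment> \<open>If \<open>y' * (P * M) = M * x\<close> for a form \<open>x\<close>, then
    \<open>P * y'\<close> is a form, so \<open>y'\<close> lies in \<open>J\<close> and is a multiple
    of \<open>M\<close>. This strips the factors \<open>P * M\<close> one at a time.\<close>
  have div: "\<exists>z\<in>MF (u - int k). y = M * z"
    if "y \<in> MF u" "x \<in> MF (u + int n * (int k + 2) - int k)" "y * (P * M) ^ n = M * x"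
    for y u x n
    using that
  proof (induction n arbitrary: x)
    case (Suc n)
    define y' where "y' = y * (P * M) ^ n"
    have "M * (P * y') = M * x" using Suc.prems(3) by (simp add: y'_def mult_ac)
    hence "P * y' = x" using M by simp
    moreover have "y' \<in> MF (u + int n * (int k + 2))"
      unfolding y'_def using MF_mult[OF Suc.prems(1) MF_power[OF PM, of n]] by simp
    ultimately have "y' \<in> J (u + int n * (int k + 2))"
      using Suc.prems(2) by (simp add: J_def algebra_simps)
    then obtain x' where "x' \<in> MF (u + int n * (int k + 2) - int k)" "y' = M * x'" using J_M by blast
    thus ?case using Suc.IH[of x'] Suc.prems(1) by (simp add: y'_def)
  qed auto
  define d where "d = degree G"
  have coeffs: "coeff G l \<in> MF (int w - 2 * int l)" for l
    using assms unfolding isobaric_def by blast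
  have "d \<noteq> 0"
  proof
    assume "d = 0"
    then obtain g where "G = [:g:]" by (auto simp: d_def elim: degree_eq_zeroE)
    thus False using assms \<open>G \<noteq> 0\<close> by simp
  qed
  define x where "x = - (\<Sum>l<d. coeff G l * (P * M) ^ l * M ^ (d - 1 - l))"
  have "0 = M ^ d * (\<Sum>l\<le>d. coeff G l * P ^ l)"
    using assms(2) by (simp add: poly_altdef d_def)
  also have "\<dots> = (\<Sum>l\<le>d. M ^ d * (coeff G l * P ^ l))"
    by (simp add: sum_distrib_left)
  also have "\<dots> = (\<Sum>l<d. M ^ d * (coeff G l * P ^ l)) + coeff G d * (P * M) ^ d"
    by (simp add: power_mult_distrib mult_ac flip: lessThan_Suc_atMost)
  also have "(\<Sum>l<d. M ^ d * (coeff G l * P ^ l)) = - M * x"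
    unfolding x_def sum_distrib_left minus_mult_minus
  proof (intro sum.cong refl)
    fix l assume "l \<in> {..<d}"
    hence "d = Suc (l + (d - 1 - l))" by simp
    hence "M ^ d = M * M ^ l * M ^ (d - 1 - l)" by (metis power_Suc power_add mult.assoc)
    thus "M ^ d * (coeff G l * P ^ l) = M * (coeff G l * (P * M) ^ l * M ^ (d - 1 - l))"
      by (simp add: power_mult_distrib mult_ac)
  qed
  finally have "coeff G d * (P * M) ^ d = M * x" by (simp add: algebra_simps)
  moreover have "x \<in> MF (int w - 2 * int d + int d * (int k + 2) - int k)"
    unfolding x_def
  proof (intro MF_uminus MF_sum)
    fix l assume "l \<in> {..<d}"
    hence "int w - 2 * int l + int l * (int k + 2) + int (d - 1 - l) * int k =
        int w - 2 * int d + int d * (int k + 2) - int k"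
      by (simp add: of_nat_diff algebra_simps)
    moreover have "M \<in> MF (int k)" using M by (simp add: J_def)
    ultimately show "coeff G l * (P * M) ^ l * M ^ (d - 1 - l) \<in>
        MF (int w - 2 * int d + int d * (int k + 2) - int k)"
      using MF_mult[OF MF_mult[OF coeffs MF_power[OF PM]] MF_power] by metis
  qed
  ultimately obtain z where z: "z \<in> MF (int w - 2 * int d - int k)" "coeff G d = M * z"
    using div[OF coeffs, of x d d] by blast
  have "z \<noteq> 0" using z \<open>G \<noteq> 0\<close> by (auto simp: d_def)
  hence "int w - 2 * int d - int k \<ge> 0" using MF_neg z by fastforce
  hence "k + 1 \<le> w" using \<open>d \<noteq> 0\<close> by linarith
  thus False using k char[of "k + 1"] by simp
qed

section \<open>The Wronskian of an isobaric polynomial and its order at the cusp\<close>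

primrec iter :: "int \<Rightarrow> nat \<Rightarrow> 'a fps poly \<Rightarrow> nat \<Rightarrow> 'a fps poly" where
  "iter w r G 0 = G"
| "iter w r G (Suc i) = Phi (w + 2 * int i) r (iter w r G i)"

lemma isobaric_iter: "isobaric w G \<Longrightarrow> isobaric (w + 2 * int i) (iter w r G i)"
proof (induction i)
  case (Suc i)
  hence "isobaric (w + 2 * int i + 2) (iter w r G (Suc i))" by (auto intro: isobaric_Phi)
  thus ?case by (simp add: algebra_simps)
qed simp

lemma degree_iter: "isobaric w G \<Longrightarrow> degree G \<le> r \<Longrightarrow> degree (iter w r G i) \<le> r"
  by (induction i) (auto intro: degree_Phi isobaric_iter)

definition shifted :: "int \<Rightarrow> nat \<Rightarrow> 'a fps poly \<Rightarrow> nat \<Rightarrow> 'a fps poly" where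
  "shifted w r G i = iter w r G i \<circ>\<^sub>p [:P, 1:]"

lemma shifted_Suc:
  "N r (shifted w r G i) =
     shifted w r G (Suc i) + smult (of_int (w + 2 * int i - int r) * P) (shifted w r G i)"
  by (simp add: shifted_def Phi_pcompose)

lemma degree_shifted: "isobaric w G \<Longrightarrow> degree G \<le> r \<Longrightarrow> degree (shifted w r G i) \<le> r"
  using degree_iter by (simp add: shifted_def degree_pcompose)

lemma N_add: "N r (s + t) = N r s + N r t"
  by (simp add: N_def mapD_add pderiv_add smult_add_right algebra_simps)

lemma N_smult: "N r (smult c s) = smult (12 * D c) s + smult c (N r s)"
  by (simp add: N_def mapD_smult pderiv_smult smult_add_right smult_diff_right algebra_simps)

lemma N_0 [simp]: "N r 0 = 0"
  by (simp add: N_def)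

lemma N_sum: "N r (sum f A) = (\<Sum>x\<in>A. N r (f x))"
  by (induction A rule: infinite_finite_induct) (auto simp: N_add)

text \<open>\<open>D\<close> does not lower the order in \<open>q\<close>, because
  \<open>D (q^n) = n * q^n\<close>, and under \<open>N\<close> the constant coefficient in
  \<open>Y\<close> evolves by itself.\<close>

lemma dvd_coeff_shifted_0:
  assumes "fps_X ^ n dvd poly G P"
  shows "fps_X ^ n dvd coeff (shifted w r G i) 0"
proof (induction i)
  case 0
  show ?case using assms by (simp add: shifted_def coeff_pcompose_0)
next
  case (Suc i)
  then obtain y where y: "coeff (shifted w r G i) 0 = fps_X ^ n * y" by (elim dvdE)
  have "D (fps_X ^ n :: 'a fps) = of_nat n * fps_X ^ n"
    by (rule fps_ext) (auto simp: fps_XD_nth fps_X_power_nth fps_of_nat [symmetric])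
  hence "fps_X ^ n dvd D (fps_X ^ n * y)" by (simp add: fps_XD_mult)
  moreover have "coeff (shifted w r G (Suc i)) 0 =
     12 * D (fps_X ^ n * y) - of_int (w + 2 * int i - int r) * P * (fps_X ^ n * y)"
    using arg_cong[OF shifted_Suc[of r w G i], of "\<lambda>p. coeff p 0"]
    by (simp add: coeff_N_0 y)
  ultimately show ?case by simp
qed

text \<open>The span over the field of Laurent series, with the common denominator \<open>d\<close>
  moved to the left so that only power series occur.\<close>

definition span :: "(nat \<Rightarrow> 'a fps poly) \<Rightarrow> nat \<Rightarrow> 'a fps poly set" where
  "span V t = {s. \<exists>d c. d \<noteq> 0 \<and> smult d s = (\<Sum>i<t. smult (c i) (V i))}"

lemma spanI: "d \<noteq> 0 \<Longrightarrow> smult d s = (\<Sum>i<t. smult (c i) (V i)) \<Longrightarrow> s \<in> span V t"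
  unfolding span_def by blast

lemma span_add:
  assumes "s \<in> span V t" "s' \<in> span V t"
  shows "s + s' \<in> span V t"
proof -
  obtain d c d' c' where "d \<noteq> 0" "smult d s = (\<Sum>i<t. smult (c i) (V i))"
    "d' \<noteq> 0" "smult d' s' = (\<Sum>i<t. smult (c' i) (V i))"
    using assms unfolding span_def by blast
  moreover have "smult (d * d') (s + s') = smult d' (smult d s) + smult d (smult d' s')"
    by (simp add: smult_add_right mult.commute)
  moreover have "smult d' (\<Sum>i<t. smult (c i) (V i)) + smult d (\<Sum>i<t. smult (c' i) (V i)) =
      (\<Sum>i<t. smult (d' * c i + d * c' i) (V i))"
    by (simp add: smult_sum2 smult_add_left sum.distrib)
  ultimately have "d * d' \<noteq> 0" "smult (d * d') (s + s') = (\<Sum>i<t. smult (d' * c i + d * c' i) (V i))"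
    by simp_all
  thus ?thesis by (rule spanI)
qed

lemma span_smult:
  assumes "s \<in> span V t"
  shows "smult a s \<in> span V t"
proof -
  obtain d c where dc: "d \<noteq> 0" "smult d s = (\<Sum>i<t. smult (c i) (V i))"
    using assms unfolding span_def by blast
  have "smult d (smult a s) = smult a (smult d s)" by (simp add: mult.commute)
  also have "\<dots> = (\<Sum>i<t. smult (a * c i) (V i))"
    unfolding dc(2) by (simp add: smult_sum2)
  finally show ?thesis by (rule spanI[OF dc(1)])
qed

lemma span_0: "0 \<in> span V t"
  unfolding span_def by (auto intro!: exI[of _ 1] exI[of _ "\<lambda>_. 0"])

lemma span_sum: "(\<And>i. i \<in> A \<Longrightarrow> f i \<in> span V t) \<Longrightarrow> sum f A \<in> span V t"
  by (induction A rule: infinite_finite_induct) (auto intro: span_add span_0)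

lemma span_base: "i < t \<Longrightarrow> V i \<in> span V t"
proof -
  assume "i < t"
  have "(\<Sum>j<t. smult (if j = i then 1 else 0) (V j)) = (\<Sum>j<t. if j = i then V j else 0)"
    by (intro sum.cong) auto
  also have "\<dots> = smult 1 (V i)" using \<open>i < t\<close> by simp
  finally show ?thesis unfolding span_def
    by (auto intro!: exI[of _ 1] exI[of _ "\<lambda>j. if j = i then 1 else 0"])
qed

lemma span_divide:
  assumes "smult a s \<in> span V t" "a \<noteq> 0"
  shows "s \<in> span V t"
proof -
  obtain d c where dc: "d \<noteq> 0" "smult d (smult a s) = (\<Sum>i<t. smult (c i) (V i))"
    using assms unfolding span_def by blast
  hence "smult (d * a) s = (\<Sum>i<t. smult (c i) (V i))" "d * a \<noteq> 0" using assms by auto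
  thus ?thesis by (intro spanI)
qed

text \<open>
  Over the fraction field, a subspace of the polynomials of degree at most \<open>r\<close> that is stable
  under \<^const>\<open>N\<close> and contains an element with nonzero constant term contains elements of all
  \<open>Y\<close>-orders \<open>0, \<dots>, r\<close>: the gap between two orders would make a constant a derivative.
\<close>
lemma span_orders:
  assumes stable: "\<And>s. s \<in> span V t \<Longrightarrow> N r s \<in> span V t"
    and s0: "s0 \<in> span V t" "coeff s0 0 \<noteq> 0"
    and char: "\<And>n. 0 < n \<Longrightarrow> n \<le> r \<Longrightarrow> of_nat n \<noteq> (0 :: 'a)"
    and "j \<le> r"
  shows "\<exists>s\<in>span V t. coeff s j \<noteq> 0 \<and> (\<forall>i<j. coeff s i = 0)"
  using \<open>j \<le> r\<close>
proof (induction j)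
  case 0
  thus ?case using s0 by auto
next
  case (Suc j)
  then obtain s where s: "s \<in> span V t" "coeff s j \<noteq> 0" "\<And>i. i < j \<Longrightarrow> coeff s i = 0" by auto
  define u v where "u = coeff s j" and "v = coeff s (Suc j)"
  \<comment> \<open>Chosen to cancel the coefficient of order \<open>j\<close>; in order
    \<open>j + 1\<close> it leaves \<open>12 * (u * D v - v * D u) + (r - j) * u^2\<close>.\<close>
  define s' where "s' = smult u (N r s) + smult (- (12 * D u)) s"
  have "s' \<in> span V t" unfolding s'_def by (intro span_add span_smult stable s)
  moreover have "coeff s' i = 0" if "i < Suc j" for i
  proof (cases i)
    case 0
    thus ?thesis using s(3)[of 0] by (cases "j = 0") (auto simp: s'_def coeff_N_0 u_def)
  next
    case (Suc i')
    have "coeff s i' = 0" using s(3)[of i'] that Suc by simp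
    thus ?thesis using s(3)[of i] that Suc
      by (cases "i = j") (auto simp: s'_def coeff_N_Suc u_def)
  qed
  moreover have "coeff s' (Suc j) \<noteq> 0"
  proof
    assume "coeff s' (Suc j) = 0"
    hence "12 * (u * D v - v * D u) = - (of_nat r - of_nat j) * u ^ 2"
      by (simp add: s'_def coeff_N_Suc u_def [symmetric] v_def [symmetric] algebra_simps
          power2_eq_square eq_neg_iff_add_eq_0)
    also have "(of_nat r - of_nat j :: 'a fps) = of_nat (r - j)"
      using Suc.prems by (simp add: of_nat_diff)
    also have "- of_nat (r - j) = (fps_const (- of_nat (r - j)) :: 'a fps)"
      by (metis fps_of_nat fps_const_neg)
    finally have "- of_nat (r - j) = (0 :: 'a)"
      by (rule fps_XD_quotient_ne_const') (use s(2) in \<open>simp add: u_def\<close>)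
    hence "of_nat (r - j) = (0 :: 'a)" by (metis neg_equal_0_iff_equal)
    thus False using char[of "r - j"] Suc.prems by simp
  qed
  ultimately show ?case by blast
qed

text \<open>A singular matrix yields a row relation \<open>c\<close> and a column relation
  \<open>lam\<close>. The row relation makes the span of the first few iterates stable under
  \<open>N\<close>, so it contains vectors of every order by \<open>span_orders\<close>, and a
  functional that kills all of them is 0.\<close>

lemma dependent_shifted:
  assumes G: "isobaric w G" "degree G \<le> r" "poly G P \<noteq> 0"
    and char: "\<And>n. 0 < n \<Longrightarrow> n \<le> r \<Longrightarrow> of_nat n \<noteq> (0 :: 'a)"
    and c: "(\<Sum>i\<le>r. smult (c i) (shifted w r G i)) = 0" "\<exists>i\<le>r. c i \<noteq> 0"
    and lam: "\<And>i. i \<le> r \<Longrightarrow> (\<Sum>k\<le>r. lam k * coeff (shifted w r G i) k) = 0"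
    and "k \<le> r"
  shows "lam k = 0"
proof -
  define V where "V = shifted w r G"
  \<comment> \<open>The last index in the relation: \<open>V t\<close> depends on its predecessors,
    so these span a space stable under \<open>N\<close>.\<close>
  define t where "t = Max {i. i \<le> r \<and> c i \<noteq> 0}"
  have "t \<in> {i. i \<le> r \<and> c i \<noteq> 0}"
    unfolding t_def using c(2) by (intro Max_in) auto
  hence t: "t \<le> r" "c t \<noteq> 0" by auto
  have "i \<le> t" if "i \<le> r" "c i \<noteq> 0" for i
    unfolding t_def using that by (intro Max_ge) auto
  hence t': "c i = 0" if "t < i" "i \<le> r" for i
    using that by force
  have V0: "coeff (V 0) 0 \<noteq> 0" using G by (simp add: V_def shifted_def coeff_pcompose_0)
  have "(\<Sum>i\<le>r. smult (c i) (V i)) = (\<Sum>i\<le>t. smult (c i) (V i))"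
    using t t' by (intro sum.mono_neutral_right) auto
  hence top: "smult (c t) (V t) = - (\<Sum>i<t. smult (c i) (V i))"
    using c(1) by (simp add: V_def eq_neg_iff_add_eq_0 add.commute flip: lessThan_Suc_atMost)
  have "t \<noteq> 0"
  proof
    assume "t = 0"
    hence "V 0 = 0" using top t by simp
    thus False using V0 by simp
  qed
  have "(\<Sum>i<t. smult (c i) (V i)) \<in> span V t"
    by (intro span_sum span_smult span_base) auto
  from span_smult[OF this, of "-1"] have "smult (c t) (V t) \<in> span V t"
    unfolding top by simp
  hence "V t \<in> span V t" using t(2) by (rule span_divide)
  hence Vt: "V i \<in> span V t" if "i \<le> t" for i
    using that span_base[of i t V] by (cases "i = t") simp_all
  have stable: "N r s \<in> span V t" if s: "s \<in> span V t" for s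
  proof -
    obtain d a where da: "d \<noteq> 0" "smult d s = (\<Sum>i<t. smult (a i) (V i))"
      using s unfolding span_def by blast
    have "N r (V i) \<in> span V t" if "i < t" for i
    proof -
      have "N r (V i) = V (Suc i) + smult (of_int (w + 2 * int i - int r) * P) (V i)"
        unfolding V_def by (rule shifted_Suc)
      thus ?thesis using Vt[of "Suc i"] Vt[of i] that by (simp add: span_add span_smult)
    qed
    hence 1: "N r (smult d s) \<in> span V t"
      unfolding da(2) N_sum N_smult by (intro span_sum span_add span_smult) (auto intro: span_base)
    have 2: "smult d (N r s) = N r (smult d s) + smult (- (12 * D d)) s"
      by (simp add: N_smult)
    have "smult d (N r s) \<in> span V t"
      unfolding 2 by (intro span_add span_smult s 1)
    thus ?thesis using da(1) span_divide by blast
  qed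
  have kill: "(\<Sum>k\<le>r. lam k * coeff s k) = 0" if s: "s \<in> span V t" for s
  proof -
    obtain d a where da: "d \<noteq> 0" "smult d s = (\<Sum>i<t. smult (a i) (V i))"
      using s unfolding span_def by blast
    have "d * (\<Sum>k\<le>r. lam k * coeff s k) = (\<Sum>k\<le>r. lam k * coeff (smult d s) k)"
      by (simp add: sum_distrib_left mult_ac)
    also have "\<dots> = (\<Sum>k\<le>r. \<Sum>i<t. a i * (lam k * coeff (V i) k))"
      unfolding da(2) by (simp add: coeff_sum sum_distrib_left mult_ac)
    also have "\<dots> = (\<Sum>i<t. a i * (\<Sum>k\<le>r. lam k * coeff (V i) k))"
      by (subst sum.swap) (simp add: sum_distrib_left)
    also have "\<dots> = 0" using lam t by (simp add: V_def)
    finally show ?thesis using da(1) by simp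
  qed
  have "V 0 \<in> span V t" using Vt by simp
  have orders: "\<exists>s\<in>span V t. coeff s j \<noteq> 0 \<and> (\<forall>i<j. coeff s i = 0)" if "j \<le> r" for j
  proof (rule span_orders[of V t r "V 0"])
    fix s assume "s \<in> span V t"
    thus "N r s \<in> span V t" by (rule stable)
  next
    fix n assume "0 < n" "n \<le> r"
    thus "of_nat n \<noteq> (0 :: 'a)" by (rule char)
  qed fact+
  \<comment> \<open>Downwards from \<open>r\<close>: on a vector of order \<open>k\<close> only
    \<open>lam k\<close> and later entries contribute, and the later ones are already known to be
    0.\<close>
  have "lam (r - n) = 0" if "n \<le> r" for n
    using that
  proof (induction n rule: less_induct)
    case (less n)
    obtain s where s: "s \<in> span V t" "coeff s (r - n) \<noteq> 0" "\<forall>i<r - n. coeff s i = 0"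
      using orders[of "r - n"] by auto
    have zero: "lam k * coeff s k = 0" if "k \<le> r" "k \<noteq> r - n" for k
    proof (cases "k < r - n")
      case False
      hence "r - k < n" "r - k \<le> r" "k = r - (r - k)" using that less.prems by auto
      thus ?thesis using less.IH[of "r - k"] by simp
    qed (use s in simp)
    have "(\<Sum>k\<le>r. lam k * coeff s k) = (\<Sum>k\<in>{r - n}. lam k * coeff s k)"
      using zero by (intro sum.mono_neutral_right) auto
    thus ?case using kill[OF s(1)] s(2) by simp
  qed
  from this[of "r - k"] show ?thesis using \<open>k \<le> r\<close> by simp
qed

lemma coeff_pcompose_Taylor:
  assumes "degree G \<le> r"
  shows "coeff (G \<circ>\<^sub>p [:P, 1:]) k = (\<Sum>l\<le>r. coeff G l * coeff ([:P, 1:] ^ l) k)"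
proof -
  have "G = (\<Sum>l\<le>r. monom (coeff G l) l)"
    using assms by (simp add: poly_as_sum_of_monoms')
  hence "G \<circ>\<^sub>p [:P, 1:] = (\<Sum>l\<le>r. monom (coeff G l) l) \<circ>\<^sub>p [:P, 1:]" by simp
  also have "\<dots> = (\<Sum>l\<le>r. smult (coeff G l) ([:P, 1:] ^ l))"
  proof -
    have "[:0, 1:] ^ l \<circ>\<^sub>p [:P, 1:] = [:P, 1:] ^ l" for l
      by (induction l) (simp_all add: pcompose_1 pcompose_pCons pcompose_mult)
    thus ?thesis by (simp add: pcompose_sum monom_altdef pcompose_smult)
  qed
  finally show ?thesis by (simp add: coeff_sum)
qed

text \<open>
  The determinant of the coefficients of \<open>G\<close> and its iterates under \<^const>\<open>Phi\<close> is a modular form; a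
  unipotent column change, substituting \<open>P + Y\<close> for \<open>X\<close>, makes the order of \<open>G\<close> at the cusp visible in
  the first column.
\<close>
lemma isobaric_order:
  assumes G: "isobaric w G" "degree G \<le> r" "poly G P \<noteq> 0"
    and char: "\<And>n. 0 < n \<Longrightarrow> n \<le> r \<Longrightarrow> of_nat n \<noteq> (0 :: 'a)"
  shows "\<exists>n a b. subdegree (poly G P) \<le> n \<and> 12 * int n + 4 * int a + 6 * int b = (int r + 1) * w"
proof -
  define A where "A = mat (Suc r) (Suc r) (\<lambda>(i, l). coeff (iter w r G i) l)"
  define U where "U = mat (Suc r) (Suc r) (\<lambda>(l, k). coeff ([:P, 1:] ^ l) k)"
  define B where "B = mat (Suc r) (Suc r) (\<lambda>(i, k). coeff (shifted w r G i) k)"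
  have carrier: "A \<in> carrier_mat (Suc r) (Suc r)" "U \<in> carrier_mat (Suc r) (Suc r)"
    "B \<in> carrier_mat (Suc r) (Suc r)" unfolding A_def U_def B_def by (rule mat_carrier)+
  have "B = A * U"
  proof (rule eq_matI)
    fix i k assume "i < dim_row (A * U)" "k < dim_col (A * U)"
    hence ik: "i < Suc r" "k < Suc r" using carrier by simp_all
    have "(A * U) $$ (i, k) = (\<Sum>l<Suc r. A $$ (i, l) * U $$ (l, k))"
      using ik carrier by (simp add: scalar_prod_def atLeast0LessThan)
    also have "\<dots> = (\<Sum>l\<le>r. coeff (iter w r G i) l * coeff ([:P, 1:] ^ l) k)"
      unfolding lessThan_Suc_atMost using ik by (intro sum.cong) (auto simp: A_def U_def)
    also have "\<dots> = coeff (shifted w r G i) k"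
      unfolding shifted_def by (rule coeff_pcompose_Taylor [symmetric]) (rule degree_iter[OF G(1,2)])
    also have "\<dots> = B $$ (i, k)" using ik by (simp add: B_def)
    finally show "B $$ (i, k) = (A * U) $$ (i, k)" ..
  qed (use carrier in simp_all)
  \<comment> \<open>Row \<open>l\<close> holds the coefficients of \<open>(P + Y)^l\<close>, a monic
    polynomial of degree \<open>l\<close> in \<open>Y\<close>.\<close>
  moreover have "Determinant.det U = 1"
  proof -
    have "Determinant.det U = prod_list (diag_mat U)"
      by (rule det_lower_triangular[OF _ carrier(2)])
         (auto simp: U_def degree_linear_power intro!: coeff_eq_0)
    also have "diag_mat U = map (\<lambda>_. 1) [0..<Suc r]"
      unfolding diag_mat_def using coeff_linear_power[of P]
      by (intro map_cong) (auto simp: U_def)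
    also have "prod_list \<dots> = 1" by (induction r) auto
    finally show ?thesis .
  qed
  ultimately have AB: "Determinant.det A = Determinant.det B"
    using det_mult[OF carrier(1,2)] by simp
  have det_MF: "Determinant.det A \<in> MF ((int r + 1) * w)"
  proof -
    have "of_int (sign p) * (\<Prod>i = 0..<Suc r. A $$ (i, p i)) \<in> MF ((int r + 1) * w)"
      if p: "p permutes {0..<Suc r}" for p
    proof -
      \<comment> \<open>The entry in row \<open>i\<close> and column \<open>l\<close> has weight
        \<open>w + 2 i - 2 l\<close>; along a permutation the contributions of rows and columns
        cancel.\<close>
      have "(\<Prod>i = 0..<Suc r. A $$ (i, p i)) \<in>
              MF (\<Sum>i = 0..<Suc r. w + 2 * int i - 2 * int (p i))"
      proof (rule MF_prod)
        fix i assume "i \<in> {0..<Suc r}"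
        moreover from this have "p i \<in> {0..<Suc r}" using permutes_in_image[OF p] by blast
        ultimately show "A $$ (i, p i) \<in> MF (w + 2 * int i - 2 * int (p i))"
          using isobaric_iter[OF G(1)] by (auto simp: A_def isobaric_def)
      qed simp
      also have "(\<Sum>i = 0..<Suc r. w + 2 * int i - 2 * int (p i)) =
          (\<Sum>i = 0..<Suc r. w) + 2 * (\<Sum>i = 0..<Suc r. int i) - 2 * (\<Sum>i = 0..<Suc r. int (p i))"
        by (simp only: sum.distrib sum_subtractf sum_distrib_left)
      also have "(\<Sum>i = 0..<Suc r. int (p i)) = (\<Sum>i = 0..<Suc r. int i)"
        using sum.permute[OF p, of int] by (simp add: o_def)
      finally show ?thesis by (intro MF_of_int) (simp add: algebra_simps)
    qed
    thus ?thesis using carrier by (auto simp: Determinant.det_def intro!: MF_sum)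
  qed
  have dvd: "fps_X ^ subdegree (poly G P) dvd Determinant.det B"
  proof -
    have "fps_X ^ subdegree (poly G P) dvd poly G P"
      by (metis subdegree_decompose dvd_triv_right)
    hence dvd: "fps_X ^ subdegree (poly G P) dvd coeff (shifted w r G i) 0" for i
      using dvd_coeff_shifted_0 by blast
    have "Determinant.det B = (\<Sum>i<Suc r. B $$ (i, 0) * cofactor B i 0)"
      using laplace_expansion_column[OF carrier(3), of 0] by simp
    also have "fps_X ^ subdegree (poly G P) dvd \<dots>"
      using dvd by (intro dvd_sum dvd_mult2) (auto simp: B_def)
    finally show ?thesis .
  qed
  have det_nz: "Determinant.det B \<noteq> 0"
  proof
    assume B0: "Determinant.det B = 0"
    then obtain v where v: "v \<in> carrier_vec (Suc r)" "v \<noteq> 0\<^sub>v (Suc r)" "B *\<^sub>v v = 0\<^sub>v (Suc r)"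
      using det_0_iff_vec_prod_zero[OF carrier(3)] by blast
    have "Determinant.det (transpose_mat B) = 0" using B0 det_transpose[OF carrier(3)] by simp
    then obtain c where c: "c \<in> carrier_vec (Suc r)" "c \<noteq> 0\<^sub>v (Suc r)"
      "transpose_mat B *\<^sub>v c = 0\<^sub>v (Suc r)"
      using det_0_iff_vec_prod_zero[of "transpose_mat B" "Suc r"] carrier by auto
    have row: "(\<Sum>k\<le>r. vec_index v k * coeff (shifted w r G i) k) = 0" if "i \<le> r" for i
    proof -
      have "(\<Sum>k\<le>r. vec_index v k * coeff (shifted w r G i) k) =
            (\<Sum>k<Suc r. B $$ (i, k) * vec_index v k)"
        unfolding lessThan_Suc_atMost using that by (intro sum.cong) (auto simp: B_def)
      also have "\<dots> = vec_index (B *\<^sub>v v) i"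
        using v(1) carrier that by (simp add: scalar_prod_def atLeast0LessThan)
      also have "\<dots> = 0" using v(3) that by simp
      finally show ?thesis .
    qed
    have col: "(\<Sum>i\<le>r. vec_index c i * coeff (shifted w r G i) k) = 0" if "k \<le> r" for k
    proof -
      have "(\<Sum>i\<le>r. vec_index c i * coeff (shifted w r G i) k) =
            (\<Sum>i<Suc r. B $$ (i, k) * vec_index c i)"
        unfolding lessThan_Suc_atMost using that by (intro sum.cong) (auto simp: B_def)
      also have "\<dots> = vec_index (transpose_mat B *\<^sub>v c) k"
        using c(1) carrier that by (simp add: scalar_prod_def atLeast0LessThan)
      also have "\<dots> = 0" using c(3) that by simp
      finally show ?thesis .
    qed
    have sum0: "(\<Sum>i\<le>r. smult (vec_index c i) (shifted w r G i)) = 0"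
    proof (rule poly_eqI)
      fix k
      show "coeff (\<Sum>i\<le>r. smult (vec_index c i) (shifted w r G i)) k = coeff 0 k"
      proof (cases "k \<le> r")
        case False
        hence "coeff (shifted w r G i) k = 0" for i
          using degree_shifted[OF G(1,2), of i] by (intro coeff_eq_0) auto
        thus ?thesis by (simp add: coeff_sum)
      qed (use col in \<open>simp add: coeff_sum\<close>)
    qed
    have nz: "\<exists>i\<le>r. vec_index c i \<noteq> 0"
    proof (rule ccontr)
      assume "\<not> ?thesis"
      hence "c = 0\<^sub>v (Suc r)" using c(1) by (intro eq_vecI) auto
      thus False using c(2) by blast
    qed
    have "vec_index v k = 0" if "k \<le> r" for k
    proof (rule dependent_shifted[where lam = "vec_index v", OF G _ sum0 nz _ that])
      fix n assume "0 < n" "n \<le> r"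
      thus "of_nat n \<noteq> (0 :: 'a)" by (rule char)
    next
      fix i assume "i \<le> r"
      thus "(\<Sum>k\<le>r. vec_index v k * coeff (shifted w r G i) k) = 0" by (rule row)
    qed
    hence "v = 0\<^sub>v (Suc r)" using v(1) by (intro eq_vecI) auto
    thus False using v(2) by blast
  qed
  have "subdegree (poly G P) \<le> subdegree (Determinant.det B)"
    using dvd_imp_subdegree_le[OF dvd det_nz] by simp
  thus ?thesis using subdegree_MF[OF det_MF] det_nz unfolding AB by blast
qed

end

section \<open>The transformation law of $E_2$\<close>

text \<open>The half-open range pairs \<open>n\<close> with \<open>- 1 - n\<close>, which matches
  the reflection from \<open>z\<close> to \<open>1 - z\<close> of the digamma function.\<close>

lemma sum_int_symmetric:
  fixes f :: "int \<Rightarrow> 'a::comm_monoid_add"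
  shows "(\<Sum>n\<in>{- int N..<int N}. f n) = (\<Sum>n<N. f (int n) + f (- 1 - int n))"
proof (induction N)
  case (Suc N)
  have "{- int (Suc N)..<int (Suc N)} = insert (- 1 - int N) (insert (int N) {- int N..<int N})"
    by auto
  thus ?case using Suc by (simp add: add_ac)
qed simp

lemma has_sum_int_symmetric:
  fixes f :: "int \<Rightarrow> 'a::{comm_monoid_add, topological_space}"
  assumes "(f has_sum S) UNIV"
  shows "(\<lambda>N. \<Sum>n\<in>{- int N..<int N}. f n) \<longlonglongrightarrow> S"
proof -
  have "filterlim (\<lambda>N. {- int N..<int N}) (finite_subsets_at_top UNIV) sequentially"
    unfolding filterlim_finite_subsets_at_top
  proof safe
    fix X :: "int set" assume X: "finite X"
    define N where "N = Suc (\<Sum>x\<in>X. nat \<bar>x\<bar>)"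
    have *: "\<bar>x\<bar> < int N" if "x \<in> X" for x
    proof -
      have "nat \<bar>x\<bar> < N"
        using member_le_sum[of x X "\<lambda>x. nat \<bar>x\<bar>"] that X by (simp add: N_def)
      thus ?thesis by linarith
    qed
    show "\<forall>\<^sub>F n in sequentially. finite {- int n..<int n} \<and> X \<subseteq> {- int n..<int n} \<and>
            {- int n..<int n} \<subseteq> UNIV"
      using eventually_ge_at_top[of N] by eventually_elim (use * in fastforce)
  qed
  with assms show ?thesis
    unfolding has_sum_def by (rule filterlim_compose)
qed

lemma has_sum_int_halves:
  fixes f :: "int \<Rightarrow> 'a::topological_comm_monoid_add"
  assumes "((\<lambda>n. f (int n)) has_sum a) UNIV" "((\<lambda>n. f (- 1 - int n)) has_sum b) UNIV"
  shows "(f has_sum (a + b)) UNIV"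
proof -
  have "(f has_sum a) {0..}"
    using assms(1) by (subst has_sum_reindex_bij_witness[of _ int nat UNIV "\<lambda>n. f (int n)"]) auto
  moreover have "(f has_sum b) {..<0}"
    using assms(2)
    by (subst has_sum_reindex_bij_witness[of _ "\<lambda>n. - 1 - int n" "\<lambda>n. nat (- 1 - n)" UNIV
          "\<lambda>n. f (- 1 - int n)"]) auto
  ultimately have "(f has_sum (a + b)) ({0..} \<union> {..<0})"
    by (intro has_sum_Un_disjoint) auto
  also have "{0..} \<union> {..<0} = (UNIV :: int set)" by auto
  finally show ?thesis .
qed

section \<open>Partial fractions of the cotangent and of its derivative\<close>

lemma complex_int_Im: "z \<in> \<int> \<Longrightarrow> Im z = 0"
  by (auto elim: Ints_cases)

text \<open>The logarithmic derivative of the reflection formula for the Gamma function.\<close>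

lemma Digamma_reflection:
  fixes z :: complex
  assumes "z \<notin> \<int>"
  shows "Digamma (1 - z) - Digamma z = of_real pi * cot (of_real pi * z)"
proof -
  have sin: "sin (of_real pi * z) \<noteq> 0"
    using assms by (auto simp: sin_eq_0)
  have z: "z \<notin> \<int>\<^sub>\<le>\<^sub>0" "1 - z \<notin> \<int>\<^sub>\<le>\<^sub>0"
    using assms nonpos_Ints_Int[of z] nonpos_Ints_Int[of "1 - z"] by auto
  have "((\<lambda>z. Gamma z * Gamma (1 - z)) has_field_derivative
     Gamma z * Gamma (1 - z) * (Digamma z - Digamma (1 - z))) (at z)"
    using z by (auto intro!: derivative_eq_intros simp: algebra_simps)
  also have "(\<lambda>z::complex. Gamma z * Gamma (1 - z)) = (\<lambda>z. of_real pi / sin (of_real pi * z))"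
    by (intro ext Gamma_reflection_complex)
  finally have "((\<lambda>z. of_real pi / sin (of_real pi * z)) has_field_derivative
     of_real pi / sin (of_real pi * z) * (Digamma z - Digamma (1 - z))) (at z)" .
  moreover have "((\<lambda>z. of_real pi / sin (of_real pi * z)) has_field_derivative
     - (of_real pi / sin (of_real pi * z)) * (of_real pi * cot (of_real pi * z))) (at z)"
    using sin by (auto intro!: derivative_eq_intros simp: cot_def field_simps power2_eq_square)
  ultimately have "of_real pi / sin (of_real pi * z) * (Digamma z - Digamma (1 - z)) =
     - (of_real pi / sin (of_real pi * z)) * (of_real pi * cot (of_real pi * z))"
    by (rule DERIV_unique)
  moreover have "of_real pi / sin (of_real pi * z) \<noteq> 0"
    using sin by simp
  ultimately have "Digamma z - Digamma (1 - z) = - (of_real pi * cot (of_real pi * z))"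
    by (metis minus_mult_commute mult_left_cancel)
  thus ?thesis by (simp add: algebra_simps)
qed

text \<open>The logarithms in the two limit formulas for \<open>Digamma\<close> cancel; the
  remaining sums are the negative and the nonnegative half of the range.\<close>

lemma cot_partial_fractions:
  fixes z :: complex
  assumes "z \<notin> \<int>"
  shows "(\<lambda>N. \<Sum>n\<in>{- int N..<int N}. 1 / (z + of_int n)) \<longlonglongrightarrow> of_real pi * cot (of_real pi * z)"
proof -
  have z: "z \<noteq> 0" "1 - z \<noteq> 0" using assms by auto
  have "(\<lambda>m. (of_real (ln (real m)) - (\<Sum>n<m. inverse (1 - z + of_nat n)))
           - (of_real (ln (real m)) - (\<Sum>n<m. inverse (z + of_nat n))))
        \<longlonglongrightarrow> Digamma (1 - z) - Digamma z"
    by (intro tendsto_diff Digamma_LIMSEQ z)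
  also have "(\<lambda>m. (of_real (ln (real m)) - (\<Sum>n<m. inverse (1 - z + of_nat n)))
           - (of_real (ln (real m)) - (\<Sum>n<m. inverse (z + of_nat n)))) =
        (\<lambda>N. \<Sum>n\<in>{- int N..<int N}. 1 / (z + of_int n))"
  proof
    fix N
    have *: "inverse (z + (- 1 - of_nat n)) = - inverse (1 - z + of_nat n)" for n
    proof -
      have "z + (- 1 - of_nat n) = - (1 - z + of_nat n)" by simp
      thus ?thesis by (simp only: inverse_minus_eq)
    qed
    show "(of_real (ln (real N)) - (\<Sum>n<N. inverse (1 - z + of_nat n)))
           - (of_real (ln (real N)) - (\<Sum>n<N. inverse (z + of_nat n))) =
        (\<Sum>n\<in>{- int N..<int N}. 1 / (z + of_int n))"
      unfolding sum_int_symmetric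
      by (simp add: sum.distrib sum_negf sum_subtractf divide_inverse * del: inverse_minus_eq)
  qed
  finally show ?thesis using Digamma_reflection[OF assms] by simp
qed

lemma Polygamma_1_reflection:
  fixes z :: complex
  assumes "Im z > 0"
  shows "Polygamma 1 z + Polygamma 1 (1 - z) = (of_real pi / sin (of_real pi * z)) ^ 2"
proof -
  have nint: "w \<notin> \<int>" if "Im w > 0" for w using that complex_int_Im[of w] by auto
  have sin: "sin (of_real pi * z) \<noteq> 0" using nint[OF assms] by (auto simp: sin_eq_0)
  have z: "z \<notin> \<int>\<^sub>\<le>\<^sub>0" "1 - z \<notin> \<int>\<^sub>\<le>\<^sub>0"
    using nint[OF assms] nonpos_Ints_Int[of z] nonpos_Ints_Int[of "1 - z"] by auto
  have "((\<lambda>z. Digamma (1 - z) - Digamma z) has_field_derivative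
     (- Polygamma 1 (1 - z) - Polygamma 1 z)) (at z)"
    using z by (auto intro!: derivative_eq_intros)
  moreover have "((\<lambda>z. of_real pi * cot (of_real pi * z)) has_field_derivative
     (- ((of_real pi / sin (of_real pi * z)) ^ 2))) (at z)"
    using sin
    by (auto intro!: derivative_eq_intros DERIV_chain2[OF DERIV_cot]
        simp: power2_eq_square field_simps)
  hence "((\<lambda>z. Digamma (1 - z) - Digamma z) has_field_derivative
     (- ((of_real pi / sin (of_real pi * z)) ^ 2))) (at z)"
    by (rule has_field_derivative_transform_within_open[of _ _ _ "{z. Im z > 0}"])
       (use assms nint in \<open>auto simp: Digamma_reflection open_halfspace_Im_gt\<close>)
  ultimately have "- Polygamma 1 (1 - z) - Polygamma 1 z = - ((of_real pi / sin (of_real pi * z)) ^ 2)"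
    by (rule DERIV_unique)
  thus ?thesis by (simp add: algebra_simps add_eq_0_iff)
qed

section \<open>Absolutely convergent sums over a row of the lattice\<close>

lemma norm_linear_ge:
  fixes z :: complex
  assumes "Im z > 0"
  obtains c where "c > 0" "\<And>a b :: real. norm (of_real a * z + of_real b) \<ge> c * max \<bar>a\<bar> \<bar>b\<bar>"
proof
  \<comment> \<open>The second bound serves the case \<open>|a| * norm z > |b| / 2\<close>, in which
    the imaginary part \<open>|a| * Im z\<close> has to control \<open>|b|\<close> as well.\<close>
  define c where "c = min (Im z) (Im z / (2 * norm z))"
  have nz: "norm z > 0" using assms by auto
  show "c > 0" using assms nz by (simp add: c_def)
  fix a b :: real
  have 1: "norm (of_real a * z + of_real b) \<ge> \<bar>a\<bar> * Im z"
    using abs_Im_le_cmod[of "of_real a * z + of_real b"] assms by (simp add: abs_mult)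
  have "norm (of_real b :: complex) \<le> norm (of_real a * z + of_real b) + norm (of_real a * z)"
    using norm_triangle_ineq4[of "of_real a * z + of_real b" "of_real a * z"] by simp
  hence 2: "\<bar>b\<bar> \<le> norm (of_real a * z + of_real b) + \<bar>a\<bar> * norm z"
    by (simp add: norm_mult)
  have "c \<le> Im z" by (simp add: c_def)
  hence ca: "c * \<bar>a\<bar> \<le> \<bar>a\<bar> * Im z"
    using mult_right_mono[of c "Im z" "\<bar>a\<bar>"] by (simp add: mult.commute)
  have "c \<le> Im z / (2 * norm z)" by (simp add: c_def)
  also have "\<dots> \<le> 1 / 2"
    using abs_Im_le_cmod[of z] assms nz by (simp add: field_simps)
  finally have c2: "c \<le> 1 / 2" .
  have "c * \<bar>b\<bar> \<le> norm (of_real a * z + of_real b)"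
  proof (cases "\<bar>a\<bar> * norm z \<le> \<bar>b\<bar> / 2")
    case True
    hence "\<bar>b\<bar> / 2 \<le> norm (of_real a * z + of_real b)" using 2 by linarith
    moreover have "c * \<bar>b\<bar> \<le> 1 / 2 * \<bar>b\<bar>" using c2 by (intro mult_right_mono) auto
    ultimately show ?thesis by linarith
  next
    case False
    have "c * \<bar>b\<bar> \<le> Im z / (2 * norm z) * \<bar>b\<bar>" by (intro mult_right_mono) (auto simp: c_def)
    also have "\<dots> = (Im z / norm z) * (\<bar>b\<bar> / 2)" by simp
    also have "\<dots> \<le> (Im z / norm z) * (\<bar>a\<bar> * norm z)"
      using False assms by (intro mult_left_mono) auto
    also have "\<dots> = \<bar>a\<bar> * Im z" using nz by simp
    finally show ?thesis using 1 by linarith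
  qed
  thus "norm (of_real a * z + of_real b) \<ge> c * max \<bar>a\<bar> \<bar>b\<bar>"
    using 1 ca by (auto simp: max_def)
qed

lemma summable_norm_inverse_squares:
  fixes z :: complex
  assumes "Im z \<noteq> 0"
  shows "summable (\<lambda>n. norm (1 / (z + of_nat n) ^ 2))"
proof -
  have "\<exists>c>0. \<forall>b :: real. norm (z + of_real b) \<ge> c * max 1 \<bar>b\<bar>"
  proof (cases "Im z > 0")
    case True
    then obtain c where "c > 0" "\<And>a b :: real. norm (of_real a * z + of_real b) \<ge> c * max \<bar>a\<bar> \<bar>b\<bar>"
      using norm_linear_ge by blast
    from this(1) this(2)[of 1] show ?thesis by auto
  next
    case False
    hence "Im (- z) > 0" using assms by simp
    then obtain c where c: "c > 0" "\<And>a b :: real. norm (of_real a * (- z) + of_real b) \<ge> c * max \<bar>a\<bar> \<bar>b\<bar>"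
      using norm_linear_ge by blast
    thus ?thesis using c(2)[of "-1"] by auto
  qed
  then obtain c where c: "c > 0" "\<And>b :: real. norm (z + of_real b) \<ge> c * max 1 \<bar>b\<bar>" by blast
  have bound: "norm (1 / (z + of_nat n) ^ 2) \<le> (1 / c ^ 2) * (1 / real n ^ 2)" if "n \<ge> 1" for n
  proof -
    have "c * real n \<le> norm (z + of_nat n)"
      using c(2)[of "real n"] that by simp
    hence "(c * real n) ^ 2 \<le> norm (z + of_nat n) ^ 2"
      using c(1) by (intro power_mono) auto
    moreover have "0 < (c * real n) ^ 2" using c(1) that by simp
    ultimately have "1 / norm (z + of_nat n) ^ 2 \<le> 1 / (c * real n) ^ 2"
      by (intro divide_left_mono mult_pos_pos) auto
    thus ?thesis by (simp add: norm_divide norm_power power_mult_distrib)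
  qed
  have summ: "summable (\<lambda>n. (1 / c ^ 2) * (1 / real n ^ 2))"
    using inverse_power_summable[of 2, where 'a = real]
    by (intro summable_mult) (simp add: field_simps)
  show ?thesis
  proof (rule summable_comparison_test'[OF summ])
    fix n :: nat assume "n \<ge> 1"
    from bound[OF this] show "norm (norm (1 / (z + of_nat n) ^ 2)) \<le> (1 / c ^ 2) * (1 / real n ^ 2)"
      by simp
  qed
qed

text \<open>For the Lipschitz formula: \<open>psi (to_nome z)\<close> is the sum of
  \<open>1 / (z + n)^2\<close> over all integers \<open>n\<close>, and \<open>psi x\<close> is
  \<open>(2 pi i)^2\<close> times the sum of \<open>d * x^d\<close>.\<close>

definition psi :: "complex \<Rightarrow> complex" where
  "psi x = - 4 * of_real pi ^ 2 * (x / (1 - x) ^ 2)"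

lemma norm_to_nome: "norm (to_nome z) = exp (- 2 * pi * Im z)"
  by (simp add: to_nome_def)

lemma to_nome_neq_0 [simp]: "to_nome z \<noteq> 0"
  by (simp add: to_nome_def)

lemma norm_to_nome_less: "Im z > 0 \<Longrightarrow> norm (to_nome z) < 1"
  by (simp add: norm_to_nome)

lemma to_nome_of_nat: "to_nome (of_nat m * z) = to_nome z ^ m"
  unfolding to_nome_def exp_of_nat_mult [symmetric] by (simp add: mult_ac)

lemma has_sum_inverse_squares:
  assumes "Im z > 0"
  shows "((\<lambda>n::int. 1 / (z + of_int n) ^ 2) has_sum psi (to_nome z)) UNIV"
proof -
  have z: "z \<noteq> 0" "1 - z \<noteq> 0" using assms by auto
  have 1: "(\<lambda>n. 1 / (z + of_nat n) ^ 2) sums Polygamma 1 z"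
    using Polygamma_LIMSEQ[OF z(1), of 1] by (simp add: divide_inverse power2_eq_square)
  have 2: "(\<lambda>n. 1 / (1 - z + of_nat n) ^ 2) sums Polygamma 1 (1 - z)"
    using Polygamma_LIMSEQ[OF z(2), of 1] by (simp add: divide_inverse power2_eq_square)
  have "((\<lambda>n. 1 / (z + of_nat n) ^ 2) has_sum Polygamma 1 z) UNIV"
    using assms 1 by (intro norm_summable_imp_has_sum summable_norm_inverse_squares) auto
  moreover have "((\<lambda>n. 1 / (1 - z + of_nat n) ^ 2) has_sum Polygamma 1 (1 - z)) UNIV"
    using assms 2 by (intro norm_summable_imp_has_sum summable_norm_inverse_squares) auto
  moreover have "(1 - z + of_nat n) ^ 2 = (z + of_int (- 1 - int n)) ^ 2" for n
    by (simp add: power2_eq_square algebra_simps)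
  ultimately have "((\<lambda>n::int. 1 / (z + of_int n) ^ 2) has_sum (Polygamma 1 z + Polygamma 1 (1 - z))) UNIV"
    by (intro has_sum_int_halves) simp_all
  also have "Polygamma 1 z + Polygamma 1 (1 - z) = (of_real pi / sin (of_real pi * z)) ^ 2"
    by (rule Polygamma_1_reflection[OF assms])
  also have "\<dots> = psi (to_nome z)"
  proof -
    define y where "y = exp (\<i> * (of_real pi * z))"
    have y: "y \<noteq> 0" "to_nome z = y ^ 2"
      by (simp_all add: y_def to_nome_def mult_ac flip: exp_of_nat_mult)
    have "y ^ 2 \<noteq> 1" using norm_to_nome_less[OF assms] y by auto
    have "sin (of_real pi * z) = (y - inverse y) / (2 * \<i>)"
      unfolding sin_exp_eq by (simp add: y_def exp_minus)
    also have "\<dots> = (y ^ 2 - 1) / (2 * \<i> * y)"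
      using y by (simp add: field_simps power2_eq_square)
    finally have "(of_real pi / sin (of_real pi * z)) ^ 2 = - 4 * of_real pi ^ 2 * (y ^ 2 / (y ^ 2 - 1) ^ 2)"
      by (simp add: power_divide power_mult_distrib)
    also have "(y ^ 2 - 1) ^ 2 = (1 - y ^ 2) ^ 2" by (simp add: power2_eq_square algebra_simps)
    finally show ?thesis by (simp add: psi_def y)
  qed
  finally show ?thesis .
qed

lemma has_sum_lattice_row:
  assumes "Im z > 0" "m \<noteq> 0"
  shows "((\<lambda>n::int. 1 / (of_int m * z + of_int n) ^ 2) has_sum psi (to_nome z ^ nat \<bar>m\<bar>)) UNIV"
proof -
  have "Im (of_nat (nat \<bar>m\<bar>) * z) > 0" using assms by simp
  from has_sum_inverse_squares[OF this]
  have *: "((\<lambda>n::int. 1 / (of_int \<bar>m\<bar> * z + of_int n) ^ 2) has_sum psi (to_nome z ^ nat \<bar>m\<bar>)) UNIV"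
    unfolding to_nome_of_nat by simp
  show ?thesis
  proof (cases "m > 0")
    case False
    have "(of_int \<bar>m\<bar> * z + of_int (- n)) ^ 2 = (of_int m * z + of_int n) ^ 2" for n
      using False by (simp add: power2_eq_square algebra_simps)
    thus ?thesis using *
      by (subst has_sum_reindex_bij_witness[of _ uminus uminus UNIV
            "\<lambda>n. 1 / (of_int \<bar>m\<bar> * z + of_int n) ^ 2"]) simp_all
  qed (use * in simp)
qed

section \<open>Lambert series, and the row sums that make up \<open>E2\<close>\<close>

lemma has_sum_from_1_iff:
  "(f has_sum S) {1::nat..} \<longleftrightarrow> ((\<lambda>n. f (Suc n)) has_sum S) UNIV"
  by (rule has_sum_reindex_bij_witness[of _ Suc "\<lambda>n. n - 1"]) auto

lemma has_sum_nat_mult_power: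
  fixes y :: "'a::{real_normed_field,banach}"
  assumes "norm y < 1"
  shows "((\<lambda>d. of_nat d * y ^ d) has_sum (y / (1 - y) ^ 2)) {1..}"
proof -
  have "(\<lambda>n. of_nat (Suc n) * norm y ^ n) sums (1 / (1 - norm y) ^ 2)"
    using assms by (intro geometric_deriv_sums) auto
  hence "summable (\<lambda>n. norm (of_nat (Suc n) * y ^ n))"
    by (simp add: norm_mult norm_power sums_iff del: of_nat_Suc)
  moreover have "(\<lambda>n. of_nat (Suc n) * y ^ n) sums (1 / (1 - y) ^ 2)"
    using assms by (rule geometric_deriv_sums)
  ultimately have "((\<lambda>n. of_nat (Suc n) * y ^ n) has_sum (1 / (1 - y) ^ 2)) UNIV"
    by (rule norm_summable_imp_has_sum)
  from has_sum_cmult_right[OF this, of y] show ?thesis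
    unfolding has_sum_from_1_iff by (simp add: mult_ac)
qed

lemma summable_lambert:
  fixes x :: complex
  assumes "norm x < 1"
  shows "(\<lambda>(m, d). of_nat d * x ^ (m * d)) summable_on ({1..} \<times> {1::nat..})"
proof -
  define r where "r = norm x"
  have r: "0 \<le> r" "r < 1" using assms by (auto simp: r_def)
  have rm: "r ^ m \<le> r" if "m \<ge> 1" for m
    using power_decreasing[of 1 m r] r that by simp
  have "(\<lambda>(m, d). real d * r ^ (m * d)) summable_on ({1..} \<times> {1..})"
  proof (rule summable_on_SigmaI)
    fix m :: nat assume m: "m \<in> {1..}"
    have "norm (r ^ m) < 1" using r rm[of m] m by simp
    from has_sum_nat_mult_power[OF this]
    show "((\<lambda>d. case (m, d) of (m, d) \<Rightarrow> real d * r ^ (m * d)) has_sum (r ^ m / (1 - r ^ m) ^ 2)) {1..}"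
      by (simp add: power_mult)
  next
    have "(\<lambda>m. r ^ m * (1 / (1 - r) ^ 2)) summable_on {1..}"
      using has_sum_geometric_from_1[of r] r
      by (intro summable_on_cmult_left) (auto simp: has_sum_imp_summable)
    thus "(\<lambda>m. r ^ m / (1 - r ^ m) ^ 2) summable_on {1..}"
    proof (rule summable_on_comparison_test)
      fix m :: nat assume "m \<in> {1..}"
      hence "1 - r \<le> 1 - r ^ m" using rm[of m] by simp
      hence "1 / (1 - r ^ m) ^ 2 \<le> 1 / (1 - r) ^ 2"
        using r by (intro divide_left_mono power_mono mult_pos_pos zero_less_power) auto
      from mult_left_mono[OF this, of "r ^ m"] r
      show "r ^ m / (1 - r ^ m) ^ 2 \<le> r ^ m * (1 / (1 - r) ^ 2)" by simp
    qed (use r in auto)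
  qed (use r in auto)
  hence "(\<lambda>a. norm (case a of (m, d) \<Rightarrow> of_nat d * x ^ (m * d))) summable_on ({1..} \<times> {1::nat..})"
    by (simp add: case_prod_unfold norm_mult norm_power r_def)
  thus ?thesis by (rule abs_summable_summable)
qed

text \<open>The double series of \<open>d * x^(m * d)\<close> is summed over \<open>d\<close> first,
  which gives \<open>psi (x^m)\<close> up to a constant, and along \<open>n = m * d\<close>, which
  gives \<open>sigma1 n\<close>.\<close>

lemma has_sum_sigma1:
  fixes x :: complex
  assumes "norm x < 1"
  obtains S where "((\<lambda>n. of_nat (sigma1 n) * x ^ n) has_sum S) {1..}"
    and "((\<lambda>m. psi (x ^ m)) has_sum (- 4 * of_real pi ^ 2 * S)) {1..}"
proof -
  define f where "f = (\<lambda>(m, d). of_nat d * x ^ (m * d))"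
  obtain S where S: "(f has_sum S) ({1..} \<times> {1::nat..})"
    using summable_lambert[OF assms] unfolding f_def summable_on_def by blast
  have "((\<lambda>m. x ^ m / (1 - x ^ m) ^ 2) has_sum S) {1..}"
  proof (rule has_sum_SigmaD[OF S])
    fix m :: nat assume "m \<in> {1..}"
    hence "norm (x ^ m) < 1" using assms by (simp add: norm_power power_Suc_less_one power_less_one_iff)
    from has_sum_nat_mult_power[OF this]
    show "((\<lambda>d. f (m, d)) has_sum (x ^ m / (1 - x ^ m) ^ 2)) {1..}"
      by (simp add: f_def power_mult)
  qed
  from has_sum_cmult_right[OF this, of "- 4 * of_real pi ^ 2"]
  have 1: "((\<lambda>m. psi (x ^ m)) has_sum (- 4 * of_real pi ^ 2 * S)) {1..}"
    by (simp add: psi_def)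
  have "((\<lambda>(n, d). of_nat d * x ^ n) has_sum S) (SIGMA n:{1..}. {d. d dvd n})"
    using S
    by (subst has_sum_reindex_bij_witness[where i = "\<lambda>(m, d). (m * d, d)" and
          j = "\<lambda>(n, d). (n div d, d)" and T = "{1..} \<times> {1..}" and h = f and s' = S])
       (auto simp: f_def Suc_le_eq dvd_pos_nat mult.commute elim!: dvdE)
  hence "((\<lambda>n. of_nat (sigma1 n) * x ^ n) has_sum S) {1..}"
  proof (rule has_sum_SigmaD)
    fix n :: nat assume "n \<in> {1..}"
    hence "finite {d. d dvd n}" by simp
    thus "((\<lambda>d. case (n, d) of (n, d) \<Rightarrow> of_nat d * x ^ n) has_sum (of_nat (sigma1 n) * x ^ n)) {d. d dvd n}"
      by (intro has_sum_finiteI) (auto simp: sigma1_def sum_distrib_right)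
  qed
  with 1 show ?thesis using that by blast
qed

lemma has_sum_int_nonzero:
  fixes f :: "nat \<Rightarrow> 'a::topological_comm_monoid_add"
  assumes "(f has_sum S) {1..}"
  shows "((\<lambda>m::int. f (nat \<bar>m\<bar>)) has_sum (S + S)) (UNIV - {0})"
proof -
  have "((\<lambda>m::int. f (nat \<bar>m\<bar>)) has_sum S) {1..}"
    using assms by (subst has_sum_reindex_bij_witness[of _ int nat "{1..}" f]) auto
  moreover have "((\<lambda>m::int. f (nat \<bar>m\<bar>)) has_sum S) {..-1}"
    using assms
    by (subst has_sum_reindex_bij_witness[of _ "\<lambda>n. - int n" "\<lambda>m. nat (- m)" "{1..}" f]) auto
  ultimately have "((\<lambda>m::int. f (nat \<bar>m\<bar>)) has_sum (S + S)) ({1..} \<union> {..-1})"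
    by (intro has_sum_Un_disjoint) auto
  also have "{1..} \<union> {..-1} = UNIV - {0::int}" by auto
  finally show ?thesis .
qed

text \<open>Eisenstein's summation by rows. The omitted row \<open>m = 0\<close> contributes
  \<open>pi^2 / 3\<close> by \<open>has_sum_inverse_squares_int\<close> and would complete the value
  to \<open>pi^2 / 3 * E2 z\<close>.\<close>

lemma has_sum_lattice_rows:
  assumes "Im z > 0"
  shows "((\<lambda>m::int. psi (to_nome z ^ nat \<bar>m\<bar>)) has_sum (of_real pi ^ 2 / 3 * (E2 z - 1))) (UNIV - {0})"
proof -
  obtain S where S: "((\<lambda>n. of_nat (sigma1 n) * to_nome z ^ n) has_sum S) {1..}"
    "((\<lambda>m. psi (to_nome z ^ m)) has_sum (- 4 * of_real pi ^ 2 * S)) {1..}"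
    using has_sum_sigma1[OF norm_to_nome_less[OF assms]] by blast
  have "(\<lambda>n. of_nat (sigma1 (Suc n)) * to_nome z ^ Suc n) sums S"
    using S(1) unfolding has_sum_from_1_iff by (rule has_sum_imp_sums)
  hence "E2 z = 1 - 24 * S" by (simp add: E2_def sums_iff)
  hence "- 4 * of_real pi ^ 2 * S + - 4 * of_real pi ^ 2 * S = of_real pi ^ 2 / 3 * (E2 z - 1)" by simp
  thus ?thesis using has_sum_int_nonzero[OF S(2)] by metis
qed

lemma has_sum_inverse_squares_int:
  "((\<lambda>n::int. 1 / of_int n ^ 2) has_sum (of_real pi ^ 2 / 3 :: complex)) (UNIV - {0})"
proof -
  have "((\<lambda>n. 1 / (real n + 1) ^ 2) has_sum (pi ^ 2 / 6)) UNIV"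
    using inverse_squares_sums by (intro sums_nonneg_imp_has_sum) (simp_all add: add_ac)
  hence "((\<lambda>n. 1 / real n ^ 2) has_sum (pi ^ 2 / 6)) {1..}"
    unfolding has_sum_from_1_iff by (simp add: add_ac)
  from has_sum_of_real[OF has_sum_int_nonzero[OF this], where 'a = complex]
  have "((\<lambda>n::int. complex_of_real (1 / real (nat \<bar>n\<bar>) ^ 2)) has_sum (of_real pi ^ 2 / 3)) (UNIV - {0})"
    by simp
  also have "(\<lambda>n::int. complex_of_real (1 / real (nat \<bar>n\<bar>) ^ 2)) = (\<lambda>n. 1 / of_int n ^ 2)"
  proof
    fix n :: int
    have "real (nat \<bar>n\<bar>) ^ 2 = of_int n ^ 2" by simp
    thus "complex_of_real (1 / real (nat \<bar>n\<bar>) ^ 2) = 1 / of_int n ^ 2" by simp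
  qed
  finally show ?thesis .
qed

text \<open>The power \<open>x^(-3/2)\<close>. Terms of cubic decay in the larger of
  \<open>|m|\<close> and \<open>|n|\<close> are bounded by a product of two such factors, which can
  be summed separately.\<close>

definition inv_sqrt_cube :: "real \<Rightarrow> real" where
  "inv_sqrt_cube x = 1 / sqrt x ^ 3"

lemma summable_inv_sqrt_cube: "summable (\<lambda>n. inv_sqrt_cube (real n))"
proof -
  have "summable (\<lambda>n. real n powr (-3/2))"
    by (subst summable_real_powr_iff) simp
  moreover have "real n powr (-3/2) = inv_sqrt_cube (real n)" for n
  proof (cases "n = 0")
    case False
    have "sqrt (real n) ^ 3 = real n powr (3 / 2)"
      using False by (simp add: powr_half_sqrt [symmetric] powr_powr flip: powr_realpow)
    moreover have "real n powr (-3/2) = 1 / real n powr (3 / 2)"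
      using powr_minus_divide[of "real n" "3 / 2"] by simp
    ultimately show ?thesis by (simp only: inv_sqrt_cube_def)
  qed (simp add: inv_sqrt_cube_def)
  ultimately show ?thesis by simp
qed

lemma inv_sqrt_cube_nonneg: "x \<ge> 0 \<Longrightarrow> inv_sqrt_cube x \<ge> 0"
  by (simp add: inv_sqrt_cube_def)

lemma summable_inv_sqrt_cube_int: "(\<lambda>m::int. inv_sqrt_cube (of_int \<bar>m\<bar>)) summable_on (UNIV - {0})"
proof -
  have "(\<lambda>n. inv_sqrt_cube (real n)) summable_on UNIV"
    using summable_inv_sqrt_cube by (intro summable_nonneg_imp_summable_on) (auto simp: inv_sqrt_cube_nonneg)
  hence "(\<lambda>n. inv_sqrt_cube (real n)) summable_on {1..}" by (rule summable_on_subset) simp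
  then obtain S where "((\<lambda>n. inv_sqrt_cube (real n)) has_sum S) {1..}" unfolding summable_on_def by blast
  from has_sum_int_nonzero[OF this] show ?thesis by (auto intro: has_sum_imp_summable)
qed

lemma summable_inv_sqrt_cube_int': "(\<lambda>m::int. inv_sqrt_cube (1 + of_int \<bar>m\<bar>)) summable_on UNIV"
proof -
  have "summable (\<lambda>n. inv_sqrt_cube (real (n + 1)))" "summable (\<lambda>n. inv_sqrt_cube (real (n + 2)))"
    using summable_inv_sqrt_cube by (rule summable_ignore_initial_segment)+
  hence "(\<lambda>n. inv_sqrt_cube (real (n + 1))) summable_on UNIV" "(\<lambda>n. inv_sqrt_cube (real (n + 2))) summable_on UNIV"
    by (intro summable_nonneg_imp_summable_on; force simp: inv_sqrt_cube_nonneg)+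
  then obtain a b where "((\<lambda>n. inv_sqrt_cube (real (n + 1))) has_sum a) UNIV" "((\<lambda>n. inv_sqrt_cube (real (n + 2))) has_sum b) UNIV"
    unfolding summable_on_def by blast
  hence "((\<lambda>m::int. inv_sqrt_cube (1 + of_int \<bar>m\<bar>)) has_sum (a + b)) UNIV"
    by (intro has_sum_int_halves) (auto simp: add_ac)
  thus ?thesis by (rule has_sum_imp_summable)
qed

text \<open>
  Subtracting the telescoping difference makes the double series absolutely convergent, so that
  the order of summation can be exchanged; the difference itself accounts for the quasimodularity.
\<close>
lemma summable_lattice:
  assumes "Im z > 0"
  shows "(\<lambda>(m::int, n::int). 1 / (of_int m * z + of_int n) ^ 2 -
      (1 / (of_int m * z + of_int n) - 1 / (of_int m * z + of_int (n + 1))))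
    summable_on ((UNIV - {0}) \<times> UNIV)"
proof -
  obtain c where c: "c > 0" "\<And>a b :: real. norm (of_real a * z + of_real b) \<ge> c * max \<bar>a\<bar> \<bar>b\<bar>"
    using norm_linear_ge[OF assms] by blast
  define g where "g = (\<lambda>(m::int, n::int). (8 / c ^ 3) * (inv_sqrt_cube (of_int \<bar>m\<bar>) * inv_sqrt_cube (1 + of_int \<bar>n\<bar>)))"
  have "g summable_on ((UNIV - {0}) \<times> UNIV)"
  proof -
    obtain S where S: "((\<lambda>m::int. inv_sqrt_cube (1 + of_int \<bar>m\<bar>)) has_sum S) UNIV"
      using summable_inv_sqrt_cube_int' unfolding summable_on_def by blast
    have "(\<lambda>(m::int, n::int). inv_sqrt_cube (of_int \<bar>m\<bar>) * inv_sqrt_cube (1 + of_int \<bar>n\<bar>)) summable_on ((UNIV - {0}) \<times> UNIV)"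
    proof (rule summable_on_SigmaI)
      fix m :: int
      show "((\<lambda>n::int. case (m, n) of (m, n) \<Rightarrow> inv_sqrt_cube (of_int \<bar>m\<bar>) * inv_sqrt_cube (1 + of_int \<bar>n\<bar>)) has_sum
         (inv_sqrt_cube (of_int \<bar>m\<bar>) * S)) UNIV"
        using has_sum_cmult_right[OF S] by simp
    next
      show "(\<lambda>m::int. inv_sqrt_cube (of_int \<bar>m\<bar>) * S) summable_on UNIV - {0}"
        by (intro summable_on_cmult_left summable_inv_sqrt_cube_int)
    qed (auto simp: inv_sqrt_cube_nonneg)
    from summable_on_cmult_right[OF this, of "8 / c ^ 3"] show ?thesis
      by (simp add: g_def case_prod_unfold)
  qed
  moreover have "norm (1 / (of_int m * z + of_int n) ^ 2 -
      (1 / (of_int m * z + of_int n) - 1 / (of_int m * z + of_int (n + 1)))) \<le> g (m, n)"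
    if "m \<noteq> 0" for m n :: int
  proof -
    define A where "A = of_int m * z + of_int n"
    define B where "B = of_int m * z + of_int (n + 1)"
    \<comment> \<open>The geometric mean of \<open>|m|\<close> and \<open>1 + |n|\<close>. Half of
      it is at most the larger of \<open>|m|\<close> and \<open>|n|\<close>, and likewise with
      \<open>n + 1\<close>, so that it bounds both denominators from below.\<close>
    define t where "t = sqrt (of_int \<bar>m\<bar>) * sqrt (1 + of_int \<bar>n\<bar>)"
    have m: "\<bar>real_of_int m\<bar> \<ge> 1" using that by linarith
    have t2: "t ^ 2 = \<bar>real_of_int m\<bar> * (1 + \<bar>real_of_int n\<bar>)" and "t > 0"
      using m by (simp_all add: t_def power_mult_distrib)
    have max: "t / 2 \<le> max \<bar>real_of_int m\<bar> y" if "4 * y \<ge> 1 + \<bar>real_of_int n\<bar> \<or> 4 * \<bar>real_of_int m\<bar> \<ge> 1 + \<bar>real_of_int n\<bar>" for y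
    proof (rule power2_le_imp_le)
      define u where "u = max \<bar>real_of_int m\<bar> y"
      have u: "u \<ge> \<bar>real_of_int m\<bar>" "4 * u \<ge> 1 + \<bar>real_of_int n\<bar>" using that by (auto simp: u_def)
      have "(t / 2) ^ 2 = \<bar>real_of_int m\<bar> * ((1 + \<bar>real_of_int n\<bar>) / 4)"
        by (simp add: power_divide t2)
      also have "\<dots> \<le> u * u" using u m by (intro mult_mono) auto
      finally show "(t / 2) ^ 2 \<le> (max \<bar>real_of_int m\<bar> y) ^ 2" by (simp add: u_def power2_eq_square)
    qed (use m in auto)
    have "4 * \<bar>real_of_int n\<bar> \<ge> 1 + \<bar>real_of_int n\<bar> \<or> 4 * \<bar>real_of_int m\<bar> \<ge> 1 + \<bar>real_of_int n\<bar>"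
      using m by linarith
    hence "c * (t / 2) \<le> c * max \<bar>real_of_int m\<bar> \<bar>real_of_int n\<bar>"
      using c(1) by (intro mult_left_mono max) auto
    also have "\<dots> \<le> norm A" using c(2)[of "of_int m" "of_int n"] by (simp add: A_def)
    finally have A: "c * (t / 2) \<le> norm A" .
    have "4 * \<bar>real_of_int (n + 1)\<bar> \<ge> 1 + \<bar>real_of_int n\<bar> \<or> 4 * \<bar>real_of_int m\<bar> \<ge> 1 + \<bar>real_of_int n\<bar>"
    proof -
      have "\<bar>real_of_int n + 1\<bar> \<ge> \<bar>real_of_int n\<bar> - 1" by simp
      have "1 + \<bar>real_of_int n\<bar> \<le> 4 * \<bar>real_of_int n + 1\<bar>"
        if "\<not> 1 + \<bar>real_of_int n\<bar> \<le> 4 * \<bar>real_of_int m\<bar>" 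
      proof -
        have *: "1 + x \<le> 4 * y" if "x - 1 \<le> y" "\<not> 1 + x \<le> 4 * M" "1 \<le> M" for x y M :: real
          using that by linarith
        show ?thesis by (rule *) (use \<open>\<bar>real_of_int n + 1\<bar> \<ge> \<bar>real_of_int n\<bar> - 1\<close> that m in auto)
      qed
      thus ?thesis by fastforce
    qed
    hence "c * (t / 2) \<le> c * max \<bar>real_of_int m\<bar> \<bar>real_of_int (n + 1)\<bar>"
      using c(1) by (intro mult_left_mono max) auto
    also have "\<dots> \<le> norm B" using c(2)[of "of_int m" "of_int (n + 1)"] by (simp add: B_def)
    finally have B: "c * (t / 2) \<le> norm B" .
    have ct: "c * (t / 2) > 0" using c \<open>t > 0\<close> by simp
    hence AB: "A \<noteq> 0" "B \<noteq> 0" "B = A + 1" using A B by (auto simp: A_def B_def)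
    \<comment> \<open>Since \<open>B = A + 1\<close>, the bracket equals \<open>1 / (A * B)\<close>,
      and the difference gains one power of decay.\<close>
    have "1 / A ^ 2 - (1 / A - 1 / B) = 1 / (A ^ 2 * B)"
    proof -
      have "1 / A - 1 / B = 1 / (A * B)" using AB by (simp add: diff_frac_eq)
      also have "\<dots> = A / (A ^ 2 * B)" using AB(1) by (simp add: power2_eq_square)
      finally have 1: "1 / A - 1 / B = A / (A ^ 2 * B)" .
      have 2: "1 / A ^ 2 = B / (A ^ 2 * B)" using AB(2) by simp
      have "B - A = 1" by (simp add: AB(3))
      thus ?thesis unfolding 1 2 diff_divide_distrib [symmetric] by (simp only:)
    qed
    hence "norm (1 / A ^ 2 - (1 / A - 1 / B)) = 1 / (norm A ^ 2 * norm B)"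
      by (simp add: norm_divide norm_mult norm_power)
    also have "\<dots> \<le> 1 / ((c * (t / 2)) ^ 2 * (c * (t / 2)))"
      using A B ct c \<open>t > 0\<close> AB(1,2)
      by (intro divide_left_mono mult_mono power_mono mult_pos_pos) auto
    also have "\<dots> = (8 / c ^ 3) * (1 / t ^ 3)"
      using c \<open>t > 0\<close> by (simp add: field_simps power2_eq_square power3_eq_cube)
    also have "1 / t ^ 3 = inv_sqrt_cube (of_int \<bar>m\<bar>) * inv_sqrt_cube (1 + of_int \<bar>n\<bar>)"
      by (simp add: t_def inv_sqrt_cube_def power_mult_distrib)
    finally show ?thesis by (simp add: g_def A_def B_def)
  qed
  ultimately have "(\<lambda>a::int \<times> int. norm (case a of (m, n) \<Rightarrow> 1 / (of_int m * z + of_int n) ^ 2 -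
      (1 / (of_int m * z + of_int n) - 1 / (of_int m * z + of_int (n + 1)))))
    summable_on ((UNIV - {0}) \<times> UNIV)"
    by (elim summable_on_comparison_test) auto
  thus ?thesis by (rule abs_summable_summable)
qed

text \<open>In this form the limit \<open>- \<i>\<close> high up in the half plane is visible; it is
  the source of the correction term in \<open>E2_S\<close>.\<close>

lemma cot_eq_nome:
  assumes "Im w > 0"
  shows "cot (of_real pi * w) = - \<i> * (1 + to_nome w) / (1 - to_nome w)"
proof -
  define y where "y = exp (\<i> * (of_real pi * w))"
  have y: "y \<noteq> 0" "to_nome w = y ^ 2"
    by (simp_all add: y_def to_nome_def mult_ac flip: exp_of_nat_mult)
  have "y ^ 2 \<noteq> 1" using norm_to_nome_less[OF assms] y by auto
  have 1: "sin (of_real pi * w) = (y ^ 2 - 1) / (2 * \<i> * y)"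
    unfolding sin_exp_eq exp_minus y_def [symmetric] using y by (simp add: field_simps power2_eq_square)
  have 2: "cos (of_real pi * w) = (y ^ 2 + 1) / (2 * y)"
    unfolding cos_exp_eq exp_minus y_def [symmetric] using y by (simp add: field_simps power2_eq_square)
  have "cot (of_real pi * w) = \<i> * (y ^ 2 + 1) / (y ^ 2 - 1)"
  proof -
    have "(y ^ 2 + 1) / (2 * y) / ((y ^ 2 - 1) / (2 * \<i> * y)) =
        (2 * y) * (\<i> * (y ^ 2 + 1)) / ((2 * y) * (y ^ 2 - 1))"
      by (simp only: divide_divide_times_eq mult_ac)
    also have "\<dots> = \<i> * (y ^ 2 + 1) / (y ^ 2 - 1)"
      using y(1) by (intro nonzero_mult_divide_mult_cancel_left) simp
    finally show ?thesis unfolding cot_def 1 2 .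
  qed
  also have "\<dots> = - \<i> * (1 + y ^ 2) / (1 - y ^ 2)"
    using \<open>y ^ 2 \<noteq> 1\<close> by (simp add: divide_simps) (simp add: algebra_simps)
  finally show ?thesis using y by simp
qed

section \<open>Comparison of the two orders of summation\<close>

lemma tendsto_inverse_linear:
  fixes a :: complex
  shows "(\<lambda>N. 1 / (a + of_nat N)) \<longlonglongrightarrow> 0" "(\<lambda>N. 1 / (a - of_nat N)) \<longlonglongrightarrow> 0"
proof -
  have "filterlim (\<lambda>N. a + of_nat N :: complex) at_infinity sequentially"
    by (intro tendsto_add_filterlim_at_infinity[OF tendsto_const] tendsto_of_nat)
  thus "(\<lambda>N. 1 / (a + of_nat N)) \<longlonglongrightarrow> 0"
    by (intro tendsto_divide_0[OF tendsto_const])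
  have "filterlim (\<lambda>N. - a + of_nat N :: complex) at_infinity sequentially"
    by (intro tendsto_add_filterlim_at_infinity[OF tendsto_const] tendsto_of_nat)
  hence "(\<lambda>N. - 1 / (- a + of_nat N)) \<longlonglongrightarrow> 0"
    by (intro tendsto_divide_0[OF tendsto_const])
  moreover have "- 1 / (- a + of_nat N) = 1 / (a - of_nat N)" for N
    by (metis minus_diff_eq minus_divide_divide uminus_add_conv_diff)
  ultimately show "(\<lambda>N. 1 / (a - of_nat N)) \<longlonglongrightarrow> 0" by simp
qed

lemma telescope_int:
  fixes g :: "int \<Rightarrow> 'a::ab_group_add"
  shows "(\<Sum>n\<in>{- int N..<int N}. g n - g (n + 1)) = g (- int N) - g (int N)"
  unfolding sum_int_symmetric by (induction N) (simp_all add: algebra_simps)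

lemma has_sum_sum:
  fixes f :: "'a \<Rightarrow> 'b \<Rightarrow> 'c::topological_comm_monoid_add"
  assumes "\<And>n. n \<in> F \<Longrightarrow> ((\<lambda>m. f m n) has_sum s n) A"
  shows "((\<lambda>m. \<Sum>n\<in>F. f m n) has_sum (\<Sum>n\<in>F. s n)) A"
  using assms
  by (induction F rule: infinite_finite_induct) (auto intro!: has_sum_add)

lemma Im_inverse_pos: "Im z > 0 \<Longrightarrow> Im (- 1 / z) > 0"
proof -
  assume z: "Im z > 0"
  hence "z \<noteq> 0" by auto
  have "Im (- 1 / z) = Im z / (norm z) ^ 2"
    by (simp add: Im_divide cmod_power2)
  thus ?thesis using z \<open>z \<noteq> 0\<close> by simp
qed

text \<open>For \<open>u = - N / z\<close> the denominators are \<open>z * (u + m)\<close> and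
  \<open>z * (- u + m)\<close>, so the sum over all \<open>m\<close> consists of two cotangent
  series. The term \<open>m = 0\<close>, equal to \<open>- 2 / N\<close>, is taken out
  again.\<close>

lemma has_sum_cot_difference:
  assumes z: "Im z > 0" and N: "N > 0"
    and S: "((\<lambda>m::int. 1 / (of_int m * z - of_nat N) - 1 / (of_int m * z + of_nat N)) has_sum S) (UNIV - {0})"
  shows "S = 2 / of_nat N + 2 * of_real pi / z * cot (of_real pi * (of_nat N * (- 1 / z)))"
proof -
  have "z \<noteq> 0" using z by auto
  define u where "u = of_nat N * (- 1 / z)"
  have Imu: "Im u > 0"
  proof -
    have "Im (- 1 / z) > 0" using Im_inverse_pos[OF z] .
    moreover have "Im u = real N * Im (- 1 / z)"
      unfolding u_def by (simp only: times_complex.sel complex_Re_of_nat complex_Im_of_nat)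
    ultimately show ?thesis using N by (metis mult_pos_pos of_nat_0_less_iff)
  qed
  have u: "u \<notin> \<int>" "- u \<notin> \<int>"
    using Imu complex_int_Im[of u] complex_int_Im[of "- u"] by auto
  define f where "f = (\<lambda>m::int. 1 / (of_int m * z - of_nat N) - 1 / (of_int m * z + of_nat N))"
  have zu: "of_nat N = - z * u" using \<open>z \<noteq> 0\<close> by (simp add: u_def)
  have f: "f m = (1 / z) * (1 / (u + of_int m) - 1 / (- u + of_int m))" for m
  proof -
    have 1: "of_int m * z - of_nat N = z * (u + of_int m)"
      and 2: "of_int m * z + of_nat N = z * (- u + of_int m)"
      unfolding zu by (simp_all add: algebra_simps)
    show ?thesis
      unfolding f_def 1 2 by (simp only: right_diff_distrib times_divide_times_eq mult_1)
  qed
  have "(f has_sum f 0) {0}" by (rule has_sum_finiteI) simp_all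
  hence "(f has_sum (S + f 0)) ((UNIV - {0}) \<union> {0})"
    using S unfolding f_def by (intro has_sum_Un_disjoint) auto
  hence "(f has_sum (S + f 0)) UNIV" by simp
  hence "(\<lambda>M. \<Sum>m\<in>{- int M..<int M}. f m) \<longlonglongrightarrow> S + f 0"
    by (rule has_sum_int_symmetric)
  moreover have "(\<lambda>M. \<Sum>m\<in>{- int M..<int M}. f m) \<longlonglongrightarrow>
      (1 / z) * (of_real pi * cot (of_real pi * u) - of_real pi * cot (of_real pi * (- u)))"
    unfolding f sum_distrib_left [symmetric] sum_subtractf
    by (intro tendsto_intros cot_partial_fractions u)
  ultimately have "S + f 0 = (1 / z) * (of_real pi * cot (of_real pi * u) - of_real pi * cot (of_real pi * (- u)))"
    by (rule LIMSEQ_unique)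
  moreover have "f 0 = - 2 / of_nat N" by (simp add: f_def)
  moreover have "cot (of_real pi * (- u)) = - cot (of_real pi * u)"
    by (simp add: cot_def)
  ultimately have "S = 2 / of_nat N + 2 * of_real pi / z * cot (of_real pi * u)"
    by (simp add: algebra_simps eq_diff_eq flip: add_divide_distrib)
  thus ?thesis by (simp add: u_def)
qed

text \<open>The corrected summand \<open>a\<close> may be summed by rows or by columns. By rows the
  correction vanishes and \<open>E2 z\<close> appears. By columns the squares give
  \<open>E2 (- 1 / z)\<close>, because \<open>m z + n = (- n v + m) z\<close> with
  \<open>v = - 1 / z\<close>, and the corrections add up to a limit of cotangents.\<close>

theorem E2_S:
  assumes z: "Im z > 0"
  shows "E2 (- 1 / z) = z ^ 2 * E2 z - 6 * \<i> * z / of_real pi"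
proof -
  define v where "v = - 1 / z"
  have "z \<noteq> 0" using z by auto
  have v: "Im v > 0" using Im_inverse_pos[OF z] by (simp add: v_def)
  define I where "I = (UNIV - {0 :: int})"
  define pi3 :: complex where "pi3 = of_real pi ^ 2 / 3"
  define t where "t = (\<lambda>m n :: int. 1 / (of_int m * z + of_int n))"
  define a where "a = (\<lambda>m n. t m n ^ 2 - (t m n - t m (n + 1)))"
  define T where "T = pi3 * (E2 z - 1)"
  have "(\<lambda>(m, n). a m n) summable_on (I \<times> UNIV)"
    using summable_lattice[OF z] by (simp add: a_def t_def I_def power_divide)
  then obtain T' where T': "((\<lambda>(m, n). a m n) has_sum T') (I \<times> UNIV)"
    unfolding summable_on_def by blast
  have sq_row: "((\<lambda>n. t m n ^ 2) has_sum psi (to_nome z ^ nat \<bar>m\<bar>)) UNIV" if "m \<in> I" for m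
    using has_sum_lattice_row[OF z, of m] that by (simp add: t_def I_def power_divide)
  have row: "((\<lambda>n. a m n) has_sum psi (to_nome z ^ nat \<bar>m\<bar>)) UNIV" if m: "m \<in> I" for m
  proof -
    have "(\<lambda>n. a m n) summable_on UNIV"
      using summable_on_SigmaD1[of "\<lambda>m n. a m n" I "\<lambda>_. UNIV" m] has_sum_imp_summable[OF T'] m by simp
    then obtain s where s: "((\<lambda>n. a m n) has_sum s) UNIV" unfolding summable_on_def by blast
    have "((\<lambda>n. t m n ^ 2 + - a m n) has_sum (psi (to_nome z ^ nat \<bar>m\<bar>) + - s)) UNIV"
      by (intro has_sum_add sq_row m has_sum_uminusI s)
    hence "((\<lambda>n. t m n - t m (n + 1)) has_sum (psi (to_nome z ^ nat \<bar>m\<bar>) - s)) UNIV"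
      by (simp add: a_def)
    hence "(\<lambda>N. t m (- int N) - t m (int N)) \<longlonglongrightarrow> psi (to_nome z ^ nat \<bar>m\<bar>) - s"
      using has_sum_int_symmetric by (force simp: telescope_int)
    moreover have "(\<lambda>N. t m (- int N) - t m (int N)) \<longlonglongrightarrow> 0 - 0"
      unfolding t_def using tendsto_inverse_linear[of "of_int m * z"] by (intro tendsto_diff) simp_all
    ultimately have "psi (to_nome z ^ nat \<bar>m\<bar>) - s = 0 - 0" by (rule LIMSEQ_unique)
    thus ?thesis using s by simp
  qed
  have "((\<lambda>m. psi (to_nome z ^ nat \<bar>m\<bar>)) has_sum T') I"
    by (rule has_sum_SigmaD[OF T']) (use row in auto)
  moreover have "((\<lambda>m. psi (to_nome z ^ nat \<bar>m\<bar>)) has_sum T) I"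
    unfolding I_def T_def pi3_def by (rule has_sum_lattice_rows[OF z])
  ultimately have "T' = T" by (rule has_sum_unique)
  with T' have T: "((\<lambda>(n, m). a m n) has_sum T) (UNIV \<times> I)"
    using has_sum_swap[where f = "\<lambda>(m, n). a m n" and S = T and A = I and B = UNIV] by (simp add: case_prod_unfold)
  \<comment> \<open>Column sums of the squares without \<open>m = 0\<close>: the column
    \<open>n = 0\<close> is a multiple of the sum of \<open>1 / m^2\<close>, and all others lose the
    term \<open>1 / n^2\<close>.\<close>
  define b where "b = (\<lambda>n. if n = 0 then pi3 / z ^ 2 else psi (to_nome v ^ nat \<bar>n\<bar>) / z ^ 2 - 1 / of_int n ^ 2)"
  have b: "((\<lambda>m. t m n ^ 2) has_sum b n) I" for n
  proof (cases "n = 0")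
    case True
    have "((\<lambda>m::int. 1 / of_int m ^ 2 * (1 / z ^ 2)) has_sum (pi3 * (1 / z ^ 2))) I"
      unfolding I_def pi3_def by (intro has_sum_cmult_left has_sum_inverse_squares_int)
    thus ?thesis using True by (simp add: t_def b_def power_divide power_mult_distrib)
  next
    case False
    have tv: "t m n ^ 2 = 1 / (of_int (- n) * v + of_int m) ^ 2 * (1 / z ^ 2)" for m
    proof -
      have "of_int m * z + of_int n = (of_int (- n) * v + of_int m) * z"
        using \<open>z \<noteq> 0\<close> by (simp add: v_def field_simps)
      thus ?thesis by (simp add: t_def power_divide power_mult_distrib)
    qed
    have "((\<lambda>m. 1 / (of_int (- n) * v + of_int m) ^ 2 * (1 / z ^ 2)) has_sum
          psi (to_nome v ^ nat \<bar>- n\<bar>) * (1 / z ^ 2)) UNIV"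
      using False by (intro has_sum_cmult_left has_sum_lattice_row v) auto
    hence "((\<lambda>m. t m n ^ 2) has_sum (psi (to_nome v ^ nat \<bar>n\<bar>) / z ^ 2)) UNIV"
      unfolding tv by simp
    moreover have "((\<lambda>m. t m n ^ 2) has_sum (1 / of_int n ^ 2)) {0}"
      by (intro has_sum_finiteI) (auto simp: t_def power_divide)
    ultimately show ?thesis
      unfolding I_def b_def using False by (simp add: has_sum_Diff)
  qed
  define B where "B = pi3 / z ^ 2 * E2 v - pi3"
  have "(b has_sum B) UNIV"
  proof -
    have "((\<lambda>n. psi (to_nome v ^ nat \<bar>n\<bar>) * (1 / z ^ 2) + - (1 / of_int n ^ 2)) has_sum
        (pi3 * (E2 v - 1) * (1 / z ^ 2) + - pi3)) I"
      unfolding I_def pi3_def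
      by (intro has_sum_add has_sum_cmult_left has_sum_lattice_rows v has_sum_uminusI
          has_sum_inverse_squares_int)
    also have "?this \<longleftrightarrow> (b has_sum (pi3 * (E2 v - 1) * (1 / z ^ 2) + - pi3)) I"
      by (intro has_sum_cong) (auto simp: b_def I_def)
    finally have "(b has_sum (pi3 * (E2 v - 1) * (1 / z ^ 2) + - pi3)) I" .
    moreover have "(b has_sum b 0) {0}" by (rule has_sum_finiteI) simp_all
    ultimately have "(b has_sum (pi3 * (E2 v - 1) * (1 / z ^ 2) + - pi3 + b 0)) (I \<union> {0})"
      by (rule has_sum_Un_disjoint) (auto simp: I_def)
    moreover have "pi3 * (E2 v - 1) * (1 / z ^ 2) + - pi3 + b 0 = B"
      by (simp add: B_def b_def diff_divide_distrib algebra_simps)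
    moreover have "I \<union> {0} = UNIV" by (auto simp: I_def)
    ultimately show ?thesis by simp
  qed
  have "\<exists>\<alpha>. ((\<lambda>m. a m n) has_sum \<alpha>) I" for n
    using summable_on_SigmaD1[of "\<lambda>n m. a m n" UNIV "\<lambda>_. I" n] has_sum_imp_summable[OF T]
    by (simp add: summable_on_def)
  then obtain \<alpha> where \<alpha>: "\<And>n. ((\<lambda>m. a m n) has_sum \<alpha> n) I" by metis
  have "(\<alpha> has_sum T) UNIV"
    by (rule has_sum_SigmaD[OF T]) (use \<alpha> in auto)
  hence "((\<lambda>n. b n + - \<alpha> n) has_sum (B + - T)) UNIV"
    by (intro has_sum_add has_sum_uminusI \<open>(b has_sum B) UNIV\<close>)
  hence lim: "(\<lambda>N. \<Sum>n\<in>{- int N..<int N}. b n - \<alpha> n) \<longlonglongrightarrow> B - T"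
    using has_sum_int_symmetric by force
  have "((\<lambda>m. t m n ^ 2 + - a m n) has_sum (b n + - \<alpha> n)) I" for n
    by (intro has_sum_add has_sum_uminusI b \<alpha>)
  hence \<beta>: "((\<lambda>m. t m n - t m (n + 1)) has_sum (b n - \<alpha> n)) I" for n
    by (simp add: a_def)
  have eq: "(\<Sum>n\<in>{- int N..<int N}. b n - \<alpha> n) =
      2 / of_nat N + 2 * of_real pi / z * cot (of_real pi * (of_nat N * v))" if "N > 0" for N
  proof -
    have "((\<lambda>m. \<Sum>n\<in>{- int N..<int N}. t m n - t m (n + 1)) has_sum
        (\<Sum>n\<in>{- int N..<int N}. b n - \<alpha> n)) I"
      by (intro has_sum_sum \<beta>)
    thus ?thesis
      unfolding telescope_int unfolding t_def I_def v_def
      by (intro has_sum_cot_difference z that) simp_all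
  qed
  \<comment> \<open>As \<open>N\<close> grows, \<open>to_nome v ^ N\<close> tends to 0, so the
    cotangent tends to \<open>- \<i>\<close> and the whole to
    \<open>- 2 * \<i> * pi / z\<close>.\<close>
  have "(\<lambda>N. 2 / of_nat N + 2 * of_real pi / z *
          (- \<i> * (1 + to_nome v ^ N) / (1 - to_nome v ^ N))) \<longlonglongrightarrow>
        0 + 2 * of_real pi / z * (- \<i> * (1 + 0) / (1 - 0))"
    using norm_to_nome_less[OF v] tendsto_mult[OF tendsto_const[of 2] tendsto_inverse_linear(1)[of 0]]
    by (intro tendsto_intros LIMSEQ_power_zero) simp_all
  moreover have "\<forall>\<^sub>F N in sequentially. 2 / of_nat N + 2 * of_real pi / z *
      (- \<i> * (1 + to_nome v ^ N) / (1 - to_nome v ^ N)) = (\<Sum>n\<in>{- int N..<int N}. b n - \<alpha> n)"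
    using eventually_gt_at_top[of 0]
  proof eventually_elim
    case (elim N)
    hence "Im (of_nat N * v) > 0" using v by simp
    from cot_eq_nome[OF this] show ?case using eq[OF elim] by (simp add: to_nome_of_nat)
  qed
  ultimately have "(\<lambda>N. \<Sum>n\<in>{- int N..<int N}. b n - \<alpha> n) \<longlonglongrightarrow>
      0 + 2 * of_real pi / z * (- \<i> * (1 + 0) / (1 - 0))"
    by (rule Lim_transform_eventually)
  from LIMSEQ_unique[OF lim this] have "B - T = - 2 * \<i> * of_real pi / z" by simp
  hence "pi3 * (E2 v / z ^ 2 - E2 z) = - 2 * \<i> * of_real pi / z"
    by (simp add: B_def T_def algebra_simps)
  moreover have "pi3 \<noteq> 0" by (simp add: pi3_def)
  ultimately have "E2 v / z ^ 2 - E2 z = - 2 * \<i> * of_real pi / z / pi3"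
    by (metis nonzero_mult_div_cancel_left)
  hence "E2 v = z ^ 2 * (E2 z + - 2 * \<i> * of_real pi / z / pi3)"
    using \<open>z \<noteq> 0\<close> by (simp add: field_simps)
  also have "\<dots> = z ^ 2 * E2 z - 6 * \<i> * z / of_real pi"
    using \<open>z \<noteq> 0\<close> by (simp add: pi3_def field_simps power2_eq_square)
  finally show ?thesis by (simp add: v_def)
qed

section \<open>Modular forms for the full modular group\<close>

definition rad1 :: "complex fps \<Rightarrow> bool" where
  "rad1 F \<longleftrightarrow> fps_conv_radius F \<ge> 1"

lemma rad1_less: "rad1 F \<Longrightarrow> norm q < 1 \<Longrightarrow> ereal (norm q) < fps_conv_radius F"
  unfolding rad1_def by (metis less_le_trans ereal_less(3))

lemma rad1_add: "rad1 F \<Longrightarrow> rad1 G \<Longrightarrow> rad1 (F + G)"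
  unfolding rad1_def using fps_conv_radius_add[of F G] by (meson min.bounded_iff order_trans)

lemma rad1_diff: "rad1 F \<Longrightarrow> rad1 G \<Longrightarrow> rad1 (F - G)"
  unfolding rad1_def using fps_conv_radius_diff[of F G] by (meson min.bounded_iff order_trans)

lemma rad1_mult: "rad1 F \<Longrightarrow> rad1 G \<Longrightarrow> rad1 (F * G)"
  unfolding rad1_def using fps_conv_radius_mult[of F G] by (meson min.bounded_iff order_trans)

lemma rad1_const: "rad1 (fps_const c)"
  by (simp add: rad1_def)

lemma rad1_X: "rad1 fps_X"
  by (simp add: rad1_def)

lemma rad1_1: "rad1 1"
  by (simp add: rad1_def)

lemma rad1_0: "rad1 0"
  by (simp add: rad1_def)

lemma rad1_numeral: "rad1 (numeral n)"
  by (simp add: rad1_def)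

lemma rad1_power: "rad1 F \<Longrightarrow> rad1 (F ^ n)"
  by (induction n) (auto intro: rad1_mult rad1_1)

lemma rad1_deriv: "rad1 F \<Longrightarrow> rad1 (fps_deriv F)"
  unfolding rad1_def using fps_conv_radius_deriv[of F] by (meson order_trans)

lemma rad1_XD: "rad1 F \<Longrightarrow> rad1 (fps_XD F)"
  by (simp add: fps_XD_def rad1_mult rad1_X rad1_deriv)

lemma rad1I:
  assumes "\<And>r. 0 < r \<Longrightarrow> r < 1 \<Longrightarrow> \<exists>q. norm q = r \<and> summable (\<lambda>n. fps_nth F n * q ^ n)"
  shows "rad1 F"
  unfolding rad1_def fps_conv_radius_def
  by (rule conv_radius_geI_ex) (use assms in auto)

definition ev :: "complex fps \<Rightarrow> complex \<Rightarrow> complex" where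
  "ev F z = eval_fps F (to_nome z)"

lemmas norm_nome_rad1 = rad1_less[OF _ norm_to_nome_less]

lemma ev_add: "rad1 F \<Longrightarrow> rad1 G \<Longrightarrow> Im z > 0 \<Longrightarrow> ev (F + G) z = ev F z + ev G z"
  by (simp add: ev_def eval_fps_add norm_nome_rad1)

lemma ev_diff: "rad1 F \<Longrightarrow> rad1 G \<Longrightarrow> Im z > 0 \<Longrightarrow> ev (F - G) z = ev F z - ev G z"
  by (simp add: ev_def eval_fps_diff norm_nome_rad1)

lemma ev_mult: "rad1 F \<Longrightarrow> rad1 G \<Longrightarrow> Im z > 0 \<Longrightarrow> ev (F * G) z = ev F z * ev G z"
  by (simp add: ev_def eval_fps_mult norm_nome_rad1)

lemma ev_const [simp]: "ev (fps_const c) z = c"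
  by (simp add: ev_def)

lemma ev_1 [simp]: "ev 1 z = 1"
  by (simp add: ev_def)

lemma ev_numeral [simp]: "ev (numeral n) z = numeral n"
  by (simp add: ev_def)

lemma ev_power: "rad1 F \<Longrightarrow> Im z > 0 \<Longrightarrow> ev (F ^ n) z = ev F z ^ n"
  by (induction n) (auto simp: ev_mult rad1_power)

lemma to_nome_add_int: "to_nome (z + of_int n) = to_nome z"
proof -
  have "2 * of_real pi * \<i> * (z + of_int n) = 2 * of_real pi * \<i> * z + of_int (2 * n) * (of_real pi * \<i>)"
    by (simp add: algebra_simps)
  moreover have "exp (of_int (2 * n) * (of_real pi * \<i>)) = 1"
    by (subst exp_eq_1) (auto intro!: exI[of _ n])
  ultimately show ?thesis by (simp add: to_nome_def exp_add)
qed

lemma ev_has_derivative: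
  assumes "rad1 F" "Im z > 0"
  shows "(ev F has_field_derivative (2 * of_real pi * \<i> * ev (fps_XD F) z)) (at z)"
proof -
  have 1: "(to_nome has_field_derivative (to_nome z * (2 * of_real pi * \<i>))) (at z)"
    unfolding to_nome_def by (auto intro!: derivative_eq_intros)
  have 2: "(eval_fps F has_field_derivative eval_fps (fps_deriv F) (to_nome z)) (at (to_nome z))"
    using assms by (intro has_field_derivative_eval_fps norm_nome_rad1)
  have "((\<lambda>z. eval_fps F (to_nome z)) has_field_derivative
     eval_fps (fps_deriv F) (to_nome z) * (to_nome z * (2 * of_real pi * \<i>))) (at z)"
    by (rule DERIV_chain2[OF 2 1])
  also have "(\<lambda>z. eval_fps F (to_nome z)) = ev F" by (simp add: ev_def fun_eq_iff)
  also have "eval_fps (fps_deriv F) (to_nome z) * (to_nome z * (2 * of_real pi * \<i>)) =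
      2 * of_real pi * \<i> * ev (fps_XD F) z"
    using ev_mult[OF rad1_X rad1_deriv[OF assms(1)] assms(2)] by (simp add: fps_XD_def ev_def)
  finally show ?thesis .
qed

lemma to_nome_surj:
  assumes "0 < r" "r < 1"
  obtains z where "Im z > 0" "norm (to_nome z) = r"
proof
  define t where "t = - ln r / (2 * pi)"
  have "ln r < 0" using assms by simp
  thus "Im (\<i> * of_real t) > 0" by (simp add: t_def divide_neg_pos)
  show "norm (to_nome (\<i> * of_real t)) = r"
    using assms by (simp add: norm_to_nome t_def)
qed

lemma to_nome_surj':
  assumes "norm q < 1" "q \<noteq> 0"
  obtains z where "Im z > 0" "to_nome z = q" "Im z = - ln (norm q) / (2 * pi)"
proof
  define z where "z = Ln q / (2 * of_real pi * \<i>)"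
  have "Im z = - ln (norm q) / (2 * pi)"
    using assms by (simp add: z_def Im_divide power2_eq_square)
  thus "Im z = - ln (norm q) / (2 * pi)" .
  moreover have "ln (norm q) < 0" using assms by simp
  ultimately show "Im z > 0" by (simp add: divide_neg_pos)
  show "to_nome z = q" using assms by (simp add: to_nome_def z_def)
qed

lemma ev_eqD:
  assumes "rad1 F" "rad1 G" "\<And>z. Im z > 0 \<Longrightarrow> ev F z = ev G z"
  shows "F = G"
proof (rule has_q_expansion_unique)
  have *: "(\<lambda>n. fps_nth H n * to_nome z ^ n) sums ev H z" if "rad1 H" "Im z > 0" for H z
    unfolding ev_def using that by (intro sums_eval_fps norm_nome_rad1)
  show "has_q_expansion (ev F) F"
    using *[OF assms(1)] by (auto simp: has_q_expansion_def upper_half_plane_def)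
  show "has_q_expansion (ev F) G"
    using *[OF assms(2)] assms(3) by (auto simp: has_q_expansion_def upper_half_plane_def)
qed

lemma has_q_expansion_iff:
  "has_q_expansion f F \<longleftrightarrow> rad1 F \<and> (\<forall>z. Im z > 0 \<longrightarrow> f z = ev F z)"
proof safe
  assume f: "has_q_expansion f F"
  show "rad1 F"
  proof (rule rad1I)
    fix r :: real assume "0 < r" "r < 1"
    then obtain z where "Im z > 0" "norm (to_nome z) = r" using to_nome_surj by blast
    thus "\<exists>q. norm q = r \<and> summable (\<lambda>n. fps_nth F n * q ^ n)"
      using f by (intro exI[of _ "to_nome z"])
         (auto simp: has_q_expansion_def upper_half_plane_def sums_iff)
  qed
  fix z assume "Im z > 0"
  thus "f z = ev F z"
    using f by (auto simp: has_q_expansion_def upper_half_plane_def sums_iff ev_def eval_fps_def)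
next
  assume *: "rad1 F" "\<forall>z. Im z > 0 \<longrightarrow> f z = ev F z"
  have "(\<lambda>n. fps_nth F n * to_nome z ^ n) sums ev F z" if "Im z > 0" for z
    unfolding ev_def using that * by (intro sums_eval_fps norm_nome_rad1)
  thus "has_q_expansion f F"
    using * by (auto simp: has_q_expansion_def upper_half_plane_def)
qed

text \<open>Only the substitution \<open>- 1 / z\<close> is demanded, as a series in the nome is
  invariant under integer translations; \<open>mform_moebius\<close> recovers the whole group in
  even weight.\<close>

definition mform :: "int \<Rightarrow> complex fps \<Rightarrow> bool" where
  "mform k F \<longleftrightarrow> rad1 F \<and> (\<forall>z. Im z > 0 \<longrightarrow> ev F (- 1 / z) = z powi k * ev F z)"

lemma mform_rad1: "mform k F \<Longrightarrow> rad1 F"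
  by (simp add: mform_def)

lemma mform_0: "mform k 0"
  by (simp add: mform_def rad1_0 ev_def)

lemma mform_1: "mform 0 1"
  by (simp add: mform_def rad1_1)

lemma mform_add: "mform k F \<Longrightarrow> mform k G \<Longrightarrow> mform k (F + G)"
  by (simp add: mform_def rad1_add ev_add Im_inverse_pos[simplified] distrib_left)

lemma mform_diff: "mform k F \<Longrightarrow> mform k G \<Longrightarrow> mform k (F - G)"
  by (simp add: mform_def rad1_diff ev_diff Im_inverse_pos[simplified] right_diff_distrib)

lemma mform_mult: "mform k F \<Longrightarrow> mform l G \<Longrightarrow> mform (k + l) (F * G)"
  unfolding mform_def
proof (intro conjI allI impI, goal_cases)
  case (2 z)
  hence "z \<noteq> 0" by auto
  thus ?case using 2 Im_inverse_pos[of z] by (simp add: ev_mult power_int_add)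
qed (auto intro: rad1_mult)

lemma mform_scale: "mform k F \<Longrightarrow> mform k (fps_const c * F)"
  by (simp add: mform_def rad1_mult rad1_const ev_mult Im_inverse_pos[simplified] mult.left_commute)

lemma mform_power: "mform k F \<Longrightarrow> mform (int n * k) (F ^ n)"
proof (induction n)
  case (Suc n)
  from mform_mult[OF Suc.prems Suc.IH[OF Suc.prems]] show ?case by (simp add: algebra_simps)
qed (simp add: mform_1)

section \<open>The full modular group, and forms of negative weight\<close>

lemma Im_moebius:
  fixes a b c d :: int
  assumes "a * d - b * c = 1"
  shows "Im ((of_int a * z + of_int b) / (of_int c * z + of_int d)) = Im z / norm (of_int c * z + of_int d) ^ 2"
proof -
  have "Im ((of_int a * z + of_int b) / (of_int c * z + of_int d)) =
     (of_int (a * d - b * c) * Im z) / norm (of_int c * z + of_int d) ^ 2"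
    by (simp add: Im_divide cmod_power2 algebra_simps)
  thus ?thesis by (simp add: assms)
qed

lemma moebius_denom_neq_0:
  fixes c d :: int
  assumes "Im z > 0" "c \<noteq> 0 \<or> d \<noteq> 0"
  shows "of_int c * z + of_int d \<noteq> 0"
proof
  assume 0: "of_int c * z + of_int d = 0"
  from arg_cong[OF this, of Im] have "c = 0" using assms by simp
  with 0 assms show False by simp
qed

lemma Im_moebius_pos:
  fixes a b c d :: int
  assumes "a * d - b * c = 1" "Im z > 0"
  shows "Im ((of_int a * z + of_int b) / (of_int c * z + of_int d)) > 0"
proof -
  have "c \<noteq> 0 \<or> d \<noteq> 0" using assms(1) by auto
  thus ?thesis using Im_moebius[OF assms(1)] moebius_denom_neq_0[OF assms(2)] assms(2) by simp
qed

text \<open>Euclid's algorithm on the first column \<open>(a, c)\<close>: after a translation by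
  \<open>n = a div c\<close>, the substitution \<open>- 1 / w\<close> leads to a matrix with lower
  left entry \<open>a mod c\<close>. In even weight the signs disappear.\<close>

lemma mform_moebius:
  fixes a b c d :: int
  assumes "mform k F" "even k" "a * d - b * c = 1" "Im z > 0"
  shows "ev F ((of_int a * z + of_int b) / (of_int c * z + of_int d)) =
         (of_int c * z + of_int d) powi k * ev F z"
  using assms(3)
proof (induction "nat \<bar>c\<bar>" arbitrary: a b c d rule: less_induct)
  case less
  have T: "ev F (w + of_int n) = ev F w" for w n by (simp add: ev_def to_nome_add_int)
  show ?case
  proof (cases "c = 0")
    case True
    hence "a * d = 1" using less.prems by simp
    hence "(a = 1 \<and> d = 1) \<or> (a = -1 \<and> d = -1)" using zmult_eq_1_iff by auto
    thus ?thesis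
    proof
      assume "a = -1 \<and> d = -1"
      moreover have "(- 1 :: complex) powi k = 1" using assms(2) by (simp add: power_int_minus_left)
      moreover have "- of_int b - - z = z + (of_int (- b) :: complex)" by simp
      ultimately show ?thesis using True T[of z "- b"] by (simp add: minus_diff_commute)
    qed (use True T[of z b] in simp)
  next
    case False
    define n where "n = a div c"
    define a' where "a' = a - n * c"
    define b' where "b' = b - n * d"
    define w where "w = (of_int (- c) * z + of_int (- d)) / (of_int a' * z + of_int b')"
    have a': "a' = a mod c" by (simp add: a'_def n_def minus_div_mult_eq_mod)
    have det: "(- c) * b' - (- d) * a' = 1"
      using less.prems by (simp add: a'_def b'_def algebra_simps)
    have "nat \<bar>a'\<bar> < nat \<bar>c\<bar>" using abs_mod_less[OF False, of a] by (simp add: a')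
    from less.hyps[OF this det]
    have IH: "ev F w = (of_int a' * z + of_int b') powi k * ev F z" by (simp add: w_def)
    have "Im w > 0" unfolding w_def by (rule Im_moebius_pos[OF det assms(4)])
    have "a' \<noteq> 0 \<or> b' \<noteq> 0" using det by auto
    hence nz: "of_int c * z + of_int d \<noteq> (0 :: complex)" "of_int a' * z + of_int b' \<noteq> (0 :: complex)"
      using moebius_denom_neq_0[OF assms(4), of c d] moebius_denom_neq_0[OF assms(4), of a' b'] False
      by auto
    have eq: "(of_int a * z + of_int b) / (of_int c * z + of_int d) = - 1 / w + of_int n"
    proof -
      have "of_int a * z + of_int b = of_int n * (of_int c * z + of_int d) + (of_int a' * z + of_int b')"
        by (simp add: a'_def b'_def algebra_simps)
      moreover have "- 1 / w = (of_int a' * z + of_int b') / (of_int c * z + of_int d)"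
      proof -
        have 1: "w = - ((of_int c * z + of_int d) / (of_int a' * z + of_int b'))"
          unfolding w_def by (simp add: minus_divide_left)
        have "- 1 / - (x / y) = y / x" for x y :: complex by simp
        thus ?thesis unfolding 1 by this
      qed
      ultimately show ?thesis using nz by (simp add: add_divide_distrib)
    qed
    have "ev F ((of_int a * z + of_int b) / (of_int c * z + of_int d)) = ev F (- 1 / w)"
      unfolding eq by (rule T)
    also have "\<dots> = w powi k * ev F w"
      using assms(1) \<open>Im w > 0\<close> by (simp add: mform_def)
    also have "\<dots> = (w * (of_int a' * z + of_int b')) powi k * ev F z"
      by (simp add: IH power_int_mult_distrib)
    also have "w * (of_int a' * z + of_int b') = - (of_int c * z + of_int d)"
      using nz by (simp add: w_def)
    also have "\<dots> powi k = (of_int c * z + of_int d) powi k"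
      using assms(2) by (simp only: power_int_minus_left if_True)
    finally show ?thesis .
  qed
qed

text \<open>Take a matrix whose lower row makes \<open>|c z + d|\<close> least, and let
  \<open>w\<close> be the image of \<open>z\<close>. Translating by \<open>- n\<close> and inverting
  cannot shorten the row, hence \<open>|w - n| >= 1\<close>; for the integer \<open>n\<close>
  nearest to \<open>Re w\<close> this bounds \<open>Im w\<close> from below.\<close>

lemma exists_moebius_Im_ge:
  assumes z: "Im z > 0"
  obtains a b c d :: int where "a * d - b * c = 1"
    "Im ((of_int a * z + of_int b) / (of_int c * z + of_int d)) \<ge> 1 / 2"
proof -
  define X :: "(int \<times> int) set" where "X = {(c, d). \<exists>a b. a * d - b * c = 1}"
  define g where "g = (\<lambda>(c, d). norm (of_int c * z + of_int d))"
  obtain e where e: "e > 0" "\<And>a b :: real. norm (of_real a * z + of_real b) \<ge> e * max \<bar>a\<bar> \<bar>b\<bar>"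
    using norm_linear_ge[OF z] by blast
  define K where "K = \<lceil>1 / e\<rceil>"
  have "{x \<in> X. g x \<le> 1} \<subseteq> {-K..K} \<times> {-K..K}"
  proof safe
    fix c d :: int assume "(c, d) \<in> X" "g (c, d) \<le> 1"
    hence "e * max \<bar>real_of_int c\<bar> \<bar>real_of_int d\<bar> \<le> 1"
      using e(2)[of "of_int c" "of_int d"] by (simp add: g_def)
    hence "max \<bar>real_of_int c\<bar> \<bar>real_of_int d\<bar> \<le> 1 / e"
      using e(1) by (metis pos_le_divide_eq mult.commute)
    hence "\<bar>real_of_int c\<bar> \<le> of_int K" "\<bar>real_of_int d\<bar> \<le> of_int K"
      unfolding K_def using le_of_int_ceiling[of "1 / e"] by linarith+
    thus "c \<in> {-K..K}" "d \<in> {-K..K}" by auto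
  qed
  hence fin: "finite (g ` {x \<in> X. g x \<le> 1})"
    by (meson finite_SigmaI finite_atLeastAtMost_int finite_imageI finite_subset)
  have "(0, 1) \<in> X" "g (0, 1) \<le> 1" by (auto simp: X_def g_def)
  hence ne: "g ` {x \<in> X. g x \<le> 1} \<noteq> {}" by blast
  obtain x where x: "x \<in> X" "g x \<le> 1" "g x = Min (g ` {x \<in> X. g x \<le> 1})"
    using Min_in[OF fin ne] by auto
  have min: "g x \<le> g y" if "y \<in> X" for y
  proof (cases "g y \<le> 1")
    case True
    thus ?thesis unfolding x(3) using that by (intro Min_le fin) auto
  qed (use x in auto)
  obtain a b c d where abcd: "x = (c, d)" "a * d - b * c = 1"
    using x(1) by (auto simp: X_def)
  define w where "w = (of_int a * z + of_int b) / (of_int c * z + of_int d)"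
  define n where "n = round (Re w)"
  have "(- c) * (b - n * d) - (- d) * (a - n * c) = 1" using abcd(2) by (simp add: algebra_simps)
  hence "(a - n * c, b - n * d) \<in> X" unfolding X_def by blast
  hence "g (c, d) \<le> g (a - n * c, b - n * d)" using min abcd by blast
  have nz: "of_int c * z + of_int d \<noteq> 0"
  proof (rule moebius_denom_neq_0[OF z])
    show "c \<noteq> 0 \<or> d \<noteq> 0" using abcd(2) by auto
  qed
  hence wu: "w * (of_int c * z + of_int d) = of_int a * z + of_int b"
    by (simp add: w_def)
  have eq: "of_int (a - n * c) * z + of_int (b - n * d) = (w - of_int n) * (of_int c * z + of_int d)"
    unfolding left_diff_distrib wu by (simp add: algebra_simps)
  have "norm (of_int c * z + of_int d) \<le> norm (w - of_int n) * norm (of_int c * z + of_int d)"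
    using \<open>g (c, d) \<le> g (a - n * c, b - n * d)\<close> eq by (simp add: g_def norm_mult)
  hence "norm (w - of_int n) \<ge> 1" using nz by simp
  hence "1 \<le> norm (w - of_int n) ^ 2" by (rule one_le_power)
  also have "norm (w - of_int n) ^ 2 = (Re w - of_int n) ^ 2 + Im w ^ 2"
    by (simp add: cmod_power2)
  also have "(Re w - of_int n) ^ 2 \<le> (1 / 2) ^ 2"
    using of_int_round_abs_le[of "Re w"] unfolding n_def
    by (intro power2_le_iff_abs_le[THEN iffD2]) (auto simp: abs_minus_commute)
  finally have "(1 / 2) ^ 2 \<le> Im w ^ 2" by (simp add: power2_eq_square)
  moreover have "Im w > 0" unfolding w_def by (rule Im_moebius_pos[OF abcd(2) z])
  hence "Im w \<ge> 0" by simp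
  ultimately have "1 / 2 \<le> Im w" by (rule power2_le_imp_le)
  thus ?thesis unfolding w_def by (rule that[OF abcd(2)])
qed

text \<open>
  A modular form of negative weight is small near the unit circle: transport its bound on
  \<open>Im z \<ge> 1 / 2\<close> back by a modular substitution. Cauchy's inequality then kills all coefficients.
\<close>
lemma mform_neg:
  assumes F: "mform k F" "even k" and k: "k < 0"
  shows "F = 0"
proof -
  define j where "j = nat (- k div 2)"
  have kj: "k = - int (2 * j)" and j: "j > 0" using k F(2) by (auto simp: j_def elim!: evenE)
  have rad: "rad1 F" using F by (simp add: mform_def)
  \<comment> \<open>The radius \<open>exp (- pi)\<close> is the norm of the nome at height
    \<open>1 / 2\<close>, the height reached in \<open>exists_moebius_Im_ge\<close>.\<close>
  have "ereal (norm q) < fps_conv_radius F" if "norm q \<le> exp (- pi)" for q :: complex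
    using that by (intro rad1_less rad) (simp add: order.strict_trans1[where b = "exp (- pi)"])
  hence "continuous_on (cball 0 (exp (- pi))) (eval_fps F)"
    by (intro continuous_on_eval_fps'[OF continuous_on_id]) auto
  hence "bounded (eval_fps F ` cball 0 (exp (- pi)))"
    by (intro compact_imp_bounded compact_continuous_image) auto
  then obtain B where "\<forall>x\<in>eval_fps F ` cball 0 (exp (- pi)). norm x \<le> B"
    unfolding bounded_iff by blast
  hence B: "norm (eval_fps F q) \<le> B" if "norm q \<le> exp (- pi)" for q
    using that by simp
  have B0: "B \<ge> 0" using order_trans[OF norm_ge_zero B[of 0]] by simp
  have bound: "norm (ev F z) \<le> B * (2 * Im z) ^ j" if z: "Im z > 0" for z
  proof -
    obtain a b c d :: int where abcd: "a * d - b * c = 1"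
      "Im ((of_int a * z + of_int b) / (of_int c * z + of_int d)) \<ge> 1 / 2"
      by (rule exists_moebius_Im_ge[OF z])
    define u where "u = of_int c * z + of_int d"
    define w where "w = (of_int a * z + of_int b) / u"
    have u: "u \<noteq> 0" unfolding u_def
    proof (rule moebius_denom_neq_0[OF z])
      show "c \<noteq> 0 \<or> d \<noteq> 0" using abcd(1) by auto
    qed
    have w: "Im w \<ge> 1 / 2" using abcd(2) by (simp add: w_def u_def)
    have "Im w = Im z / norm u ^ 2" unfolding w_def u_def by (rule Im_moebius[OF abcd(1)])
    hence "norm u ^ 2 = Im z / Im w" using u z w by (simp add: field_simps)
    also have "\<dots> \<le> Im z / (1 / 2)" using w z by (intro divide_left_mono) auto
    finally have nu: "norm u ^ 2 \<le> 2 * Im z" by simp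
    have "norm (to_nome w) \<le> exp (- pi)" using w by (simp add: norm_to_nome)
    hence Bw: "norm (ev F w) \<le> B" unfolding ev_def by (rule B)
    have "ev F w = u powi k * ev F z"
      unfolding w_def u_def by (rule mform_moebius[OF F abcd(1) z])
    hence "ev F w = ev F z / u ^ (2 * j)"
      unfolding kj power_int_minus power_int_of_nat by (simp add: divide_inverse mult.commute)
    hence "ev F z = ev F w * u ^ (2 * j)" using u by simp
    hence "norm (ev F z) = norm (ev F w) * (norm u ^ 2) ^ j"
      by (simp add: norm_mult norm_power power_mult)
    also have "\<dots> \<le> B * (2 * Im z) ^ j"
      using Bw nu B0 by (intro mult_mono power_mono) auto
    finally show ?thesis .
  qed
  have coeff: "norm (fps_nth F n) * r ^ n \<le> B * (- ln r / pi) ^ j" if r: "0 < r" "r < 1" for n r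
  proof -
    have rr: "ereal (norm q) < fps_conv_radius F" if "norm q \<le> r" for q :: complex
      using that r by (intro rad1_less rad) linarith
    have "norm ((deriv ^^ n) (eval_fps F) 0) \<le> fact n * (B * (- ln r / pi) ^ j) / r ^ n"
    proof (rule Cauchy_inequality)
      show "eval_fps F holomorphic_on ball 0 r"
        using rr[OF less_imp_le] by (intro holomorphic_on_eval_fps) auto
      show "continuous_on (cball 0 r) (eval_fps F)"
        using rr by (intro continuous_on_eval_fps'[OF continuous_on_id]) auto
      fix q :: complex assume "norm (0 - q) = r"
      hence q: "norm q = r" by simp
      hence q1: "norm q < 1" "q \<noteq> 0" using r by auto
      obtain z where z: "Im z > 0" "to_nome z = q" "Im z = - ln (norm q) / (2 * pi)"
        by (rule to_nome_surj'[OF q1])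
      have "norm (eval_fps F q) \<le> B * (2 * Im z) ^ j" using bound[OF z(1)] z(2) by (simp add: ev_def)
      also have "2 * Im z = - ln r / pi" by (simp add: z(3) q)
      finally show "norm (eval_fps F q) \<le> B * (- ln r / pi) ^ j" .
    qed (use r in auto)
    hence "norm ((deriv ^^ n) (eval_fps F) 0) / fact n \<le> (B * (- ln r / pi) ^ j) / r ^ n"
      by (subst pos_divide_le_eq) (simp_all add: mult.commute)
    moreover have "fps_conv_radius F > 0" using rad unfolding rad1_def by (rule less_le_trans[rotated]) simp
    hence "fps_nth F n = (deriv ^^ n) (eval_fps F) 0 / fact n" by (rule fps_nth_conv_deriv)
    ultimately have "norm (fps_nth F n) \<le> (B * (- ln r / pi) ^ j) / r ^ n"
      by (simp add: norm_divide)
    thus ?thesis using r by (subst (asm) pos_le_divide_eq) auto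
  qed
  \<comment> \<open>As \<open>r\<close> tends to 1, \<open>- ln r\<close> tends to 0; since
    \<open>j > 0\<close>, the bound on the coefficient collapses.\<close>
  have "fps_nth F n = 0" for n
  proof -
    have "((\<lambda>r. norm (fps_nth F n) * r ^ n) \<longlongrightarrow> norm (fps_nth F n) * 1 ^ n) (at_left 1)"
      by (intro tendsto_intros)
    moreover have "((\<lambda>r. B * (- ln r / pi) ^ j) \<longlongrightarrow> B * (- ln 1 / pi) ^ j) (at_left 1)"
      by (intro tendsto_intros) auto
    moreover have "eventually (\<lambda>r. norm (fps_nth F n) * r ^ n \<le> B * (- ln r / pi) ^ j) (at_left 1)"
      using eventually_at_left_field[of _ "1 :: real"] coeff by (auto intro!: exI[of _ 0])
    ultimately have "norm (fps_nth F n) * 1 ^ n \<le> B * (- ln 1 / pi) ^ j"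
      by (intro tendsto_le[OF trivial_limit_at_left_real])
    thus ?thesis using j by (simp add: power_0_left)
  qed
  thus ?thesis by (intro fps_ext) simp
qed

section \<open>Eisenstein series and their transformation laws\<close>

definition sigma_fps :: "'a::comm_ring_1 fps" where
  "sigma_fps = Abs_fps (\<lambda>n. of_nat (sigma1 n))"

lemma sigma1_0 [simp]: "sigma1 0 = 0"
  by (simp add: sigma1_def)

lemma sigma1_1 [simp]: "sigma1 (Suc 0) = 1"
  by (simp add: sigma1_def)

lemma sums_sigma1:
  assumes "norm q < 1"
  shows "summable (\<lambda>n. of_nat (sigma1 n) * q ^ n :: complex)"
proof -
  obtain S where "((\<lambda>n. of_nat (sigma1 n) * q ^ n) has_sum S) {1..}"
    using has_sum_sigma1[OF assms] by blast
  hence "summable (\<lambda>n. of_nat (sigma1 (Suc n)) * q ^ Suc n)"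
    unfolding has_sum_from_1_iff by (intro sums_summable has_sum_imp_sums)
  thus ?thesis by (subst (asm) summable_Suc_iff)
qed

lemma rad1_sigma_fps: "rad1 sigma_fps"
proof (rule rad1I)
  fix r :: real assume "0 < r" "r < 1"
  thus "\<exists>q::complex. norm q = r \<and> summable (\<lambda>n. fps_nth sigma_fps n * q ^ n)"
    by (intro exI[of _ "of_real r :: complex"] conjI) (auto simp: sigma_fps_def intro!: sums_sigma1)
qed

definition E2_fps :: "'a::comm_ring_1 fps" where
  "E2_fps = 1 - 24 * sigma_fps"

text \<open>\<open>E4\<close> and \<open>E6\<close> are obtained from \<open>E2\<close> by solving
  two of Ramanujan's identities, so that these hold by definition in every commutative ring and only
  the third one is left to prove.\<close>

definition E4_fps :: "'a::comm_ring_1 fps" where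
  "E4_fps = E2_fps ^ 2 - 12 * fps_XD E2_fps"

definition E6_fps :: "'a::comm_ring_1 fps" where
  "E6_fps = E2_fps * E4_fps - 3 * fps_XD E4_fps"

lemma rad1_E2: "rad1 E2_fps"
  unfolding E2_fps_def by (intro rad1_diff rad1_mult rad1_1 rad1_numeral rad1_sigma_fps)

lemma rad1_E4: "rad1 E4_fps"
  unfolding E4_fps_def by (intro rad1_diff rad1_mult rad1_numeral rad1_power rad1_XD rad1_E2)

lemma ev_E2:
  assumes "Im z > 0"
  shows "ev E2_fps z = E2 z"
proof -
  have s: "summable (\<lambda>n. of_nat (sigma1 n) * to_nome z ^ n)"
    by (rule sums_sigma1[OF norm_to_nome_less[OF assms]])
  have "ev sigma_fps z = (\<Sum>n. of_nat (sigma1 n) * to_nome z ^ n)"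
    by (simp add: ev_def eval_fps_def sigma_fps_def)
  also have "\<dots> = (\<Sum>n. of_nat (sigma1 (Suc n)) * to_nome z ^ Suc n)"
    using suminf_split_head[OF s] by simp
  finally show ?thesis
    using assms
    by (simp add: E2_fps_def E2_def ev_diff ev_mult rad1_mult rad1_1 rad1_numeral rad1_sigma_fps)
qed

lemma ev_E2_S: "Im z > 0 \<Longrightarrow> ev E2_fps (- 1 / z) = z ^ 2 * ev E2_fps z + 12 / (2 * of_real pi * \<i>) * z"
proof -
  assume z: "Im z > 0"
  have "ev E2_fps (- 1 / z) = E2 (- 1 / z)" by (intro ev_E2 Im_inverse_pos z)
  also have "\<dots> = z ^ 2 * E2 z - 6 * \<i> * z / of_real pi" by (rule E2_S[OF z])
  also have "\<dots> = z ^ 2 * E2 z + (- 6 * \<i> / of_real pi) * z" by simp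
  also have "- 6 * \<i> / of_real pi = 12 / (2 * of_real pi * \<i>)"
    by (simp add: field_simps)
  finally show ?thesis using z by (simp add: ev_E2)
qed

lemma derivative_inverse:
  assumes "Im z > 0"
  shows "((\<lambda>z. - 1 / z) has_field_derivative (1 / z ^ 2)) (at z)"
proof -
  have "z \<noteq> 0" using assms by auto
  thus ?thesis by (auto intro!: derivative_eq_intros simp: power2_eq_square)
qed

lemma ev_S_derivative:
  assumes "rad1 F" "Im z > 0"
  shows "((\<lambda>z. ev F (- 1 / z)) has_field_derivative
           (2 * of_real pi * \<i> * ev (fps_XD F) (- 1 / z) / z ^ 2)) (at z)"
  using DERIV_chain2[OF ev_has_derivative[OF assms(1) Im_inverse_pos[OF assms(2)]] derivative_inverse[OF assms(2)]]
  by simp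

text \<open>Up to the factor \<open>z powi k\<close>, differentiating the transformation law of
  \<open>F\<close> and multiplying by 12 leaves the extra term \<open>12 k z / (2 pi i)\<close>
  times \<open>F\<close>, and \<open>k * E2\<close> contributes the same one.\<close>

lemma mform_serre:
  assumes "mform k F"
  shows "mform (k + 2) (12 * fps_XD F - of_int k * E2_fps * F)"
  unfolding mform_def
proof (intro conjI allI impI)
  have rad: "rad1 F" and S: "\<And>z. Im z > 0 \<Longrightarrow> ev F (- 1 / z) = z powi k * ev F z"
    using assms by (auto simp: mform_def)
  have of_int: "(of_int k :: complex fps) = fps_const (of_int k)" by (simp add: fps_of_int)
  have rad2: "rad1 (12 * fps_XD F)" "rad1 (of_int k * E2_fps * F)"
    unfolding of_int by (intro rad1_mult rad1_numeral rad1_XD rad rad1_const rad1_E2)+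
  thus "rad1 (12 * fps_XD F - of_int k * E2_fps * F)" by (rule rad1_diff)
  fix z :: complex assume z: "Im z > 0"
  define \<kappa> where "\<kappa> = 2 * of_real pi * \<i>"
  have \<kappa>: "\<kappa> \<noteq> 0" by (simp add: \<kappa>_def)
  have "z \<noteq> 0" using z by auto
  have "((\<lambda>z. ev F (- 1 / z)) has_field_derivative
      (of_int k * z powi (k - 1) * ev F z + z powi k * (\<kappa> * ev (fps_XD F) z))) (at z)"
  proof (rule has_field_derivative_transform_within_open)
    show "((\<lambda>z. z powi k * ev F z) has_field_derivative
        (of_int k * z powi (k - 1) * ev F z + z powi k * (\<kappa> * ev (fps_XD F) z))) (at z)"
      using \<open>z \<noteq> 0\<close> unfolding \<kappa>_def
      by (auto intro!: derivative_eq_intros ev_has_derivative rad z)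
    show "open {z. Im z > 0}" by (rule open_halfspace_Im_gt)
  qed (use z S in auto)
  from DERIV_unique[OF ev_S_derivative[OF rad z] this]
  have eq: "\<kappa> * ev (fps_XD F) (- 1 / z) / z ^ 2 =
      of_int k * z powi (k - 1) * ev F z + z powi k * (\<kappa> * ev (fps_XD F) z)"
    by (simp add: \<kappa>_def)
  have pz: "z powi k = z powi (k - 1) * z"
    using \<open>z \<noteq> 0\<close> power_int_add[of z "k - 1" 1] by simp
  have "ev (fps_XD F) (- 1 / z) = z ^ 2 / \<kappa> * (\<kappa> * ev (fps_XD F) (- 1 / z) / z ^ 2)"
    using \<open>z \<noteq> 0\<close> \<kappa> by simp
  also have "\<dots> = z powi k * (z * of_int k * ev F z / \<kappa> + z ^ 2 * ev (fps_XD F) z)"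
    unfolding eq pz using \<kappa> by (simp add: field_simps power2_eq_square)
  finally have D: "ev (fps_XD F) (- 1 / z) =
      z powi k * (z * of_int k * ev F z / \<kappa> + z ^ 2 * ev (fps_XD F) z)" .
  have ev: "ev (12 * fps_XD F - of_int k * E2_fps * F) w =
      12 * ev (fps_XD F) w - of_int k * ev E2_fps w * ev F w" if "Im w > 0" for w
    unfolding of_int using that rad
    by (simp add: ev_diff ev_mult rad1_mult rad1_numeral rad1_XD rad1_const rad1_E2)
  have zk: "z powi (k + 2) = z powi k * z ^ 2" using \<open>z \<noteq> 0\<close> by (simp add: power_int_add)
  have e: "ev E2_fps (- 1 / z) = z ^ 2 * ev E2_fps z + 12 / \<kappa> * z"
    unfolding \<kappa>_def by (rule ev_E2_S[OF z])
  show "ev (12 * fps_XD F - of_int k * E2_fps * F) (- 1 / z) =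
        z powi (k + 2) * ev (12 * fps_XD F - of_int k * E2_fps * F) z"
    unfolding ev[OF z] ev[OF Im_inverse_pos[OF z]] S[OF z] D e zk
    using \<kappa> by (simp add: field_simps)
qed

text \<open>The extra terms of \<open>E2^2\<close> and of \<open>12 * fps_XD E2_fps\<close> under
  \<open>- 1 / z\<close> coincide.\<close>

lemma mform_E4: "mform 4 E4_fps"
  unfolding mform_def
proof (intro conjI allI impI rad1_E4)
  fix z :: complex assume z: "Im z > 0"
  define \<kappa> where "\<kappa> = 2 * of_real pi * \<i>"
  have \<kappa>: "\<kappa> \<noteq> 0" by (simp add: \<kappa>_def)
  have "z \<noteq> 0" using z by auto
  have "((\<lambda>z. ev E2_fps (- 1 / z)) has_field_derivative
      (2 * z * ev E2_fps z + z ^ 2 * (\<kappa> * ev (fps_XD E2_fps) z) + 12 / \<kappa>)) (at z)"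
  proof (rule has_field_derivative_transform_within_open)
    show "((\<lambda>z. z ^ 2 * ev E2_fps z + 12 / \<kappa> * z) has_field_derivative
       (2 * z * ev E2_fps z + z ^ 2 * (\<kappa> * ev (fps_XD E2_fps) z) + 12 / \<kappa>)) (at z)"
      unfolding \<kappa>_def by (auto intro!: derivative_eq_intros ev_has_derivative rad1_E2 z)
    show "open {z. Im z > 0}" by (rule open_halfspace_Im_gt)
  qed (use z ev_E2_S in \<open>auto simp: \<kappa>_def\<close>)
  from DERIV_unique[OF ev_S_derivative[OF rad1_E2 z] this]
  have eq: "\<kappa> * ev (fps_XD E2_fps) (- 1 / z) / z ^ 2 =
     2 * z * ev E2_fps z + z ^ 2 * (\<kappa> * ev (fps_XD E2_fps) z) + 12 / \<kappa>"
    by (simp add: \<kappa>_def)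
  have "ev (fps_XD E2_fps) (- 1 / z) = z ^ 2 / \<kappa> * (\<kappa> * ev (fps_XD E2_fps) (- 1 / z) / z ^ 2)"
    using \<open>z \<noteq> 0\<close> \<kappa> by simp
  hence D: "ev (fps_XD E2_fps) (- 1 / z) =
     z ^ 2 / \<kappa> * (2 * z * ev E2_fps z + z ^ 2 * (\<kappa> * ev (fps_XD E2_fps) z) + 12 / \<kappa>)"
    unfolding eq .
  have ev: "ev E4_fps w = ev E2_fps w ^ 2 - 12 * ev (fps_XD E2_fps) w" if "Im w > 0" for w
    unfolding E4_fps_def using that
    by (simp add: ev_diff ev_mult ev_power rad1_power rad1_mult rad1_numeral rad1_XD rad1_E2)
  have e: "ev E2_fps (- 1 / z) = z ^ 2 * ev E2_fps z + 12 / \<kappa> * z"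
    unfolding \<kappa>_def by (rule ev_E2_S[OF z])
  show "ev E4_fps (- 1 / z) = z powi 4 * ev E4_fps z"
    unfolding ev[OF z] ev[OF Im_inverse_pos[OF z]] D e
    using \<kappa> by (simp add: field_simps power2_eq_square power4_eq_xxxx)
qed

lemma mform_E6: "mform 6 E6_fps"
proof -
  have "mform (4 + 2) (fps_const (- 1 / 4) * (12 * fps_XD E4_fps - of_int 4 * E2_fps * E4_fps))"
    by (intro mform_scale mform_serre mform_E4)
  also have "fps_const (- 1 / 4) * (12 * fps_XD E4_fps - of_int 4 * E2_fps * E4_fps) = (E6_fps :: complex fps)"
  proof -
    have 1: "fps_const (- 1 / 4) * 12 = (- 3 :: complex fps)" "fps_const (- 1 / 4) * of_int 4 = (- 1 :: complex fps)"
      by (simp_all add: fps_numeral_fps_const)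
    have "fps_const (- 1 / 4) * (12 * fps_XD E4_fps - of_int 4 * E2_fps * E4_fps) =
        (fps_const (- 1 / 4) * 12) * fps_XD E4_fps - (fps_const (- 1 / 4) * of_int 4) * (E2_fps * E4_fps :: complex fps)"
      by (simp only: right_diff_distrib mult.assoc)
    also have "\<dots> = E6_fps" unfolding 1 E6_fps_def by simp
    finally show ?thesis .
  qed
  finally show ?thesis by simp
qed

section \<open>The discriminant as an exponential\<close>

definition L_fps :: "complex fps" where
  "L_fps = Abs_fps (\<lambda>n. of_nat (sigma1 n) / of_nat n)"

lemma XD_L_fps: "fps_XD L_fps = sigma_fps"
proof (rule fps_ext)
  fix n show "fps_nth (fps_XD L_fps) n = fps_nth sigma_fps n"
    by (cases "n = 0") (auto simp: fps_XD_nth L_fps_def sigma_fps_def)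
qed

lemma rad1_L_fps: "rad1 L_fps"
proof (rule rad1I)
  fix r :: real assume r: "0 < r" "r < 1"
  have "summable (\<lambda>n. norm (fps_nth sigma_fps n * of_real r ^ n :: complex))"
    using rad1_less[OF rad1_sigma_fps, of "of_real r :: complex"] r by (intro norm_summable_fps) auto
  hence "summable (\<lambda>n. fps_nth L_fps n * of_real r ^ n)"
  proof (rule summable_comparison_test')
    fix n :: nat
    have "real (sigma1 n) / real n \<le> real (sigma1 n)"
      using divide_left_mono[of 1 "real n" "real (sigma1 n)"] by (cases "n = 0") simp_all
    hence "real (sigma1 n) / real n * r ^ n \<le> real (sigma1 n) * r ^ n"
      using r by (intro mult_right_mono) auto
    thus "norm (fps_nth L_fps n * of_real r ^ n) \<le> norm (fps_nth sigma_fps n * of_real r ^ n :: complex)"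
      using r by (simp add: L_fps_def sigma_fps_def norm_mult norm_divide norm_power)
  qed
  thus "\<exists>q. norm q = r \<and> summable (\<lambda>n. fps_nth L_fps n * q ^ n)"
    using r by (intro exI[of _ "of_real r :: complex"]) auto
qed

definition expL :: "complex \<Rightarrow> complex fps" where
  "expL c = fps_expansion (\<lambda>q. exp (c * eval_fps L_fps q)) 0"

lemma holomorphic_expL: "(\<lambda>q. exp (c * eval_fps L_fps q)) holomorphic_on eball 0 1"
  by (intro holomorphic_intros) (auto intro: rad1_less[OF rad1_L_fps])

lemma rad1_expL: "rad1 (expL c)"
  unfolding rad1_def expL_def by (rule conv_radius_fps_expansion[OF holomorphic_expL])

lemma eval_expL: "norm q < 1 \<Longrightarrow> eval_fps (expL c) q = exp (c * eval_fps L_fps q)"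
  unfolding expL_def by (subst eval_fps_expansion'[OF holomorphic_expL]) auto

text \<open>\<open>L_fps\<close> is minus the logarithm of the product of all
  \<open>1 - q^n\<close>, so this is \<open>q\<close> times the product of all
  \<open>(1 - q^n)^24\<close>. As an exponential it has no zeros in the half plane, hence cusp forms
  can be divided by it.\<close>

definition delta :: "complex fps" where
  "delta = fps_X * expL (- 24)"

lemma rad1_delta: "rad1 delta"
  unfolding delta_def by (intro rad1_mult rad1_X rad1_expL)

lemma ev_delta:
  assumes "Im z > 0"
  shows "ev delta z = exp (2 * of_real pi * \<i> * z - 24 * ev L_fps z)"
  using assms ev_mult[OF rad1_X rad1_expL, of z "- 24"] norm_to_nome_less[OF assms]
  by (simp add: delta_def ev_def eval_expL to_nome_def exp_diff exp_minus divide_inverse)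

lemma expL_inverse: "expL (- 24) * expL 24 = 1"
proof (rule ev_eqD)
  fix z :: complex assume z: "Im z > 0"
  have "ev (expL (- 24) * expL 24) z = ev (expL (- 24)) z * ev (expL 24) z"
    by (intro ev_mult rad1_expL z)
  also have "\<dots> = ev 1 z"
    using norm_to_nome_less[OF z] by (simp add: ev_def eval_expL flip: exp_add)
  finally show "ev (expL (- 24) * expL 24) z = ev 1 z" .
qed (intro rad1_mult rad1_expL rad1_1)+

text \<open>The logarithmic derivative of \<open>delta\<close> is \<open>2 pi i * E2\<close>, so by
  the transformation law of \<open>E2\<close> the quotient \<open>K\<close> of both sides is
  constant; its value is 1 at the fixed point \<open>\<i>\<close>.\<close>

lemma mform_delta: "mform 12 delta"
  unfolding mform_def
proof (intro conjI allI impI rad1_delta)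
  fix z :: complex assume z: "Im z > 0"
  define H where "H = (\<lambda>z. 2 * of_real pi * \<i> * z - 24 * ev L_fps z)"
  define K where "K = (\<lambda>z. exp (H (- 1 / z) - H z) / z ^ 12)"
  have H: "(H has_field_derivative (2 * of_real pi * \<i> * ev E2_fps z)) (at z)" if "Im z > 0" for z
  proof -
    have E: "ev E2_fps z = 1 - 24 * ev (fps_XD L_fps) z"
      using that unfolding XD_L_fps E2_fps_def
      by (simp add: ev_diff ev_mult rad1_1 rad1_mult rad1_numeral rad1_sigma_fps)
    show ?thesis unfolding H_def E using that
      by (auto intro!: derivative_eq_intros ev_has_derivative rad1_L_fps simp: algebra_simps)
  qed
  have K: "(K has_field_derivative 0) (at z)" if z: "Im z > 0" for z
  proof -
    have "z \<noteq> 0" using z by auto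
    have "((\<lambda>z. H (- 1 / z)) has_field_derivative (2 * of_real pi * \<i> * ev E2_fps (- 1 / z) * (1 / z ^ 2))) (at z)"
      by (rule DERIV_chain2[OF H[OF Im_inverse_pos[OF z]] derivative_inverse[OF z]])
    also have "2 * of_real pi * \<i> * ev E2_fps (- 1 / z) * (1 / z ^ 2) =
        2 * of_real pi * \<i> * ev E2_fps z + 12 / z"
      unfolding ev_E2_S[OF z] using \<open>z \<noteq> 0\<close> by (simp add: field_simps power2_eq_square)
    finally have 1: "((\<lambda>z. H (- 1 / z)) has_field_derivative (2 * of_real pi * \<i> * ev E2_fps z + 12 / z)) (at z)" .
    have "((\<lambda>z. H (- 1 / z) - H z) has_field_derivative 12 / z) (at z)"
      using DERIV_diff[OF 1 H[OF z]] by simp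
    hence 2: "((\<lambda>z. exp (H (- 1 / z) - H z)) has_field_derivative
        (exp (H (- 1 / z) - H z) * (12 / z))) (at z)"
      by (rule DERIV_chain2[OF DERIV_exp])
    have "((\<lambda>z. z ^ 12) has_field_derivative 12 * z ^ 11) (at z)"
      by (auto intro!: derivative_eq_intros)
    from DERIV_divide[OF 2 this] \<open>z \<noteq> 0\<close>
    have "(K has_field_derivative
      (exp (H (- 1 / z) - H z) * (12 / z) * z ^ 12 - exp (H (- 1 / z) - H z) * (12 * z ^ 11)) / (z ^ 12 * z ^ 12)) (at z)"
      unfolding K_def by simp
    moreover have "12 / z * z ^ 12 = 12 * z ^ 11"
      using \<open>z \<noteq> 0\<close> by (simp add: power_numeral_reduce)
    hence "exp (H (- 1 / z) - H z) * (12 / z) * z ^ 12 - exp (H (- 1 / z) - H z) * (12 * z ^ 11) = 0"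
      by (metis diff_self mult.assoc)
    ultimately show ?thesis by simp
  qed
  have "\<exists>c. \<forall>x\<in>{z. Im z > 0}. K x = c"
    by (rule has_field_derivative_zero_constant)
       (auto intro: convex_halfspace_Im_gt K has_field_derivative_at_within)
  then obtain c where c: "\<And>x. Im x > 0 \<Longrightarrow> K x = c" by blast
  have "- 1 / \<i> = \<i>" by (simp add: divide_i)
  hence "K \<i> = 1" by (simp add: K_def power_numeral_reduce)
  hence "K z = 1" using c[of \<i>] c[OF z] by simp
  moreover have "z \<noteq> 0" using z by auto
  ultimately have "exp (H (- 1 / z)) = z ^ 12 * exp (H z)"
    by (simp add: K_def exp_diff field_simps)
  thus "ev delta (- 1 / z) = z powi 12 * ev delta z"
    using z Im_inverse_pos[OF z] by (simp add: ev_delta H_def)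
qed

lemma mform_cusp:
  assumes F: "mform k F" "fps_nth F 0 = 0"
  obtains G where "mform (k - 12) G" "F = delta * G"
proof
  define G where "G = fps_shift 1 F * expL 24"
  have rad: "rad1 G"
    unfolding G_def using mform_rad1[OF F(1)]
    by (intro rad1_mult rad1_expL) (simp add: rad1_def)
  have "F = fps_X * fps_shift 1 F"
    using F(2) by (intro fps_ext) (auto simp: not_less_eq split: nat.splits)
  also have "\<dots> = fps_X * (expL (- 24) * expL 24) * fps_shift 1 F" by (simp add: expL_inverse)
  finally show FG: "F = delta * G" by (simp add: delta_def G_def mult_ac)
  show "mform (k - 12) G"
    unfolding mform_def
  proof (intro conjI allI impI rad)
    fix z :: complex assume z: "Im z > 0"
    have "z \<noteq> 0" using z by auto
    have "ev F (- 1 / z) = z powi k * ev F z" using F(1) z by (simp add: mform_def)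
    hence "ev delta (- 1 / z) * ev G (- 1 / z) = z powi k * (ev delta z * ev G z)"
      unfolding FG ev_mult[OF rad1_delta rad z] ev_mult[OF rad1_delta rad Im_inverse_pos[OF z]] .
    moreover have "ev delta (- 1 / z) = z ^ 12 * ev delta z"
      using mform_delta z by (simp add: mform_def)
    moreover have "z powi k = z ^ 12 * z powi (k - 12)"
      using \<open>z \<noteq> 0\<close> power_int_add[of z 12 "k - 12"] by simp
    ultimately have "(z ^ 12 * ev delta z) * ev G (- 1 / z) = (z ^ 12 * ev delta z) * (z powi (k - 12) * ev G z)"
      by (simp only: mult_ac)
    moreover have "z ^ 12 * ev delta z \<noteq> 0" using z \<open>z \<noteq> 0\<close> by (simp add: ev_delta)
    ultimately show "ev G (- 1 / z) = z powi (k - 12) * ev G z" by (metis mult_left_cancel)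
  qed
qed

lemma mform_cusp_eq_0:
  assumes "mform k F" "fps_nth F 0 = 0" "even k" "k < 12"
  shows "F = 0"
proof -
  obtain G where G: "mform (k - 12) G" "F = delta * G" using mform_cusp assms(1,2) by blast
  have "G = 0" by (rule mform_neg[OF G(1)]) (use assms in auto)
  thus ?thesis using G by simp
qed

section \<open>Ramanujan's third identity over every commutative ring\<close>

lemma E2_nth: "fps_nth E2_fps 0 = 1" "fps_nth E2_fps (Suc 0) = - 24"
  by (simp_all add: E2_fps_def sigma_fps_def fps_mult_nth_1 fps_numeral_nth)

lemma E4_nth: "fps_nth E4_fps 0 = 1" "fps_nth E4_fps (Suc 0) = (240 :: 'a::comm_ring_1)"
  by (simp_all add: E4_fps_def E2_nth fps_XD_nth power2_eq_square fps_mult_nth_1 fps_numeral_nth)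

lemma E6_nth: "fps_nth E6_fps 0 = 1" "fps_nth E6_fps (Suc 0) = (- 504 :: 'a::comm_ring_1)"
  by (simp_all add: E6_fps_def E2_nth E4_nth fps_XD_nth fps_mult_nth_1 fps_numeral_nth)

lemma disc_nth: "fps_nth (E4_fps ^ 3 - E6_fps ^ 2) 1 = (1728 :: 'a::comm_ring_1)"
  by (simp add: E4_nth E6_nth power2_eq_square power3_eq_cube fps_mult_nth_1)

text \<open>Six times the difference of both sides is the Serre derivative of \<open>E6_fps\<close>
  plus \<open>6 * E4_fps^2\<close>, a form of weight 8 without constant term.\<close>

lemma DE6_complex: "2 * fps_XD E6_fps = E2_fps * E6_fps - (E4_fps :: complex fps) ^ 2"
proof -
  define F :: "complex fps" where "F = 2 * fps_XD E6_fps - E2_fps * E6_fps + E4_fps ^ 2"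
  have "mform 8 ((12 * fps_XD E6_fps - of_int 6 * E2_fps * E6_fps) + fps_const 6 * E4_fps ^ 2)"
    using mform_serre[OF mform_E6] mform_scale[OF mform_power[OF mform_E4, of 2]]
    by (intro mform_add) simp_all
  also have "(12 * fps_XD E6_fps - of_int 6 * E2_fps * E6_fps) + fps_const 6 * E4_fps ^ 2 = fps_const 6 * F"
    by (simp add: F_def algebra_simps flip: fps_numeral_fps_const)
  finally have "fps_const 6 * F = 0"
    by (rule mform_cusp_eq_0) (auto simp: F_def E2_nth E4_nth E6_nth fps_XD_nth power2_eq_square)
  hence "F = 0" by simp
  thus ?thesis by (simp add: F_def algebra_simps add_eq_0_iff2)
qed

definition ofi :: "int fps \<Rightarrow> 'a::comm_ring_1 fps" where
  "ofi F = Abs_fps (\<lambda>n. of_int (fps_nth F n))"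

lemma ofi_nth [simp]: "fps_nth (ofi F) n = of_int (fps_nth F n)"
  by (simp add: ofi_def)

lemma ofi_diff [simp]: "ofi (F - G) = ofi F - ofi G"
  by (rule fps_ext) simp

lemma ofi_mult [simp]: "ofi (F * G) = ofi F * ofi G"
  by (rule fps_ext) (simp add: fps_mult_nth)

lemma ofi_1 [simp]: "ofi 1 = 1"
  by (rule fps_ext) (simp add: fps_one_nth)

lemma ofi_numeral [simp]: "ofi (numeral n) = numeral n"
  by (rule fps_ext) (simp add: fps_numeral_nth)

lemma ofi_power [simp]: "ofi (F ^ n) = ofi F ^ n"
  by (induction n) simp_all

lemma ofi_XD [simp]: "ofi (fps_XD F) = fps_XD (ofi F)"
  by (rule fps_ext) (simp add: fps_XD_nth)

lemma ofi_sigma [simp]: "ofi sigma_fps = sigma_fps"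
  by (rule fps_ext) (simp add: sigma_fps_def)

lemma ofi_E2 [simp]: "ofi E2_fps = E2_fps"
  by (simp add: E2_fps_def)

lemma ofi_E4 [simp]: "ofi E4_fps = E4_fps"
  by (simp add: E4_fps_def)

lemma ofi_E6 [simp]: "ofi E6_fps = E6_fps"
  by (simp add: E6_fps_def)

lemma ofi_complex_inj: "ofi F = (ofi G :: complex fps) \<Longrightarrow> F = G"
  by (rule fps_ext) (metis ofi_nth of_int_eq_iff)

text \<open>The identity is pulled back from the complex numbers to the integers, where the
  coefficients live, and pushed on from there to any ring.\<close>

lemma DE6: "2 * fps_XD E6_fps = E2_fps * E6_fps - (E4_fps :: 'a::comm_ring_1 fps) ^ 2"
proof -
  have "2 * fps_XD E6_fps = E2_fps * E6_fps - (E4_fps :: int fps) ^ 2"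
    by (rule ofi_complex_inj) (simp add: DE6_complex)
  from arg_cong[OF this, of ofi] show ?thesis by simp
qed

lemma ramanujan_Eisenstein:
  assumes "(1728 :: 'a::field) \<noteq> 0"
  shows "ramanujan E2_fps E4_fps (E6_fps :: 'a fps)"
proof
  show "12 * fps_XD E2_fps = E2_fps ^ 2 - (E4_fps :: 'a fps)" by (simp add: E4_fps_def)
  show "3 * fps_XD E4_fps = E2_fps * E4_fps - (E6_fps :: 'a fps)" by (simp add: E6_fps_def)
  show "fps_nth (E4_fps ^ 3 - E6_fps ^ 2) 1 \<noteq> (0 :: 'a)" unfolding disc_nth by (rule assms)
qed (simp_all add: E2_nth E4_nth E6_nth DE6)

section \<open>The structure theorem over the complex numbers\<close>

interpretation C: ramanujan E2_fps E4_fps "E6_fps :: complex fps"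
  by (rule ramanujan_Eisenstein) simp

text \<open>The quotient of \<open>disc\<close> by \<open>delta\<close> is a form of weight 0, hence
  constant.\<close>

lemma delta_MF: "delta \<in> C.MF 12"
proof -
  have mf: "mform 12 C.disc"
    using mform_diff[OF mform_power[OF mform_E4, of 3, simplified] mform_power[OF mform_E6, of 2, simplified]]
    by (simp add: C.disc_def)
  obtain G where G: "mform (12 - 12) G" "C.disc = delta * G"
    using mform_cusp[OF mf C.disc_0] by blast
  have "mform 0 (G - fps_const (fps_nth G 0) * 1)"
    using G by (intro mform_diff mform_scale mform_1) simp
  hence "G - fps_const (fps_nth G 0) * 1 = 0" by (rule mform_cusp_eq_0) auto
  hence eq: "C.disc = fps_const (fps_nth G 0) * delta" using G by (simp add: mult.commute)
  have "fps_nth G 0 \<noteq> 0" using eq C.disc_neq_0 by auto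
  hence "delta = fps_const (1 / fps_nth G 0) * C.disc"
    unfolding eq by (simp flip: mult.assoc)
  thus ?thesis using C.MF_scale[OF C.disc_MF] by metis
qed

text \<open>If \<open>a\<close> is the constant term, weights 4 and 6 give
  \<open>F^2 = a^2 * E4\<close> and \<open>F^3 = a^3 * E6\<close>; comparing the two values of
  \<open>F^6\<close> yields \<open>a^6 * disc = 0\<close>.\<close>

lemma mform_2: "mform 2 F \<Longrightarrow> F = 0"
proof -
  assume F: "mform 2 F"
  define a where "a = fps_nth F 0"
  have "mform 4 (F ^ 2 - fps_const (a ^ 2) * E4_fps)"
    using mform_power[OF F, of 2] by (intro mform_diff mform_scale mform_E4) simp
  hence "F ^ 2 - fps_const (a ^ 2) * E4_fps = 0"
    by (rule mform_cusp_eq_0) (auto simp: a_def E4_nth fps_nth_power_0)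
  hence 2: "F ^ 2 = fps_const (a ^ 2) * E4_fps" by simp
  have "mform 6 (F ^ 3 - fps_const (a ^ 3) * E6_fps)"
    using mform_power[OF F, of 3] by (intro mform_diff mform_scale mform_E6) simp
  hence "F ^ 3 - fps_const (a ^ 3) * E6_fps = 0"
    by (rule mform_cusp_eq_0) (auto simp: a_def E6_nth fps_nth_power_0)
  hence 3: "F ^ 3 = fps_const (a ^ 3) * E6_fps" by simp
  have "fps_const (a ^ 6) * E4_fps ^ 3 = (F ^ 2) ^ 3"
    unfolding 2 by (simp add: power_mult_distrib fps_const_power flip: power_mult)
  also have "\<dots> = (F ^ 3) ^ 2" by (simp flip: power_mult)
  also have "\<dots> = fps_const (a ^ 6) * E6_fps ^ 2"
    unfolding 3 by (simp add: power_mult_distrib fps_const_power flip: power_mult)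
  finally have "fps_const (a ^ 6) * C.disc = 0" by (simp add: C.disc_def algebra_simps)
  hence "a = 0" using C.disc_neq_0 by simp
  hence "F ^ 2 = 0" using 2 by simp
  thus ?thesis by simp
qed

lemma mform_imp_MF:
  assumes "even k" "mform k F"
  shows "F \<in> C.MF k"
  using assms
\<comment> \<open>The offset 12 makes the measure drop also in the last step, where
  \<open>k - 12\<close> is negative.\<close>
proof (induction "nat (k + 12)" arbitrary: k F rule: less_induct)
  case less
  consider "k < 0" | "k = 2" | "k \<ge> 0" "k \<noteq> 2" by linarith
  thus ?case
  proof cases
    case 1
    thus ?thesis using mform_neg[OF less.prems(2,1)] by (simp add: C.MF.zero)
  next
    case 2
    thus ?thesis using mform_2 less.prems by (auto intro: C.MF.zero)
  next
    case 3
    define j where "j = nat (k div 2)"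
    have j: "k = 2 * int j" using 3 less.prems(1) by (simp add: j_def)
    hence "j \<noteq> 1" using 3 by auto
    obtain a b where ab: "4 * int a + 6 * int b = k"
    proof (cases "even j")
      case True
      thus ?thesis using that[of "j div 2" 0] j by auto
    next
      case False
      define i where "i = (j - 3) div 2"
      have "j = 2 * i + 3" using False \<open>j \<noteq> 1\<close> unfolding i_def by presburger
      thus ?thesis using that[of i 1] j by simp
    qed
    define m where "m = fps_const (fps_nth F 0) * (E4_fps ^ a * E6_fps ^ b)"
    have m: "m \<in> C.MF k" unfolding m_def by (intro C.MF_scale C.MF_monom ab)
    have "mform (int a * 4 + int b * 6) (E4_fps ^ a * E6_fps ^ b)"
      by (intro mform_mult mform_power mform_E4 mform_E6)
    hence "mform k m" using ab unfolding m_def by (intro mform_scale) (simp add: mult.commute)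
    hence "mform k (F - m)" using less.prems by (intro mform_diff)
    moreover have "fps_nth (F - m) 0 = 0" by (simp add: m_def E4_nth E6_nth fps_nth_power_0)
    ultimately obtain G where G: "mform (k - 12) G" "F - m = delta * G" using mform_cusp by blast
    have "G \<in> C.MF (k - 12)" using less.hyps[of "k - 12" G] G(1) less.prems 3 by auto
    from C.MF_mult[OF delta_MF this] have "F - m \<in> C.MF k" by (simp add: G)
    from C.MF_add[OF this m] show ?thesis by simp
  qed
qed

lemma MF_imp_mform: "F \<in> C.MF k \<Longrightarrow> mform k F"
proof (induction rule: C.MF.induct)
  case (step x a b c)
  have "mform (int a * 4 + int b * 6) (E4_fps ^ a * E6_fps ^ b)"
    by (intro mform_mult mform_power mform_E4 mform_E6)
  hence "mform k (fps_const c * (E4_fps ^ a * E6_fps ^ b))"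
    using step(2) by (intro mform_scale) (simp add: mult.commute)
  thus ?case using step by (auto intro!: mform_add simp: mult.assoc)
qed (rule mform_0)

section \<open>The coefficient matrix and its determinant\<close>

text \<open>Exactly the weights \<open>4 a + 6 b\<close>, by \<open>admissible_obtain\<close> and
  \<open>admissibleI\<close>.\<close>

definition admissible :: "int \<Rightarrow> bool" where
  "admissible k \<longleftrightarrow> 0 \<le> k \<and> k \<noteq> 2 \<and> even k"

text \<open>The orders at the cusp that occur in weight \<open>k\<close>; they index an echelon
  basis, see \<open>form\<close> and \<open>fps_nth_form\<close>.\<close>

definition orders :: "int \<Rightarrow> nat set" where
  "orders k = {j. admissible (k - 12 * int j)}"

lemma finite_orders: "finite (orders k)"
proof (rule finite_subset)
  show "orders k \<subseteq> {..nat k}" by (auto simp: orders_def admissible_def)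
qed simp

lemma admissible_obtain:
  assumes "admissible k"
  obtains a b where "4 * int a + 6 * int b = k"
proof -
  define j where "j = nat (k div 2)"
  have j: "k = 2 * int j" using assms by (simp add: j_def admissible_def)
  hence "j \<noteq> 1" using assms by (auto simp: admissible_def)
  show ?thesis
  proof (cases "even j")
    case True
    thus ?thesis using that[of "j div 2" 0] j by auto
  next
    case False
    define i where "i = (j - 3) div 2"
    have "j = 2 * i + 3" using False \<open>j \<noteq> 1\<close> unfolding i_def by presburger
    thus ?thesis using that[of i 1] j by simp
  qed
qed

lemma admissibleI: "4 * int a + 6 * int b = k \<Longrightarrow> admissible k"
  unfolding admissible_def by presburger

lemma orders_Suc: "admissible k \<Longrightarrow> orders k = insert 0 (Suc ` orders (k - 12))"
proof -
  assume k: "admissible k"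
  have "j \<in> orders k \<longleftrightarrow> j = 0 \<or> (\<exists>i. j = Suc i \<and> i \<in> orders (k - 12))" for j
    using k by (cases j) (auto simp: orders_def algebra_simps)
  thus ?thesis by auto
qed

context ramanujan
begin

definition form :: "int \<Rightarrow> nat \<Rightarrow> 'a fps" where
  "form k j = disc ^ j * Cmon (k - 12 * int j)"

lemma form_MF: "j \<in> orders k \<Longrightarrow> form k j \<in> MF k"
proof -
  assume "j \<in> orders k"
  then obtain a b where "4 * int a + 6 * int b = k - 12 * int j"
    using admissible_obtain by (auto simp: orders_def)
  from MF_mult[OF MF_power[OF disc_MF, of j] Cmon_MF[OF this]] show ?thesis
    by (simp add: form_def algebra_simps)
qed

lemma MF_expand:
  assumes "x \<in> MF k"
  shows "\<exists>c. x = (\<Sum>j\<in>orders k. fps_const (c j) * form k j)"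
  using assms
proof (induction "nat (k + 12)" arbitrary: x k rule: less_induct)
  case less
  show ?case
  proof (cases "x = 0")
    case True
    thus ?thesis by (intro exI[of _ "\<lambda>_. 0"]) simp
  next
    case False
    then obtain a b where "4 * int a + 6 * int b = k" using MF_nontrivial less.prems by blast
    hence k: "admissible k" by (rule admissibleI)
    obtain y where y: "y \<in> MF (k - 12)" "x = fps_const (fps_nth x 0) * Cmon k + disc * y"
      using MF_eq_Cmon[OF less.prems] by blast
    have "nat (k - 12 + 12) < nat (k + 12)" using k by (simp add: admissible_def)
    from less.hyps[OF this y(1)] obtain c
      where c: "y = (\<Sum>j\<in>orders (k - 12). fps_const (c j) * form (k - 12) j)" by blast
    define c' where "c' = case_nat (fps_nth x 0) c"
    have "(\<Sum>j\<in>orders k. fps_const (c' j) * form k j) =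
        fps_const (c' 0) * form k 0 + (\<Sum>j\<in>Suc ` orders (k - 12). fps_const (c' j) * form k j)"
      unfolding orders_Suc[OF k] using finite_orders by (subst sum.insert) auto
    also have "(\<Sum>j\<in>Suc ` orders (k - 12). fps_const (c' j) * form k j) =
        (\<Sum>j\<in>orders (k - 12). fps_const (c j) * form k (Suc j))"
      by (subst sum.reindex) (auto simp: c'_def)
    also have "\<dots> = disc * y"
    proof -
      have "form k (Suc j) = disc * form (k - 12) j" for j
        by (simp add: form_def algebra_simps)
      thus ?thesis unfolding c sum_distrib_left by (simp add: mult_ac)
    qed
    finally show ?thesis using y(2) by (intro exI[of _ c']) (simp add: form_def c'_def)
  qed
qed

lemma fps_nth_form:
  "n < j \<Longrightarrow> fps_nth (form k j) n = 0" "fps_nth (form k j) j = fps_nth disc 1 ^ j"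
proof -
  have "disc = fps_X * fps_shift 1 disc"
    using disc_0 by (intro fps_ext) (auto simp: not_less_eq split: nat.splits)
  hence "form k j = fps_X ^ j * (fps_shift 1 disc ^ j * Cmon (k - 12 * int j))"
    unfolding form_def by (metis mult.assoc power_mult_distrib)
  thus "n < j \<Longrightarrow> fps_nth (form k j) n = 0" "fps_nth (form k j) j = fps_nth disc 1 ^ j"
    by (simp_all add: fps_X_power_mult_nth Cmon_0 fps_nth_power_0)
qed

lemma form_independent:
  assumes "(\<Sum>j\<in>orders k. fps_const (c j) * form k j) = 0" "j \<in> orders k"
  shows "c j = 0"
  using assms(2)
proof (induction j rule: less_induct)
  case (less j)
  have "0 = fps_nth (\<Sum>i\<in>orders k. fps_const (c i) * form k i) j" by (simp add: assms(1))
  also have "\<dots> = (\<Sum>i\<in>orders k. c i * fps_nth (form k i) j)" by (simp add: fps_sum_nth)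
  also have "\<dots> = (\<Sum>i\<in>{j}. c i * fps_nth (form k i) j)"
  proof (intro sum.mono_neutral_right finite_orders ballI)
    fix i assume "i \<in> orders k - {j}"
    thus "c i * fps_nth (form k i) j = 0"
      using less.IH[of i] fps_nth_form(1)[of j i k] by (cases "i < j") auto
  qed (use less.prems in auto)
  finally show "c j = 0" using disc1 by (simp add: fps_nth_form(2) disc_def)
qed

end

section \<open>The dimension against the largest order\<close>

definition basis_idx :: "nat \<Rightarrow> nat \<Rightarrow> (nat \<times> nat) set" where
  "basis_idx w r = (SIGMA l:{..r}. orders (int w - 2 * int l))"

lemma finite_basis_idx: "finite (basis_idx w r)"
  unfolding basis_idx_def using finite_orders by auto

text \<open>\<open>B\<close> covers all differences between an even residue modulo 12 and
  \<open>2 l\<close> for \<open>l <= 4\<close>. The next value \<open>- 10\<close> would break the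
  pattern: \<open>12 - 10 = 2\<close> is not admissible, so one more order is lost.\<close>

lemma card_orders:
  assumes "B \<in> {-8, -6, -4, -2, 0, 2, 4, 6, 8, 10}"
  shows "card (orders (12 * int A + B)) = A + (if B \<in> {0, 4, 6, 8, 10} then 1 else 0)"
proof -
  have "orders (12 * int A + B) = (if B \<in> {0, 4, 6, 8, 10} then {..A} else {..<A})"
  proof (rule Set.set_eqI)
    fix j
    show "j \<in> orders (12 * int A + B) \<longleftrightarrow> j \<in> (if B \<in> {0, 4, 6, 8, 10} then {..A} else {..<A})"
      using assms unfolding orders_def admissible_def mem_Collect_eq by (elim insertE emptyE; simp; presburger)
  qed
  thus ?thesis by simp
qed

text \<open>The order is at most \<open>(r + 1) * w / 12\<close> rounded down, and less than that if
  the remainder is 2, as weight 2 cannot be left over. That this stays below the dimension is a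
  check of five depths and six residues; for depth 5 and positive \<open>w\<close> divisible by 12
  the two numbers would be equal.\<close>

lemma order_less_card_basis_idx:
  assumes "r \<in> {0, 1, 2, 3, 4}" "even w"
    and n: "12 * int n + 4 * int a + 6 * int b = (int r + 1) * int w"
  shows "n < card (basis_idx w r)"
proof -
  define A where "A = w div 12"
  define B where "B = w mod 12"
  have w: "w = 12 * A + B" by (simp add: A_def B_def)
  have "B < 12" "even B" using assms(2) by (auto simp: B_def dvd_mod_iff)
  hence "B = 0 \<or> B = 2 \<or> B = 4 \<or> B = 6 \<or> B = 8 \<or> B = 10" by presburger
  hence B: "B \<in> {0, 2, 4, 6, 8, 10}" by simp
  have "card (basis_idx w r) = (\<Sum>l\<le>r. card (orders (int w - 2 * int l)))"
    unfolding basis_idx_def by (intro card_SigmaI) (auto intro: finite_orders)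
  also have "\<dots> = (\<Sum>l\<le>r. A + (if int B - 2 * int l \<in> {0, 4, 6, 8, 10} then 1 else 0))"
  proof (intro sum.cong refl)
    fix l assume "l \<in> {..r}"
    hence "l \<le> 4" using assms(1) by auto
    hence "l = 0 \<or> l = 1 \<or> l = 2 \<or> l = 3 \<or> l = 4" by presburger
    hence "int B - 2 * int l \<in> {-8, -6, -4, -2, 0, 2, 4, 6, 8, 10}"
      using B by (elim disjE insertE emptyE) simp_all
    from card_orders[OF this, of A]
    show "card (orders (int w - 2 * int l)) = A + (if int B - 2 * int l \<in> {0, 4, 6, 8, 10} then 1 else 0)"
      by (simp add: w algebra_simps)
  qed
  finally have card: "card (basis_idx w r) =
    (\<Sum>l\<le>r. A + (if int B - 2 * int l \<in> {0, 4, 6, 8, 10} then 1 else 0))" .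
  have "int (12 * n + 4 * a + 6 * b) = int ((r + 1) * (12 * A + B))"
    using n unfolding w by (simp add: algebra_simps)
  hence n': "12 * n + 4 * a + 6 * b = (r + 1) * (12 * A + B)"
    by (simp only: of_nat_eq_iff)
  have S: "{..0::nat} = {0}" "{..1::nat} = {0, 1}" "{..2::nat} = {0, 1, 2}"
    "{..3::nat} = {0, 1, 2, 3}" "{..4::nat} = {0, 1, 2, 3, 4}" by auto
  have "r = 0 \<or> r = 1 \<or> r = 2 \<or> r = 3 \<or> r = 4" using assms(1) by simp
  moreover have "n < (r + 1) * A + (r + 1) * B div 12 + (if (r + 1) * B mod 12 = 2 then 0 else 1)"
  proof -
    define M K where "M = (r + 1) * A" and "K = (r + 1) * B"
    have eq: "12 * n + (4 * a + 6 * b) = 12 * (M + K div 12) + K mod 12"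
      using n' by (simp add: M_def K_def algebra_simps)
    have "n \<le> x" if "12 * n + e = 12 * x + y" "y < 12" for e x y
      using that by linarith
    from this[OF eq] have "n \<le> M + K div 12" by simp
    moreover have "n \<noteq> M + K div 12" if "K mod 12 = 2"
    proof
      assume "n = M + K div 12"
      hence "4 * a + 6 * b = 2" using eq that by simp
      thus False by presburger
    qed
    ultimately show ?thesis by (auto simp: M_def K_def)
  qed
  ultimately show ?thesis using B unfolding card
    by (elim disjE insertE emptyE) (simp_all add: S)
qed

context ramanujan
begin

text \<open>The order bound turns vanishing of the first coefficients into vanishing of the whole
  q-series, and \<open>vanishing_isobaric\<close> turns this into vanishing of the
  polynomial.\<close>

lemma basis_nonvanishing:
  assumes r: "r \<in> {0, 1, 2, 3, 4}" and w: "even w" "4 \<le> w"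
    and char: "\<And>n. 0 < n \<Longrightarrow> n \<le> w \<Longrightarrow> of_nat n \<noteq> (0 :: 'a)"
    and zero: "\<And>n. n < card (basis_idx w r) \<Longrightarrow>
      fps_nth (\<Sum>(l, j)\<in>basis_idx w r. fps_const (c (l, j)) * (P ^ l * form (int w - 2 * int l) j)) n = 0"
    and i: "i \<in> basis_idx w r"
  shows "c i = 0"
proof -
  define g where "g = (\<lambda>l. \<Sum>j\<in>orders (int w - 2 * int l). fps_const (c (l, j)) * form (int w - 2 * int l) j)"
  define G where "G = (\<Sum>l\<le>r. monom (g l) l)"
  have cG: "coeff G l = (if l \<le> r then g l else 0)" for l
    by (simp add: G_def coeff_sum sum.delta if_distrib cong: if_cong)
  have deg: "degree G \<le> r" by (rule degree_le) (simp add: cG)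
  have "g l \<in> MF (int w - 2 * int l)" for l
    unfolding g_def by (intro MF_sum MF_scale form_MF)
  hence iso: "isobaric (int w) G" by (simp add: isobaric_def cG MF.zero)
  have "poly G P = (\<Sum>l\<le>r. g l * P ^ l)"
    by (simp add: G_def poly_sum poly_monom)
  also have "\<dots> = (\<Sum>l\<le>r. \<Sum>j\<in>orders (int w - 2 * int l). fps_const (c (l, j)) * (P ^ l * form (int w - 2 * int l) j))"
    by (simp add: g_def sum_distrib_left sum_distrib_right mult_ac)
  also have "\<dots> = (\<Sum>(l, j)\<in>basis_idx w r. fps_const (c (l, j)) * (P ^ l * form (int w - 2 * int l) j))"
    unfolding basis_idx_def by (subst sum.Sigma) (auto intro: finite_orders)
  finally have GP: "poly G P = (\<Sum>(l, j)\<in>basis_idx w r. fps_const (c (l, j)) * (P ^ l * form (int w - 2 * int l) j))" .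
  have "poly G P = 0"
  proof (rule ccontr)
    assume nz: "poly G P \<noteq> 0"
    have char': "of_nat n \<noteq> (0 :: 'a)" if "0 < n" "n \<le> r" for n
      using char[of n] that r w by auto
    obtain n a b where n: "subdegree (poly G P) \<le> n" "12 * int n + 4 * int a + 6 * int b = (int r + 1) * int w"
      using isobaric_order[OF iso deg nz char'] by blast
    have "n < card (basis_idx w r)" by (rule order_less_card_basis_idx[OF r w(1) n(2)])
    hence "fps_nth (poly G P) (subdegree (poly G P)) = 0"
      unfolding GP using zero n(1) unfolding GP by simp
    thus False using nz by simp
  qed
  hence "G = 0" by (rule vanishing_isobaric[OF iso _ char])
  obtain l j where lj: "i = (l, j)" "l \<le> r" "j \<in> orders (int w - 2 * int l)"
    using i by (auto simp: basis_idx_def)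
  have "g l = 0" using cG[of l] lj \<open>G = 0\<close> by simp
  thus ?thesis unfolding lj(1) g_def by (rule form_independent) (rule lj)
qed

end

text \<open>The products \<open>P^l * form\<close> written out over any commutative ring: the locale
  speaks about fields, but the matrix has to be integral.\<close>

definition basis_series :: "nat \<Rightarrow> nat \<times> nat \<Rightarrow> 'a::comm_ring_1 fps" where
  "basis_series w = (\<lambda>(l, j). E2_fps ^ l * ((E4_fps ^ 3 - E6_fps ^ 2) ^ j *
     (let k = int w - 2 * int l - 12 * int j in
      if k mod 4 = 2 then E4_fps ^ nat ((k - 6) div 4) * E6_fps else E4_fps ^ nat (k div 4))))"

lemma ofi_basis_series: "ofi (basis_series w i) = basis_series w i"
  by (simp add: basis_series_def Let_def split: prod.splits)

lemma basis_series_eq: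
  assumes "ramanujan E2_fps E4_fps (E6_fps :: 'a::field fps)"
  shows "basis_series w (l, j) = (E2_fps ^ l * ramanujan.form E4_fps E6_fps (int w - 2 * int l) j :: 'a fps)"
  by (simp add: basis_series_def ramanujan.form_def[OF assms] ramanujan.Cmon_def[OF assms]
      ramanujan.disc_def[OF assms] Let_def)

section \<open>The integral coefficient matrix and its reductions\<close>

definition basis_list :: "nat \<Rightarrow> nat \<Rightarrow> (nat \<times> nat) list" where
  "basis_list w r = (SOME xs. set xs = basis_idx w r \<and> distinct xs)"

lemma basis_list: "set (basis_list w r) = basis_idx w r" "distinct (basis_list w r)"
  using someI_ex[OF finite_distinct_list[OF finite_basis_idx]] by (auto simp: basis_list_def)

lemma length_basis_list: "length (basis_list w r) = card (basis_idx w r)"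
  using basis_list distinct_card by metis

lemma sum_basis_idx:
  "(\<Sum>i<card (basis_idx w r). f (basis_list w r ! i)) = sum f (basis_idx w r)"
  using sum.reindex_bij_betw[OF bij_betw_nth[OF basis_list(2) refl refl], of f w r]
  by (simp add: basis_list(1) length_basis_list)

definition coeff_mat :: "nat \<Rightarrow> nat \<Rightarrow> int mat" where
  "coeff_mat w r = mat (card (basis_idx w r)) (card (basis_idx w r))
     (\<lambda>(n, i). fps_nth (basis_series w (basis_list w r ! i)) n)"

text \<open>A kernel vector of the reduced matrix is a combination of the basis series whose first
  coefficients all vanish. Besides the prime fields, the complex numbers are an instance, which
  shows that the determinant is not 0.\<close>

lemma det_coeff_mat_nonzero:
  assumes r: "r \<in> {0, 1, 2, 3, 4}" and w: "even w" "4 \<le> w"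
    and char: "\<And>n. 0 < n \<Longrightarrow> n \<le> w \<Longrightarrow> of_nat n \<noteq> (0 :: 'a::field)"
  shows "of_int (Determinant.det (coeff_mat w r)) \<noteq> (0 :: 'a)"
proof
  assume 0: "of_int (Determinant.det (coeff_mat w r)) = (0 :: 'a)"
  define m where "m = card (basis_idx w r)"
  define A :: "'a mat" where "A = of_int_hom.mat_hom (coeff_mat w r)"
  have A: "A \<in> carrier_mat m m" by (simp add: A_def coeff_mat_def m_def)
  have "Determinant.det A = 0" unfolding A_def of_int_hom.hom_det by (rule 0)
  then obtain v where v: "v \<in> carrier_vec m" "v \<noteq> 0\<^sub>v m" "A *\<^sub>v v = 0\<^sub>v m"
    using det_0_iff_vec_prod_zero[OF A] by blast
  \<comment> \<open>From \<open>4 <= w\<close>, the integers 2 and 3 are invertible, hence also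
    1728, the value in \<open>disc1\<close>.\<close>
  have "(2 :: 'a) \<noteq> 0" "(3 :: 'a) \<noteq> 0" using char[of 2] char[of 3] w by simp_all
  moreover have "(1728 :: 'a) = 2 ^ 6 * 3 ^ 3" by simp
  ultimately have "(1728 :: 'a) \<noteq> 0" by (metis mult_eq_0_iff power_not_zero)
  hence ram: "ramanujan E2_fps E4_fps (E6_fps :: 'a fps)" by (rule ramanujan_Eisenstein)
  define c where "c = (\<lambda>x. vec_index v (inv_into {..<m} ((!) (basis_list w r)) x))"
  have inj: "inj_on ((!) (basis_list w r)) {..<m}"
    using basis_list(2)[of w r] length_basis_list[of w r] by (auto simp: inj_on_def m_def nth_eq_iff_index_eq)
  have c: "c (basis_list w r ! i) = vec_index v i" if "i < m" for i
    using inv_into_f_f[OF inj, of i] that by (simp add: c_def)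
  have "c x = 0" if x: "x \<in> basis_idx w r" for x
  proof (rule ramanujan.basis_nonvanishing[OF ram r w char _ x])
    fix n assume n: "n < card (basis_idx w r)"
    have "fps_nth (\<Sum>(l, j)\<in>basis_idx w r. fps_const (c (l, j)) *
        (E2_fps ^ l * ramanujan.form E4_fps E6_fps (int w - 2 * int l) j)) n =
      fps_nth (\<Sum>x\<in>basis_idx w r. fps_const (c x) * basis_series w x) n"
    proof -
      have "(basis_series w x :: 'a fps) = E2_fps ^ fst x * ramanujan.form E4_fps E6_fps (int w - 2 * int (fst x)) (snd x)" for x
        using basis_series_eq[OF ram, of w "fst x" "snd x"] by simp
      thus ?thesis by (simp add: case_prod_unfold)
    qed
    also have "\<dots> = (\<Sum>x\<in>basis_idx w r. c x * fps_nth (basis_series w x) n)"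
      by (simp add: fps_sum_nth)
    also have "\<dots> = (\<Sum>i<m. c (basis_list w r ! i) * fps_nth (basis_series w (basis_list w r ! i)) n)"
      unfolding m_def by (rule sum_basis_idx [symmetric])
    also have "\<dots> = (\<Sum>i<m. A $$ (n, i) * vec_index v i)"
    proof (intro sum.cong refl)
      fix i assume "i \<in> {..<m}"
      moreover have "fps_nth (basis_series w x) n = (of_int (fps_nth (basis_series w x) n) :: 'a)" for x
        by (metis ofi_basis_series ofi_nth)
      ultimately show "c (basis_list w r ! i) * fps_nth (basis_series w (basis_list w r ! i)) n = A $$ (n, i) * vec_index v i"
        using n c[of i] by (simp add: A_def coeff_mat_def m_def)
    qed
    also have "\<dots> = vec_index (A *\<^sub>v v) n"
      using v(1) A n by (simp add: m_def scalar_prod_def atLeast0LessThan)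
    also have "\<dots> = 0" using v(3) n by (simp add: m_def)
    finally show "fps_nth (\<Sum>(l, j)\<in>basis_idx w r. fps_const (c (l, j)) *
        (E2_fps ^ l * ramanujan.form E4_fps E6_fps (int w - 2 * int l) j)) n = 0" .
  qed
  hence "vec_index v i = 0" if "i < m" for i
    using c[OF that] basis_list(1)[of w r] length_basis_list[of w r] that nth_mem by (metis m_def)
  hence "v = 0\<^sub>v m" using v(1) by (intro eq_vecI) auto
  thus False using v(2) by blast
qed

text \<open>
  Reduction modulo an arbitrary prime needs a field type of that characteristic, and types cannot
  depend on variables. It is enough to treat one closed term, a counterexample chosen by \<open>SOME\<close>.
\<close>
definition bad_prime :: "nat \<Rightarrow> bool" where
  "bad_prime p \<longleftrightarrow> prime p \<and> (\<exists>w r. r \<in> {0, 1, 2, 3, 4} \<and> even w \<and> 4 \<le> w \<and> w < p \<and>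
     int p dvd Determinant.det (coeff_mat w r))"

text \<open>The default 2 keeps the number prime in the absence of a counterexample, as the type
  \<open>residue\<close> requires.\<close>

definition chosen_prime :: nat where
  "chosen_prime = (if Ex bad_prime then Eps bad_prime else 2)"

lemma bad_chosen_prime: "bad_prime p \<Longrightarrow> bad_prime chosen_prime"
  unfolding chosen_prime_def using someI[of bad_prime p] by auto

lemma prime_chosen_prime: "prime chosen_prime"
proof (cases "Ex bad_prime")
  case True
  thus ?thesis using bad_chosen_prime unfolding bad_prime_def by blast
next
  case False
  hence "chosen_prime = 2" unfolding chosen_prime_def by (rule if_not_P)
  thus ?thesis by (metis two_is_prime_nat)
qed

typedef residue = "{0..<chosen_prime}"
  using prime_gt_0_nat[OF prime_chosen_prime] by (intro exI[of _ 0]) simp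

lemma card_residue: "CARD(residue) = chosen_prime"
  using type_definition.card[OF type_definition_residue] by simp

instance residue :: prime_card
  by intro_classes (simp add: card_residue prime_chosen_prime)

lemma not_bad_prime: "\<not> bad_prime p"
proof
  assume "bad_prime p"
  hence "bad_prime chosen_prime" by (rule bad_chosen_prime)
  then obtain w r where wr: "r \<in> {0, 1, 2, 3, 4}" "even w" "4 \<le> w" "w < chosen_prime"
    "int chosen_prime dvd Determinant.det (coeff_mat w r)"
    by (auto simp: bad_prime_def)
  have "of_int (Determinant.det (coeff_mat w r)) \<noteq> (0 :: residue mod_ring)"
  proof (rule det_coeff_mat_nonzero[OF wr(1-3)])
    fix n assume "0 < n" "n \<le> w"
    thus "of_nat n \<noteq> (0 :: residue mod_ring)"
      using wr(4) by (simp add: of_nat_eq_0_iff_char_dvd card_residue nat_dvd_not_less)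
  qed
  thus False using wr(5) by (simp add: of_int_eq_0_iff_char_dvd card_residue)
qed

section \<open>Extremal quasimodular forms\<close>

definition qf :: "complex fps \<Rightarrow> complex \<Rightarrow> complex" where
  "qf F z = (if Im z > 0 then ev F z else 0)"

lemma has_q_expansion_qf: "rad1 F \<Longrightarrow> has_q_expansion (qf F) F"
  by (simp add: has_q_expansion_iff qf_def)

text \<open>One direction looks at \<open>- 1 / z\<close> alone and applies
  \<open>mform_imp_MF\<close>; in the other, \<open>mform_moebius\<close> supplies all
  matrices.\<close>

lemma modular_forms_iff:
  assumes "even k"
  shows "f \<in> modular_forms k \<longleftrightarrow> (\<exists>F\<in>C.MF k. f = qf F)"
proof
  assume f: "f \<in> modular_forms k"
  then obtain F where F: "has_q_expansion f F" by (auto simp: modular_forms_def)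
  hence F': "rad1 F" "\<And>z. Im z > 0 \<Longrightarrow> f z = ev F z" by (auto simp: has_q_expansion_iff)
  have "mform k F"
    unfolding mform_def
  proof (intro conjI allI impI F'(1))
    fix z :: complex assume z: "Im z > 0"
    have "\<forall>a b c d :: int. a * d - b * c = 1 \<longrightarrow> (\<forall>z\<in>\<H>. f ((of_int a * z + of_int b) / (of_int c * z + of_int d)) =
                 (of_int c * z + of_int d) powi k * f z)"
      using f by (simp add: modular_forms_def)
    \<comment> \<open>The variables are instantiated in their order of appearance \<open>a\<close>,
      \<open>d\<close>, \<open>b\<close>, \<open>c\<close>, so this is the matrix with rows
      \<open>0, -1\<close> and \<open>1, 0\<close>.\<close>
    from this[rule_format, of 0 0 "-1" 1 z] z have "f (- 1 / z) = z powi k * f z"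
      by (simp add: upper_half_plane_def)
    thus "ev F (- 1 / z) = z powi k * ev F z"
      using F'(2)[OF z] F'(2)[OF Im_inverse_pos[OF z]] by simp
  qed
  hence "F \<in> C.MF k" by (rule mform_imp_MF[OF assms])
  moreover have "f = qf F"
    using f F'(2) by (auto simp: fun_eq_iff qf_def modular_forms_def upper_half_plane_def)
  ultimately show "\<exists>F\<in>C.MF k. f = qf F" by blast
next
  assume "\<exists>F\<in>C.MF k. f = qf F"
  then obtain F where F: "mform k F" "f = qf F" using MF_imp_mform by blast
  have rad: "rad1 F" using F by (simp add: mform_def)
  have "ev F holomorphic_on \<H>"
    unfolding holomorphic_on_def upper_half_plane_def
    using ev_has_derivative[OF rad] by (auto simp: field_differentiable_def intro: has_field_derivative_at_within)
  hence "f holomorphic_on \<H>"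
    by (rule holomorphic_transform) (simp add: F qf_def upper_half_plane_def)
  moreover have "f ((of_int a * z + of_int b) / (of_int c * z + of_int d)) =
      (of_int c * z + of_int d) powi k * f z" if "a * d - b * c = 1" "Im z > 0" for a b c d :: int and z
    using mform_moebius[OF F(1) assms that] Im_moebius_pos[OF that] that(2)
    unfolding F(2) qf_def by (simp only: if_True)
  ultimately show "f \<in> modular_forms k"
    using has_q_expansion_qf[OF rad] F(2)
    by (auto simp: modular_forms_def upper_half_plane_def qf_def)
qed

lemma rad1_MF: "F \<in> C.MF k \<Longrightarrow> rad1 F"
  using MF_imp_mform mform_rad1 by blast

lemma rad1_sum: "(\<And>i. i \<in> A \<Longrightarrow> rad1 (f i)) \<Longrightarrow> rad1 (sum f A)"
  by (induction A rule: infinite_finite_induct) (auto intro: rad1_add rad1_0)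

lemma ev_0 [simp]: "ev 0 z = 0"
  by (simp add: ev_def)

lemma ev_sum: "(\<And>i. i \<in> A \<Longrightarrow> rad1 (f i)) \<Longrightarrow> Im z > 0 \<Longrightarrow> ev (sum f A) z = (\<Sum>i\<in>A. ev (f i) z)"
  by (induction A rule: infinite_finite_induct) (auto simp: ev_add rad1_sum)

lemma basis_series_complex: "basis_series w (l, j) = E2_fps ^ l * C.form (int w - 2 * int l) j"
  by (rule basis_series_eq) (rule C.ramanujan_axioms)

lemma rad1_basis_series: "i \<in> basis_idx w r \<Longrightarrow> rad1 (basis_series w i)"
  using C.form_MF rad1_MF
  by (cases i) (auto simp: basis_idx_def basis_series_complex intro!: rad1_mult rad1_power rad1_E2)

lemma quasimodular_expansion:
  assumes "f \<in> quasimodular_forms w r" "even w"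
  obtains c where "f = qf (\<Sum>i\<in>basis_idx w r. fps_const (c i) * basis_series w i)"
proof -
  obtain g where g: "f = (\<lambda>z. \<Sum>l\<le>r. E2 z ^ l * g l z)" "\<And>l. l \<le> r \<Longrightarrow> g l \<in> modular_forms (int w - 2 * int l)"
    using assms(1) by (auto simp: quasimodular_forms_def)
  have "\<exists>F\<in>C.MF (int w - 2 * int l). g l = qf F" if "l \<le> r" for l
    using g(2)[OF that] assms(2) by (subst (asm) modular_forms_iff) auto
  then obtain F where F: "\<And>l. l \<le> r \<Longrightarrow> F l \<in> C.MF (int w - 2 * int l)" "\<And>l. l \<le> r \<Longrightarrow> g l = qf (F l)"
    by metis
  have "\<exists>c. F l = (\<Sum>j\<in>orders (int w - 2 * int l). fps_const (c j) * C.form (int w - 2 * int l) j)" if "l \<le> r" for l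
    by (rule C.MF_expand[OF F(1)[OF that]])
  then obtain c where c: "\<And>l. l \<le> r \<Longrightarrow>
      F l = (\<Sum>j\<in>orders (int w - 2 * int l). fps_const (c l j) * C.form (int w - 2 * int l) j)"
    by metis
  have rad: "rad1 (E2_fps ^ l * F l)" if "l \<le> r" for l
    using rad1_MF[OF F(1)[OF that]] by (intro rad1_mult rad1_power rad1_E2)
  have "(\<Sum>l\<le>r. E2_fps ^ l * F l) =
      (\<Sum>l\<le>r. \<Sum>j\<in>orders (int w - 2 * int l). fps_const (c l j) * basis_series w (l, j))"
    using c by (intro sum.cong) (auto simp: basis_series_complex sum_distrib_left mult_ac)
  also have "\<dots> = (\<Sum>(l, j)\<in>basis_idx w r. fps_const (c l j) * basis_series w (l, j))"
    unfolding basis_idx_def by (subst sum.Sigma) (auto intro: finite_orders)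
  finally have S: "(\<Sum>l\<le>r. E2_fps ^ l * F l) =
      (\<Sum>i\<in>basis_idx w r. fps_const (c (fst i) (snd i)) * basis_series w i)"
    by (simp add: case_prod_unfold)
  have "f = qf (\<Sum>l\<le>r. E2_fps ^ l * F l)"
  proof
    fix z
    show "f z = qf (\<Sum>l\<le>r. E2_fps ^ l * F l) z"
    proof (cases "Im z > 0")
      case True
      have "ev (\<Sum>l\<le>r. E2_fps ^ l * F l) z = (\<Sum>l\<le>r. ev (E2_fps ^ l * F l) z)"
        using rad True by (intro ev_sum) auto
      also have "\<dots> = (\<Sum>l\<le>r. E2 z ^ l * ev (F l) z)"
        using True rad1_MF[OF F(1)] by (intro sum.cong) (auto simp: ev_mult ev_power ev_E2 rad1_power rad1_E2)
      finally show ?thesis using True F(2) by (simp add: g(1) qf_def)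
    qed (use F(2) in \<open>simp add: g(1) qf_def\<close>)
  qed
  thus ?thesis unfolding S by (rule that)
qed

lemma basis_series_quasimodular:
  assumes "i \<in> basis_idx w r" "even w"
  shows "qf (basis_series w i) \<in> quasimodular_forms w r"
proof -
  obtain l j where i: "i = (l, j)" "l \<le> r" "j \<in> orders (int w - 2 * int l)"
    using assms by (auto simp: basis_idx_def)
  define F where "F = C.form (int w - 2 * int l) j"
  have F: "F \<in> C.MF (int w - 2 * int l)" unfolding F_def by (rule C.form_MF[OF i(3)])
  define g where "g = (\<lambda>l'. if l' = l then qf F else qf 0)"
  have "g l' \<in> modular_forms (int w - 2 * int l')" for l'
    using F assms(2) by (subst modular_forms_iff) (auto simp: g_def intro: C.MF.zero)
  moreover have "qf (basis_series w i) = (\<lambda>z. \<Sum>l'\<le>r. E2 z ^ l' * g l' z)"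
  proof
    fix z
    have "(\<Sum>l'\<le>r. E2 z ^ l' * g l' z) = (\<Sum>l'\<in>{l}. E2 z ^ l' * g l' z)"
      using i(2) by (intro sum.mono_neutral_right) (auto simp: g_def qf_def ev_def)
    also have "\<dots> = qf (basis_series w i) z"
      using rad1_MF[OF F]
      by (simp add: g_def qf_def i(1) basis_series_complex ev_mult ev_power ev_E2 rad1_power rad1_E2
          flip: F_def)
    finally show "qf (basis_series w i) z = (\<Sum>l'\<le>r. E2 z ^ l' * g l' z)" ..
  qed
  ultimately show ?thesis unfolding quasimodular_forms_def by blast
qed

lemma qf_combination:
  assumes "\<And>i. i \<in> A \<Longrightarrow> rad1 (b i)"
  shows "qf (\<Sum>i\<in>A. fps_const (c i) * b i) z = (\<Sum>i\<in>A. c i * qf (b i) z)"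
  using assms by (simp add: qf_def ev_sum ev_mult rad1_mult rad1_const)

lemma sum_fun_apply: "(\<Sum>i\<in>A. f i) z = (\<Sum>i\<in>A. f i z)"
  for f :: "'b \<Rightarrow> 'c \<Rightarrow> 'd::comm_monoid_add"
  by (induction A rule: infinite_finite_induct) auto

lemma basis_independent:
  assumes r: "r \<in> {0, 1, 2, 3, 4}" and w: "even w" "4 \<le> w"
    and zero: "\<And>z. (\<Sum>i\<in>basis_idx w r. c i * qf (basis_series w i) z) = 0" and i: "i \<in> basis_idx w r"
  shows "c i = 0"
proof -
  define H where "H = (\<Sum>i\<in>basis_idx w r. fps_const (c i) * basis_series w i)"
  have "H = 0"
  proof (rule ev_eqD)
    show "rad1 H" unfolding H_def by (intro rad1_sum rad1_mult rad1_const rad1_basis_series)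
    fix z :: complex assume "Im z > 0"
    thus "ev H z = ev 0 z"
      using zero[of z] qf_combination[of "basis_idx w r" "basis_series w" c z] rad1_basis_series
      by (simp add: H_def qf_def ev_def)
  qed (rule rad1_0)
  show ?thesis
  proof (rule C.basis_nonvanishing[OF r w _ _ i])
    fix n
    have "H = (\<Sum>(l, j)\<in>basis_idx w r. fps_const (c (l, j)) * (E2_fps ^ l * C.form (int w - 2 * int l) j))"
      unfolding H_def by (intro sum.cong) (auto simp: basis_series_complex)
    thus "fps_nth (\<Sum>(l, j)\<in>basis_idx w r. fps_const (c (l, j)) * (E2_fps ^ l * C.form (int w - 2 * int l) j)) n = 0"
      using \<open>H = 0\<close> by simp
  qed simp
qed

lemma dim_quasimodular_forms:
  assumes r: "r \<in> {0, 1, 2, 3, 4}" and w: "even w" "4 \<le> w"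
  shows "cfun_dim (quasimodular_forms w r) = card (basis_idx w r)"
proof -
  define \<beta> where "\<beta> = (\<lambda>i. qf (basis_series w i))"
  define I where "I = basis_idx w r"
  have ind: "c i = 0" if "\<And>z. (\<Sum>i\<in>I. c i * \<beta> i z) = 0" "i \<in> I" for c i
    using basis_independent[OF r w] that unfolding \<beta>_def I_def by blast
  have inj: "inj_on \<beta> I"
  proof (rule inj_onI, rule ccontr)
    fix i j assume ij: "i \<in> I" "j \<in> I" "\<beta> i = \<beta> j" "i \<noteq> j"
    define c :: "nat \<times> nat \<Rightarrow> complex" where "c = (\<lambda>x. if x = i then 1 else if x = j then -1 else 0)"
    have "(\<Sum>x\<in>I. c x * \<beta> x z) = (\<Sum>x\<in>{i, j}. c x * \<beta> x z)" for z
      using ij finite_basis_idx by (intro sum.mono_neutral_right) (auto simp: c_def I_def)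
    also have "(\<Sum>x\<in>{i, j}. c x * \<beta> x z) = 0" for z using ij by (simp add: c_def)
    finally have "c i = 0" using ind ij(1) by blast
    thus False by (simp add: c_def)
  qed
  show ?thesis
  proof (rule cfun.dim_unique)
    show "\<beta> ` I \<subseteq> quasimodular_forms w r"
      using basis_series_quasimodular w(1) by (auto simp: \<beta>_def I_def)
    show "quasimodular_forms w r \<subseteq> cfun.span (\<beta> ` I)"
    proof
      fix f assume "f \<in> quasimodular_forms w r"
      then obtain c where c: "f = qf (\<Sum>i\<in>I. fps_const (c i) * basis_series w i)"
        using quasimodular_expansion[OF _ w(1)] unfolding I_def by blast
      have "f = (\<Sum>i\<in>I. (\<lambda>z. c i * \<beta> i z))"
        unfolding c using rad1_basis_series
        by (intro ext) (simp add: sum_fun_apply qf_combination \<beta>_def I_def)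
      also have "\<dots> \<in> cfun.span (\<beta> ` I)"
        by (intro cfun.span_sum cfun.span_scale cfun.span_base) auto
      finally show "f \<in> cfun.span (\<beta> ` I)" .
    qed
    show "cfun.independent (\<beta> ` I)"
    proof (rule cfun.independent_if_scalars_zero)
      show "finite (\<beta> ` I)" using finite_basis_idx by (simp add: I_def)
      fix u x assume u: "(\<Sum>x\<in>\<beta> ` I. (\<lambda>z. u x * x z)) = 0" and "x \<in> \<beta> ` I"
      then obtain i where i: "i \<in> I" "x = \<beta> i" by blast
      have "(\<Sum>i\<in>I. u (\<beta> i) * \<beta> i z) = 0" for z
        using fun_cong[OF u, of z] by (simp add: sum_fun_apply sum.reindex[OF inj])
      thus "u x = 0" using ind[of "\<lambda>i. u (\<beta> i)" i] i by simp
    qed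
    show "card (\<beta> ` I) = card (basis_idx w r)" using card_image[OF inj] by (simp add: I_def)
  qed
qed

section \<open>Denominators of the coefficients\<close>

lemma snd_quotient_of_dvd:
  assumes "d \<noteq> 0"
  shows "snd (quotient_of (of_int a / of_int d)) dvd d"
proof -
  obtain n e where ne: "quotient_of (of_int a / of_int d) = (n, e)" by (cases "quotient_of (of_int a / of_int d)")
  have e: "e > 0" "coprime n e" using quotient_of_denom_pos[OF ne] quotient_of_coprime[OF ne] by auto
  have "(of_int a / of_int d :: rat) = of_int n / of_int e" by (rule quotient_of_div[OF ne])
  hence "(of_int (a * e) :: rat) = of_int (n * d)" using assms e(1) by (simp add: field_simps)
  hence "a * e = n * d" by (simp only: of_int_eq_iff)
  hence "e dvd n * d" by (metis dvd_triv_right)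
  thus ?thesis using e(2) ne by (simp add: coprime_dvd_mult_right_iff coprime_commute)
qed

lemma integral_combination:
  assumes r: "r \<in> {0, 1, 2, 3, 4}" and w: "even w" "4 \<le> w"
    and H: "H = (\<Sum>i\<in>basis_idx w r. fps_const (c i) * (basis_series w i :: complex fps))"
    and int: "\<And>n. n < card (basis_idx w r) \<Longrightarrow> fps_nth H n \<in> \<int>"
  shows "of_int (Determinant.det (coeff_mat w r)) * fps_nth H n \<in> \<int>"
proof -
  define m where "m = card (basis_idx w r)"
  define A where "A = coeff_mat w r"
  define b where "b = basis_list w r"
  have A: "A \<in> carrier_mat m m" by (simp add: A_def coeff_mat_def m_def)
  have nth: "fps_nth (basis_series w x) k = (of_int (fps_nth (basis_series w x) k) :: complex)" for x k
    by (metis ofi_basis_series ofi_nth)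
  have Hn: "fps_nth H k = (\<Sum>i<m. c (b ! i) * of_int (fps_nth (basis_series w (b ! i)) k))" for k
  proof -
    have "fps_nth H k = (\<Sum>x\<in>basis_idx w r. c x * of_int (fps_nth (basis_series w x) k))"
      unfolding H by (simp add: fps_sum_nth nth)
    thus ?thesis
      using sum_basis_idx[of "\<lambda>x. c x * of_int (fps_nth (basis_series w x) k)" w r]
      by (simp add: m_def b_def)
  qed
  have intC: "of_int (Determinant.det A) * c (b ! i) \<in> \<int>" if i: "i < m" for i
  proof -
    \<comment> \<open>Cramer's rule with the adjugate: \<open>det A\<close> times a coordinate is an
      integral combination of the first \<open>m\<close> coefficients of \<open>H\<close>.\<close>
    define B where "B = adj_mat A"
    have B: "B \<in> carrier_mat m m" "B * A = Determinant.det A \<cdot>\<^sub>m 1\<^sub>m m"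
      using adj_mat[OF A] by (simp_all add: B_def)
    have BA: "(\<Sum>k<m. B $$ (i, k) * A $$ (k, i')) = (if i = i' then Determinant.det A else 0)" if i': "i' < m" for i'
    proof -
      have "(\<Sum>k<m. B $$ (i, k) * A $$ (k, i')) = (B * A) $$ (i, i')"
        using A B(1) i i' by (simp add: scalar_prod_def atLeast0LessThan)
      thus ?thesis unfolding B(2) using i i' by simp
    qed
    have "(\<Sum>k<m. of_int (B $$ (i, k)) * fps_nth H k) =
        (\<Sum>k<m. \<Sum>i'<m. of_int (B $$ (i, k) * A $$ (k, i')) * c (b ! i'))"
      unfolding Hn sum_distrib_left
      by (intro sum.cong refl) (simp add: A_def coeff_mat_def m_def b_def mult_ac)
    also have "\<dots> = (\<Sum>i'<m. of_int (\<Sum>k<m. B $$ (i, k) * A $$ (k, i')) * c (b ! i'))"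
      by (subst sum.swap) (simp add: sum_distrib_right)
    also have "\<dots> = (\<Sum>i'<m. if i = i' then of_int (Determinant.det A) * c (b ! i') else 0)"
      using BA by (intro sum.cong refl) auto
    also have "\<dots> = of_int (Determinant.det A) * c (b ! i)" using i by simp
    finally have "of_int (Determinant.det A) * c (b ! i) = (\<Sum>k<m. of_int (B $$ (i, k)) * fps_nth H k)" ..
    also have "\<dots> \<in> \<int>" using int by (intro Ints_sum Ints_mult) (auto simp: m_def)
    finally show ?thesis .
  qed
  have eq: "of_int (Determinant.det A) * fps_nth H n =
      (\<Sum>i<m. (of_int (Determinant.det A) * c (b ! i)) * of_int (fps_nth (basis_series w (b ! i)) n))"
    unfolding Hn sum_distrib_left by (simp add: mult_ac)
  show ?thesis unfolding A_def [symmetric] eq by (intro Ints_sum Ints_mult[OF intC]) auto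
qed

lemma basis_idx_2: "basis_idx 2 r = (if r = 0 then {} else {(1, 0)})"
proof -
  have "(l, j) \<in> basis_idx 2 r \<longleftrightarrow> l = 1 \<and> j = 0 \<and> r \<noteq> 0" for l j
    by (auto simp: basis_idx_def orders_def admissible_def; presburger)
  thus ?thesis by auto
qed

theorem theorem6p5:
  fixes r w :: nat and f :: "complex \<Rightarrow> complex"
  assumes "r \<in> {0, 1, 2, 3, 4}"
    and "w > 0" and "even w"
    and "extremal w r f" and "normalized f"
  shows "\<forall>n. \<exists>x :: rat. fps_nth (q_expansion f) n = of_rat x \<and>
           (\<forall>p :: nat. prime p \<and> int p dvd snd (quotient_of x) \<longrightarrow> p < w)"
proof -
  have f: "f \<in> quasimodular_forms w r" "f \<noteq> 0"
    "Suc (subdegree (q_expansion f)) = cfun_dim (quasimodular_forms w r)"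
    using assms(4) by (auto simp: extremal_def)
  obtain c where c: "f = qf (\<Sum>i\<in>basis_idx w r. fps_const (c i) * basis_series w i)"
    using quasimodular_expansion[OF f(1) assms(3)] by blast
  define H where "H = (\<Sum>i\<in>basis_idx w r. fps_const (c i) * basis_series w i)"
  have rad: "rad1 H" unfolding H_def by (intro rad1_sum rad1_mult rad1_const rad1_basis_series)
  have q: "q_expansion f = H"
    using has_q_expansion_qf[OF rad] by (intro q_expansion_eqI) (simp add: c H_def)
  have norm: "fps_nth H (subdegree H) = 1" using assms(5) by (simp add: normalized_def q)
  show ?thesis
  \<comment> \<open>In weight 2 the prime 3 exceeds \<open>w\<close>, but the argument by reduction
    inverts 2 and 3. Here the only possible basis element is \<open>E2\<close>, whose coefficients
    are integers.\<close>
  proof (cases "w = 2")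
    case True
    have "H \<noteq> 0" using norm by auto
    hence "r \<noteq> 0" by (intro notI) (simp add: H_def True basis_idx_2)
    hence H: "H = fps_const (c (1, 0)) * E2_fps"
      by (simp add: H_def True basis_idx_2 basis_series_def)
    hence "c (1, 0) \<noteq> 0" using \<open>H \<noteq> 0\<close> by auto
    hence "subdegree H = 0" by (simp add: H E2_nth subdegree_eq_0_iff)
    hence "c (1, 0) = 1" using norm by (simp add: H E2_nth)
    hence "H = E2_fps" using H by simp
    hence "fps_nth H n = of_int (fps_nth E2_fps n)" for n by (metis ofi_E2 ofi_nth)
    hence "fps_nth H n = of_rat (of_int (fps_nth E2_fps n))" for n by simp
    moreover have "\<not> int p dvd snd (quotient_of (of_int k))" if "prime p" for p k
      using that by auto
    ultimately show ?thesis unfolding q by blast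
  next
    case False
    hence w: "4 \<le> w" using assms(2,3) by presburger
    define d where "d = Determinant.det (coeff_mat w r)"
    have d: "\<not> int p dvd d" if "prime p" "w < p" for p
      using not_bad_prime[of p] that assms(1,3) w unfolding bad_prime_def d_def by blast
    have "d \<noteq> 0"
      using det_coeff_mat_nonzero[OF assms(1,3) w, where 'a = complex] by (auto simp: d_def)
    have "Suc (subdegree H) = card (basis_idx w r)"
      using f(3) unfolding q dim_quasimodular_forms[OF assms(1,3) w] .
    \<comment> \<open>The order is one less than the number of basis elements, so the coefficients
      entering the linear system are zeros followed by the normalized 1.\<close>
    hence "n = subdegree H \<or> n < subdegree H" if "n < card (basis_idx w r)" for n
      using that by linarith
    hence "fps_nth H n \<in> \<int>" if "n < card (basis_idx w r)" for n
      using that norm nth_less_subdegree_zero[of n H] by fastforce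
    hence int: "of_int d * fps_nth H n \<in> \<int>" for n
      using integral_combination[OF assms(1,3) w H_def] unfolding d_def by blast
    show ?thesis
    proof
      fix n
      from int[of n] obtain a where a: "of_int d * fps_nth H n = of_int a" by (rule Ints_cases)
      have "fps_nth H n = of_int a / of_int d" using a \<open>d \<noteq> 0\<close> by (simp add: field_simps)
      hence "fps_nth H n = of_rat (of_int a / of_int d)" by (simp add: of_rat_divide)
      moreover have "p < w" if p: "prime p" "int p dvd snd (quotient_of (of_int a / of_int d))" for p
      proof -
        have "int p dvd d" using p(2) snd_quotient_of_dvd[OF \<open>d \<noteq> 0\<close>] by (rule dvd_trans)
        hence "p \<le> w" using d[OF p(1)] by (meson not_le)
        \<comment> \<open>The determinant excludes only \<open>p > w\<close>; the case
          \<open>p = w\<close> fails because \<open>w\<close> is even and at least 4.\<close>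
        moreover have "p \<noteq> w" using p(1) assms(3) w prime_nat_iff[of w] by (auto dest: prime_odd_nat)
        ultimately show ?thesis by simp
      qed
      ultimately show "\<exists>x. fps_nth (q_expansion f) n = of_rat x \<and>
           (\<forall>p. prime p \<and> int p dvd snd (quotient_of x) \<longrightarrow> p < w)"
        unfolding q by blast
    qed
  qed
qed

end
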